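(* The property for a tropical fan to be div-faithful is shellable. That is, if $\mathcal S$ is the class of div-faithful tropical fans, then $\mathrm{Sh}(\mathcal S)=\mathcal S$, where $\mathrm{Sh}=\mathrm{Sh}_{\mathcal C}$ for $\mathcal C$ the class of all tropical fans.
   Context: **Fans.** $N$ is a free $\mathbb Z$-module of finite rank, $N_{\mathbb R}=N\otimes\mathbb R$. A rational fan $\Sigma$ in $N_{\mathbb R}$ is a non-empty finite collection of strongly convex rational polyhedral cones, closed under taking faces, any two of which meet along a common face. $|\Sigma|$ is the support, $\Sigma_k$ the set of $k$-dimensional cones; $\tau\prec\sigma$ means that $\tau$ is a face of $\sigma$. Put $N_\sigma=N\cap\mathrm{span}(\sigma)$, $N^\sigma=N/N_\sigma$. The star fan $\Sigma^\sigma$ is the fan in $N^\sigma_{\mathbb R}$ formed by the images of the cones of $\Sigma$ containing $\sigma$. If $\tau\prec\sigma$ has codimension one, $e^\tau_\sigma$ is the generator of $N_\sigma/N_\tau$ lying in the image of $\sigma$, and $\mathfrak n_{\sigma/\tau}\in N_\sigma$ is any lift of it. A tropical fan of dimension $d$ is a rational fan of pure dimension $d$ with $\sum_{\sigma\in\Sigma_d,\sigma\supset\tau}e^\tau_\sigma=0$ in $N^\tau$ for every $\tau\in\Sigma_{d-1}$. Fans are considered modulo isomorphism: two rational fans are isomorphic if there is a linear isomorphism between the subspaces they span, identifying the induced lattices, and mapping cones to cones bijectively. **Div-faithfulness.** A conewise integral linear function on a tropical fan $\Sigma$ of dimension $d$ is a continuous $f\colon|\Sigma|\to\mathbb R$ whose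 restriction to each cone $\sigma$ is given by an integral linear form $f_\sigma$ on $N_\sigma$. For $\tau\in\Sigma_{d-1}$ put $\mathrm{ord}_\tau(f)=-\sum_{\sigma\in\Sigma_d,\sigma\supset\tau}f_\sigma(\mathfrak n_{\sigma/\tau})+f_\tau\bigl(\sum_{\sigma\in\Sigma_d,\sigma\supset\tau}\mathfrak n_{\sigma/\tau}\bigr)$. The divisor $\mathrm{div}(f)$ is the weight function $\tau\mapsto\mathrm{ord}_\tau(f)$; it is trivial if all weights vanish. A linear function on $\Sigma$ is the restriction to $|\Sigma|$ of a linear function on $N_{\mathbb R}$. $\Sigma$ is div-faithful if for every $\eta\in\Sigma$ and every conewise integral linear function $f$ on $\Sigma^\eta$ with $\mathrm{div}(f)$ trivial, $f$ is a linear function on $\Sigma^\eta$. **Tropical modification.** $\mathrm{div}(f)$ is reduced if all non-zero weights are equal to one, in which case it is identified with the subfan $\Delta$ of $\Sigma$ of all faces of the cones $\tau$ with $\mathrm{ord}_\tau(f)=1$ ($\Delta=\emptyset$ if $\mathrm{div}(f)$ is trivial; otherwise $\Delta$ is a tropical fan of dimension $d-1$). The tropical modification $\mathrm{TM}_f(\Sigma)$ is the tropical fan in $N_{\mathbb R}\times\mathbb R$, with lattice $N\times\mathbb Z$, formed by the cones $\{(x,f(x)):x\in\sigma\}$, $\sigma\in\Sigma$, and $\{(x,f(x)):x\in\delta\}+\mathbb R_+(0,1)$, $\delta\in\Delta$. **Blow-up.** For $\sigma\in\Sigma$ of dimension at least one and a rational ray $\rho$ in the relative interior of $\sigma$, $\Sigma_{(\rho)}$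 is the star subdivision of $\Sigma$ along $\rho$: remove all cones containing $\sigma$ and add the cones $\tau+\rho$ for all $\tau\in\Sigma$ not containing $\sigma$ which are faces of a cone of $\Sigma$ containing $\sigma$. **Shellability.** Let $\mathcal C$ be a class of tropical fans and $\mathcal B\subseteq\mathcal C$. $\mathrm{Sh}_{\mathcal C}(\mathcal B)$ is the smallest class of tropical fans, all in $\mathcal C$, such that: (i) $\mathcal B\subseteq\mathrm{Sh}_{\mathcal C}(\mathcal B)$; (ii) if $\Sigma,\Sigma'\in\mathrm{Sh}_{\mathcal C}(\mathcal B)$ and $\Sigma\times\Sigma'\in\mathcal C$, then $\Sigma\times\Sigma'\in\mathrm{Sh}_{\mathcal C}(\mathcal B)$; (iii) if $\Sigma\in\mathrm{Sh}_{\mathcal C}(\mathcal B)$ and $f$ is a conewise integral linear function on $\Sigma$ such that either $\mathrm{div}(f)$ is reduced and belongs to $\mathrm{Sh}_{\mathcal C}(\mathcal B)$, or $\mathrm{div}(f)$ is trivial, and if $\mathrm{TM}_f(\Sigma)\in\mathcal C$, then $\mathrm{TM}_f(\Sigma)\in\mathrm{Sh}_{\mathcal C}(\mathcal B)$; (iv) if $\Sigma\in\mathcal C$, $\sigma\in\Sigma$ and $\rho$ is a ray in the relative interior of $\sigma$ with $\Sigma^\sigma\in\mathrm{Sh}_{\mathcal C}(\mathcal B)$ and $\Sigma_{(\rho)}\in\mathcal C$, then $\Sigma\in\mathrm{Sh}_{\mathcal C}(\mathcal B)\iff\Sigma_{(\rho)}\in\mathrm{Sh}_{\mathcal C}(\mathcal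 B)$. A property $P$ is shellable in $\mathcal C$ if the subclass $\mathcal S$ of fans of $\mathcal C$ verifying $P$ satisfies $\mathrm{Sh}_{\mathcal C}(\mathcal S)=\mathcal S$; "shellable" without mention of $\mathcal C$ refers to the class of all tropical fans. *)

theory Defs
  imports "HOL-Analysis.Analysis" "HOL-Analysis.Finite_Function_Topology"
begin

text \<open>
  All fans live in the real vector space of finitely supported real sequences, which contains a
  copy of every \<open>N \<otimes> \<real>\<close>, for \<open>N\<close> a free \<open>\<int>\<close>-module of finite rank. Its
  topology is that of the \<open>\<ell>\<^sup>1\<close>-norm, hence the Euclidean one on finite-dimensional subspaces.
\<close>

type_synonym vec = "nat \<Rightarrow>\<^sub>0 real"

definition is_lattice :: "vec set \<Rightarrow> bool" where
  "is_lattice N \<longleftrightarrow>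
     (\<exists>B. finite B \<and> independent B \<and> N = {\<Sum>b\<in>B. of_int (k b) *\<^sub>R b | k :: vec \<Rightarrow> int. True})"

text \<open>
  Since a lattice has an \<open>\<real>\<close>-independent \<open>\<int>\<close>-basis, \<open>N \<otimes> \<real>\<close> is \<open>span N\<close>.
\<close>

datatype fan = Fan (lat: "vec set") (cones: "vec set set")

definition support :: "fan \<Rightarrow> vec set" where
  "support F = \<Union>(cones F)"

definition cone_face :: "vec set \<Rightarrow> vec set \<Rightarrow> bool" where
  "cone_face \<tau> \<sigma> \<longleftrightarrow> \<tau> face_of \<sigma> \<and> \<tau> \<noteq> {}"  \<comment> \<open>\<open>{}\<close> is a face of every set in the sense of \<open>face_of\<close>\<close>

definition rational_cone :: "vec set \<Rightarrow> vec set \<Rightarrow> bool" where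
  "rational_cone N \<sigma> \<longleftrightarrow> (\<exists>V. finite V \<and> V \<subseteq> N \<and> \<sigma> = convex_cone hull V)"

definition strongly_convex :: "vec set \<Rightarrow> bool" where
  "strongly_convex \<sigma> \<longleftrightarrow> \<sigma> \<inter> uminus ` \<sigma> = {0}"

definition rational_fan :: "fan \<Rightarrow> bool" where
  "rational_fan F \<longleftrightarrow>
     is_lattice (lat F) \<and> finite (cones F) \<and> cones F \<noteq> {} \<and>
     (\<forall>\<sigma>\<in>cones F. rational_cone (lat F) \<sigma> \<and> strongly_convex \<sigma>) \<and>
     (\<forall>\<sigma>\<in>cones F. \<forall>\<tau>. cone_face \<tau> \<sigma> \<longrightarrow> \<tau> \<in> cones F) \<and>
     (\<forall>\<sigma>\<in>cones F. \<forall>\<sigma>'\<in>cones F. cone_face (\<sigma> \<inter> \<sigma>') \<sigma> \<and> cone_face (\<sigma> \<inter> \<sigma>') \<sigma>')"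

definition pure_dim :: "fan \<Rightarrow> nat \<Rightarrow> bool" where
  "pure_dim F d \<longleftrightarrow>
     (\<forall>\<sigma>\<in>cones F. (\<forall>\<tau>\<in>cones F. \<sigma> \<subseteq> \<tau> \<longrightarrow> \<tau> = \<sigma>) \<longrightarrow> dim \<sigma> = d)"

definition fan_dim :: "fan \<Rightarrow> nat" where
  "fan_dim F = Max (dim ` cones F)"

text \<open>The cones of dimension \<open>d\<close> and \<open>d - 1\<close> in a fan of dimension \<open>d\<close>.\<close>

definition facets :: "fan \<Rightarrow> vec set set" where
  "facets F = {\<sigma> \<in> cones F. dim \<sigma> = fan_dim F}"

definition ridges :: "fan \<Rightarrow> vec set set" where
  "ridges F = {\<tau> \<in> cones F. dim \<tau> + 1 = fan_dim F}"

definition lat_of :: "vec set \<Rightarrow> vec set \<Rightarrow> vec set" where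
  "lat_of N \<sigma> = N \<inter> span \<sigma>"

text \<open>
  \<open>v\<close> is a lift of \<open>e\<^sup>\<tau>\<^sub>\<sigma>\<close>: its class generates \<open>N\<^sub>\<sigma>/N\<^sub>\<tau>\<close> and lies in the image of \<open>\<sigma>\<close>
  modulo the span of \<open>\<tau>\<close>.
\<close>

definition is_normal_vector :: "vec set \<Rightarrow> vec set \<Rightarrow> vec set \<Rightarrow> vec \<Rightarrow> bool" where
  "is_normal_vector N \<tau> \<sigma> v \<longleftrightarrow>
     v \<in> lat_of N \<sigma> \<and>
     (\<forall>x\<in>lat_of N \<sigma>. \<exists>k :: int. x - of_int k *\<^sub>R v \<in> lat_of N \<tau>) \<and>
     (\<exists>s\<in>\<sigma>. v - s \<in> span \<tau>)"

definition normal_vector :: "vec set \<Rightarrow> vec set \<Rightarrow> vec set \<Rightarrow> vec" where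
  "normal_vector N \<tau> \<sigma> = (SOME v. is_normal_vector N \<tau> \<sigma> v)"

definition normal_sum :: "fan \<Rightarrow> vec set \<Rightarrow> vec" where
  "normal_sum F \<tau> = (\<Sum>\<sigma> | \<sigma> \<in> facets F \<and> \<tau> \<subseteq> \<sigma>. normal_vector (lat F) \<tau> \<sigma>)"

text \<open>
  Vanishing of \<open>\<Sum> e\<^sup>\<tau>\<^sub>\<sigma>\<close> in \<open>N/N\<^sub>\<tau>\<close> says that the sum of the lifts lies in \<open>N\<^sub>\<tau>\<close>.
\<close>

definition tropical_fan :: "fan \<Rightarrow> bool" where
  "tropical_fan F \<longleftrightarrow>
     rational_fan F \<and> pure_dim F (fan_dim F) \<and>
     (\<forall>\<tau>\<in>ridges F. normal_sum F \<tau> \<in> lat_of (lat F) \<tau>)"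

definition fan_iso :: "fan \<Rightarrow> fan \<Rightarrow> bool" where
  "fan_iso F G \<longleftrightarrow>
     (\<exists>\<phi> :: vec \<Rightarrow> vec. linear \<phi> \<and>
        bij_betw \<phi> (span (support F)) (span (support G)) \<and>
        \<phi> ` lat_of (lat F) (support F) = lat_of (lat G) (support G) \<and>
        bij_betw ((`) \<phi>) (cones F) (cones G))"

text \<open>
  The quotient of the ambient space by a subspace \<open>V\<close> is realised inside the ambient space by the
  choice of a linear endomorphism with kernel \<open>V\<close>.
\<close>

definition quotient_map :: "vec set \<Rightarrow> vec \<Rightarrow> vec" where
  "quotient_map V = (SOME q. linear q \<and> {x. q x = 0} = V)"

lemma quotient_map:
  assumes "subspace V"
  shows "linear (quotient_map V)" and "{x. quotient_map V x = 0} = V"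
proof -
  obtain A where A: "A \<subseteq> V" "independent A" "span A = V"
    using real_vector.maximal_independent_subset[of V] assms real_vector.span_subspace by metis
  define B where "B = real_vector.extend_basis A"
  have B: "independent B" "A \<subseteq> B" "span B = UNIV"
    unfolding B_def
    using A(2) real_vector.independent_extend_basis real_vector.extend_basis_superset
      real_vector.span_extend_basis by auto
  obtain q :: "vec \<Rightarrow> vec" where q: "linear q" "\<forall>x\<in>B. q x = (if x \<in> A then 0 else x)"
    using linear_independent_extend[OF B(1), of "\<lambda>x. if x \<in> A then 0 else x"] by blast
  have zero: "q x = 0" if "x \<in> span A" for x
  proof (rule linear_eq_0_on_span[OF q(1) _ that])
    show "q a = 0" if "a \<in> A" for a using q(2) B(2) that by auto
  qed
  have fixed: "q x = x" if "x \<in> span (B - A)" for x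
  proof -
    have "q x = id x"
    proof (rule linear_eq_on[OF q(1) linear_id that])
      show "q b = id b" if "b \<in> B - A" for b using q(2) that by auto
    qed
    then show ?thesis by simp
  qed
  have "x \<in> V" if "q x = 0" for x
  proof -
    have "x \<in> span (A \<union> (B - A))"
      using B(2,3) by (simp add: Un_absorb1)
    then obtain a b where ab: "a \<in> span A" "b \<in> span (B - A)" "x = a + b"
      unfolding real_vector.span_Un by blast
    then have "b = 0"
      using that zero fixed linear_add[OF q(1)] by auto
    then show ?thesis using ab A(3) by simp
  qed
  then have "linear q \<and> {x. q x = 0} = V"
    using q(1) zero A(3) by auto
  then have "linear (quotient_map V) \<and> {x. quotient_map V x = 0} = V"
    unfolding quotient_map_def by (rule someI[where P = "\<lambda>q. linear q \<and> {x. q x = 0} = V"])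
  then show "linear (quotient_map V)" "{x. quotient_map V x = 0} = V"
    by auto
qed

definition star_fan :: "fan \<Rightarrow> vec set \<Rightarrow> fan" where
  "star_fan F \<sigma> =
     (let q = quotient_map (span \<sigma>)
      in Fan (q ` lat F) ((`) q ` {\<tau> \<in> cones F. \<sigma> \<subseteq> \<tau>}))"

text \<open>Only the values on the support matter for functions on a fan.\<close>

definition conewise_integral_linear :: "fan \<Rightarrow> (vec \<Rightarrow> real) \<Rightarrow> bool" where
  "conewise_integral_linear F f \<longleftrightarrow>
     continuous_on (support F) f \<and>
     (\<forall>\<sigma>\<in>cones F. \<exists>l. linear l \<and> (\<forall>x\<in>lat_of (lat F) \<sigma>. l x \<in> \<int>) \<and> (\<forall>x\<in>\<sigma>. f x = l x))"

text \<open>The values of \<open>cone_form f \<sigma>\<close> on the span of \<open>\<sigma>\<close> are determined by \<open>f\<close>.\<close>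

definition cone_form :: "(vec \<Rightarrow> real) \<Rightarrow> vec set \<Rightarrow> vec \<Rightarrow> real" where
  "cone_form f \<sigma> = (SOME l. linear l \<and> (\<forall>x\<in>\<sigma>. f x = l x))"

definition ord_at :: "fan \<Rightarrow> (vec \<Rightarrow> real) \<Rightarrow> vec set \<Rightarrow> real" where
  "ord_at F f \<tau> =
     - (\<Sum>\<sigma> | \<sigma> \<in> facets F \<and> \<tau> \<subseteq> \<sigma>. cone_form f \<sigma> (normal_vector (lat F) \<tau> \<sigma>))
     + cone_form f \<tau> (normal_sum F \<tau>)"

definition div_trivial :: "fan \<Rightarrow> (vec \<Rightarrow> real) \<Rightarrow> bool" where
  "div_trivial F f \<longleftrightarrow> (\<forall>\<tau>\<in>ridges F. ord_at F f \<tau> = 0)"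

definition div_reduced :: "fan \<Rightarrow> (vec \<Rightarrow> real) \<Rightarrow> bool" where
  "div_reduced F f \<longleftrightarrow> (\<forall>\<tau>\<in>ridges F. ord_at F f \<tau> \<noteq> 0 \<longrightarrow> ord_at F f \<tau> = 1)"

text \<open>If the divisor is trivial, then \<open>div_fan F f\<close> has no cones and is not a rational fan.\<close>

definition div_fan :: "fan \<Rightarrow> (vec \<Rightarrow> real) \<Rightarrow> fan" where
  "div_fan F f = Fan (lat F) {\<delta>. \<exists>\<tau>\<in>ridges F. ord_at F f \<tau> = 1 \<and> cone_face \<delta> \<tau>}"

definition linear_on_fan :: "fan \<Rightarrow> (vec \<Rightarrow> real) \<Rightarrow> bool" where
  "linear_on_fan F f \<longleftrightarrow> (\<exists>l. linear l \<and> (\<forall>x\<in>support F. f x = l x))"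

definition div_faithful :: "fan \<Rightarrow> bool" where
  "div_faithful F \<longleftrightarrow>
     (\<forall>\<eta>\<in>cones F. \<forall>f. conewise_integral_linear (star_fan F \<eta>) f \<longrightarrow>
        div_trivial (star_fan F \<eta>) f \<longrightarrow> linear_on_fan (star_fan F \<eta>) f)"

text \<open>
  Direct sums are formed by interleaving coordinates; \<open>vpair\<close> is a linear isomorphism from
  \<open>vec \<times> vec\<close> onto \<open>vec\<close>. The factor \<open>\<real>\<close> of the ambient space of a tropical modification is
  embedded as the zeroth coordinate of the second summand.
\<close>

lift_definition vpair :: "vec \<Rightarrow> vec \<Rightarrow> vec" is
  "\<lambda>x y n. if even n then x (n div 2) else y (n div 2)"
proof -
  fix x y :: "nat \<Rightarrow> real"
  assume "finite {n. x n \<noteq> 0}" "finite {n. y n \<noteq> 0}"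
  then have "finite ((\<lambda>n. 2 * n) ` {n. x n \<noteq> 0} \<union> (\<lambda>n. 2 * n + 1) ` {n. y n \<noteq> 0})"
    by simp
  moreover have "{n. (if even n then x (n div 2) else y (n div 2)) \<noteq> 0}
      \<subseteq> (\<lambda>n. 2 * n) ` {n. x n \<noteq> 0} \<union> (\<lambda>n. 2 * n + 1) ` {n. y n \<noteq> 0}"
    (is "?L \<subseteq> ?R")
  proof
    fix n assume n: "n \<in> ?L"
    show "n \<in> ?R"
    proof (cases "even n")
      case True
      then have "n = 2 * (n div 2)" "x (n div 2) \<noteq> 0" using n by auto
      then show ?thesis by blast
    next
      case False
      then have "n = 2 * (n div 2) + 1" "y (n div 2) \<noteq> 0" using n by auto
      then show ?thesis by blast
    qed
  qed
  ultimately show "finite {n. (if even n then x (n div 2) else y (n div 2)) \<noteq> 0}"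
    by (rule finite_subset[rotated])
qed

lemma vpair_inject: "vpair x y = vpair x' y' \<longleftrightarrow> x = x' \<and> y = y'"
proof
  assume eq: "vpair x y = vpair x' y'"
  have "Poly_Mapping.lookup (vpair x y) (2 * n) = Poly_Mapping.lookup (vpair x' y') (2 * n)"
       "Poly_Mapping.lookup (vpair x y) (2 * n + 1) = Poly_Mapping.lookup (vpair x' y') (2 * n + 1)" for n
    using eq by simp_all
  then show "x = x' \<and> y = y'"
    by (simp add: vpair.rep_eq poly_mapping_eq_iff fun_eq_iff)
qed simp

definition line_vec :: "real \<Rightarrow> vec" where
  "line_vec t = Poly_Mapping.single 0 t"

definition fan_prod :: "fan \<Rightarrow> fan \<Rightarrow> fan" where
  "fan_prod F G =
     Fan {vpair x y | x y. x \<in> lat F \<and> y \<in> lat G}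
         {{vpair x y | x y. x \<in> \<sigma> \<and> y \<in> \<tau>} | \<sigma> \<tau>. \<sigma> \<in> cones F \<and> \<tau> \<in> cones G}"

definition trop_mod :: "fan \<Rightarrow> (vec \<Rightarrow> real) \<Rightarrow> fan" where
  "trop_mod F f =
     Fan {vpair x (line_vec (of_int k)) | x k. x \<in> lat F}
         ({{vpair x (line_vec (f x)) | x. x \<in> \<sigma>} | \<sigma>. \<sigma> \<in> cones F} \<union>
          {{vpair x (line_vec (f x + t)) | x t. x \<in> \<delta> \<and> t \<ge> 0} | \<delta>. \<delta> \<in> cones (div_fan F f)})"

definition rational_ray :: "vec set \<Rightarrow> vec set \<Rightarrow> bool" where
  "rational_ray N \<rho> \<longleftrightarrow> (\<exists>v\<in>N. v \<noteq> 0 \<and> \<rho> = {t *\<^sub>R v | t. t \<ge> 0})"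

definition blow_up_ray :: "fan \<Rightarrow> vec set \<Rightarrow> vec set \<Rightarrow> bool" where
  "blow_up_ray F \<sigma> \<rho> \<longleftrightarrow>
     \<sigma> \<in> cones F \<and> dim \<sigma> \<ge> 1 \<and> rational_ray (lat F) \<rho> \<and> \<rho> - {0} \<subseteq> rel_interior \<sigma>"

definition blow_up :: "fan \<Rightarrow> vec set \<Rightarrow> vec set \<Rightarrow> fan" where
  "blow_up F \<sigma> \<rho> =
     Fan (lat F)
         ({\<tau> \<in> cones F. \<not> \<sigma> \<subseteq> \<tau>} \<union>
          {{x + y | x y. x \<in> \<tau> \<and> y \<in> \<rho>} | \<tau>. \<tau> \<in> cones F \<and> \<not> \<sigma> \<subseteq> \<tau> \<and>
             (\<exists>\<sigma>'\<in>cones F. \<sigma> \<subseteq> \<sigma>' \<and> cone_face \<tau> \<sigma>')})"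

text \<open>
  Rule \<open>iso\<close> expresses that fans are considered modulo isomorphism; in particular membership of a
  star fan does not depend on the realisation of the quotient lattice. The two \<open>blow_up\<close> rules
  are the two directions of an equivalence.
\<close>

inductive_set Sh :: "fan set \<Rightarrow> fan set \<Rightarrow> fan set" for C B :: "fan set" where
  base: "F \<in> B \<Longrightarrow> F \<in> Sh C B"
| iso: "F \<in> Sh C B \<Longrightarrow> fan_iso F G \<Longrightarrow> G \<in> C \<Longrightarrow> G \<in> Sh C B"
| product: "F \<in> Sh C B \<Longrightarrow> G \<in> Sh C B \<Longrightarrow> fan_prod F G \<in> C \<Longrightarrow> fan_prod F G \<in> Sh C B"
| modification_reduced:
    "F \<in> Sh C B \<Longrightarrow> conewise_integral_linear F f \<Longrightarrow> div_reduced F f \<Longrightarrow>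
     div_fan F f \<in> Sh C B \<Longrightarrow> trop_mod F f \<in> C \<Longrightarrow> trop_mod F f \<in> Sh C B"
| modification_trivial:
    "F \<in> Sh C B \<Longrightarrow> conewise_integral_linear F f \<Longrightarrow> div_trivial F f \<Longrightarrow>
     trop_mod F f \<in> C \<Longrightarrow> trop_mod F f \<in> Sh C B"
| blow_up:
    "F \<in> C \<Longrightarrow> blow_up_ray F \<sigma> \<rho> \<Longrightarrow> star_fan F \<sigma> \<in> Sh C B \<Longrightarrow> blow_up F \<sigma> \<rho> \<in> C \<Longrightarrow>
     F \<in> Sh C B \<Longrightarrow> blow_up F \<sigma> \<rho> \<in> Sh C B"
| blow_down:
    "F \<in> C \<Longrightarrow> blow_up_ray F \<sigma> \<rho> \<Longrightarrow> star_fan F \<sigma> \<in> Sh C B \<Longrightarrow> blow_up F \<sigma> \<rho> \<in> C \<Longrightarrow>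
     blow_up F \<sigma> \<rho> \<in> Sh C B \<Longrightarrow> F \<in> Sh C B"

definition shellable_in :: "fan set \<Rightarrow> (fan \<Rightarrow> bool) \<Rightarrow> bool" where
  "shellable_in C P \<longleftrightarrow> Sh C {F \<in> C. P F} = {F \<in> C. P F}"

end

theory Submission
  imports Defs
begin

text \<open>
  Star fans can be avoided: div-faithfulness at \<open>\<eta>\<close> says that every compatible, balanced
  family of rational linear forms on the cones containing \<open>\<eta>\<close> is the restriction of one linear form,
  and in this form it can be transported along linear maps. For a product, one restricts a family to the
  slices \<open>\<sigma> \<times> \<kappa>\<close> and \<open>\<psi> \<times> \<tau>\<close> for fixed facets \<open>\<kappa>\<close> and \<open>\<psi>\<close>. For a tropical modification along
  \<open>f\<close>, one subtracts a multiple of the last coordinate, so that the family becomes constant in the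
  vertical direction and descends to the base; the equation \<open>ord\<^sub>\<tau>(f) = 1\<close> along the divisor is what
  makes the result balanced. At the cones which contain the vertical direction, the star is that of the
  divisor. A blow-up does not change the support, and for two tropical fans with the same support
  and lattice, one refining the other, div-faithfulness is equivalent: on the refined cones inside one
  facet a balanced family has only one linear form, because a generic segment crosses only
  ridges, and at a ridge in the interior of a facet balancing forces the two adjacent forms to agree.
\<close>

section \<open>Dimension in finitely generated subspaces\<close>

text \<open>Forms take rational rather than integral values because a form on
  \<open>span \<eta>\<close> has to be extended to the whole lattice with control over its values;
  over the rationals this is a question of bases, and integrality is recovered by a common
  denominator over the finitely many cones. Families need not vanish on \<open>\<eta>\<close>, so
  that no quotient is built into them; one locale, \<open>fan_projection\<close>, then serves for
  the quotient in the definition of a star, for an isomorphism and for the projection of vertical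
  cones to the divisor, since all it asks of the kernel is to lie in \<open>span \<eta>\<close>.
  Maps send normal vectors to normal vectors, but not the selected ones to the selected ones; hence
  balancing is stated for some choice, and uniqueness modulo \<open>span \<tau>\<close> shows that
  the choice is harmless. Incidence of cones is decided by interior points: a cone of a fan that
  contains an interior point of another one contains all of it. The ambient space being
  infinite-dimensional, interiors are taken algebraically and dimensions are counted inside spans of
  finite sets.\<close>

lemma finite_basis:
  fixes A B :: "'a::real_vector set"
  assumes "A \<subseteq> span B" "finite B"
  obtains D where "D \<subseteq> A" "independent D" "A \<subseteq> span D" "finite D" "card D = dim A"
proof -
  obtain D where D: "D \<subseteq> A" "independent D" "A \<subseteq> span D" "card D = dim A"
    using real_vector.basis_exists by blast
  moreover have "finite D"
    using real_vector.independent_span_bound[OF assms(2) D(2)] D(1) assms(1) by blast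
  ultimately show ?thesis using that by blast
qed

text \<open>\<open>dim\<close> is the cardinality of a basis and so equals 0 for an infinite one;
  the finite set \<open>B\<close> keeps all bases finite, here and in the following lemmas.\<close>

lemma dim_mono_span:
  fixes A B C :: "'a::real_vector set"
  assumes "A \<subseteq> span C" "C \<subseteq> span B" "finite B"
  shows "dim A \<le> dim C"
proof -
  obtain D where D: "D \<subseteq> C" "independent D" "C \<subseteq> span D" "finite D" "card D = dim C"
    using finite_basis assms by metis
  then have "A \<subseteq> span D"
    using assms(1) span_minimal[OF D(3)] by auto
  then show ?thesis using real_vector.dim_le_card D by metis
qed

lemma span_eq_if_dim_le:
  fixes A B C :: "'a::real_vector set"
  assumes "A \<subseteq> span C" "C \<subseteq> span B" "finite B" "dim C \<le> dim A"
  shows "span A = span C"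
proof -
  have AB: "A \<subseteq> span B"
    using assms(1,2) span_minimal[OF assms(2)] by auto
  obtain D where D: "D \<subseteq> A" "independent D" "A \<subseteq> span D" "finite D" "card D = dim A"
    using finite_basis AB assms(3) by metis
  obtain E where E: "E \<subseteq> C" "independent E" "C \<subseteq> span E" "finite E" "card E = dim C"
    using finite_basis assms by metis
  have "c \<in> span D" if "c \<in> C" for c
  proof (rule ccontr)
    assume c: "c \<notin> span D"
    then have ind: "independent (insert c D)" 
      using D(2) real_vector.independent_insertI by blast
    have "insert c D \<subseteq> span E" 
      using that D(1) assms(1) E(3) span_minimal[OF E(3)] by auto
    then have "card (insert c D) \<le> card E"
      using real_vector.independent_span_bound[OF E(4) ind] by blast
    moreover have "c \<notin> D" using c span_base by blast
    ultimately show False using D E assms(4) by simp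
  qed
  then have "C \<subseteq> span D" by blast
  then have "span C \<subseteq> span D" by (simp add: span_minimal)
  moreover have "span D \<subseteq> span A" using D(1) span_mono by blast
  moreover have "span A \<subseteq> span C" using assms(1) by (simp add: span_minimal)
  ultimately show ?thesis by blast
qed

text \<open>Rank-nullity: a basis \<open>D\<close> of the kernel is extended to a basis
  \<open>E\<close> of \<open>span A\<close>, and \<open>\<phi>\<close> maps \<open>E - D\<close>
  injectively onto an independent set with the span of the image.\<close>

lemma dim_kernel_image:
  fixes A B :: "'a::real_vector set" and \<phi> :: "'a \<Rightarrow> 'b::real_vector"
  assumes "linear \<phi>" "A \<subseteq> span B" "finite B"
  shows "dim A = dim (\<phi> ` A) + dim {x \<in> span A. \<phi> x = 0}"
proof -
  define K where "K = {x \<in> span A. \<phi> x = 0}"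
  have AB: "span A \<subseteq> span B" using assms(2) by (simp add: span_minimal)
  have "K \<subseteq> span B" using AB by (auto simp: K_def)
  then obtain D where D: "D \<subseteq> K" "independent D" "K \<subseteq> span D" "finite D" "card D = dim K"
    using finite_basis assms(3) by metis
  have KA: "D \<subseteq> span A" using D(1) by (auto simp: K_def)
  then obtain E where E: "D \<subseteq> E" "E \<subseteq> span A" "independent E" "span A \<subseteq> span E"
    using real_vector.maximal_independent_subset_extend[OF _ D(2)] by metis
  have fE: "finite E" 
    using real_vector.independent_span_bound[OF assms(3) E(3)] E(2) AB by blast
  have cE: "card E = dim A"
    using real_vector.basis_card_eq_dim[OF E(2,4,3)] by simp
  have zero: "x = 0" if "x \<in> span (E - D)" "\<phi> x = 0" for x
  proof -
    have "x \<in> K" using that span_minimal[of "E - D" "span A"] E(2)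
      by (auto simp: K_def)
    then have "x \<in> span D" using D(3) by blast
    show ?thesis
    proof (rule ccontr)
      assume nz: "x \<noteq> 0"
      \<comment> \<open>\<open>x\<close> lies in the span of \<open>E - D\<close> and, being in the
        kernel, also in that of \<open>D\<close>; either membership kills the coordinates at the
        other part of \<open>E\<close>.\<close>
      have rep0: "real_vector.representation E x b = 0" if b: "b \<in> E" for b
      proof (cases "b \<in> D")
        case True
        have "real_vector.representation E x = real_vector.representation (E - D) x"
          using real_vector.representation_extend[OF E(3) \<open>x \<in> span (E - D)\<close>] by blast
        then show ?thesis using True real_vector.representation_ne_zero by fastforce
      next
        case False
        have "real_vector.representation E x = real_vector.representation D x"
          using real_vector.representation_extend[OF E(3) \<open>x \<in> span D\<close> E(1)] .
        then show ?thesis using False real_vector.representation_ne_zero by fastforce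
      qed
      have "x \<in> span E" using \<open>x \<in> span D\<close> E(1) span_mono by blast
      then have "x = (\<Sum>b\<in>E. real_vector.representation E x b *\<^sub>R b)"
        using real_vector.sum_representation_eq[OF E(3) _ fE] by auto
      then show False using rep0 nz by simp
    qed
  qed
  have inj: "inj_on \<phi> (span (E - D))"
    using zero real_vector.linear_inj_on_iff_eq_0[OF assms(1), of "span (E - D)"] by auto
  have ind: "independent (\<phi> ` (E - D))"
    using real_vector.linear_independent_injective_image[OF assms(1) _ inj]
      real_vector.independent_mono[OF E(3)] by blast
  have sp: "span (\<phi> ` A) = span (\<phi> ` (E - D))"
  proof
    have "\<phi> ` E \<subseteq> span (\<phi> ` (E - D))"
    proof
      fix y assume "y \<in> \<phi> ` E"
      then obtain e where e: "e \<in> E" "y = \<phi> e" by blast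
      show "y \<in> span (\<phi> ` (E - D))"
      proof (cases "e \<in> D")
        case True
        then have "y = 0" using D(1) e by (auto simp: K_def)
        then show ?thesis by (simp add: span_zero)
      next
        case False
        then show ?thesis using e by (auto intro: span_base)
      qed
    qed
    then have "span (\<phi> ` E) \<subseteq> span (\<phi> ` (E - D))"
      by (simp add: span_minimal)
    moreover have "\<phi> ` A \<subseteq> span (\<phi> ` E)"
      using E(4) span_superset[of A] linear_span_image[OF assms(1), of E] by blast
    ultimately show "span (\<phi> ` A) \<subseteq> span (\<phi> ` (E - D))"
      by (simp add: span_minimal)
    have "\<phi> ` (E - D) \<subseteq> span (\<phi> ` A)"
      using E(2) linear_span_image[OF assms(1), of A] by blast
    then show "span (\<phi> ` (E - D)) \<subseteq> span (\<phi> ` A)"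
      by (simp add: span_minimal)
  qed
  have "dim (\<phi> ` A) = card (\<phi> ` (E - D))"
    using sp real_vector.dim_eq_card[OF _ ind, of "\<phi> ` A"] by simp
  also have "\<dots> = card (E - D)"
    by (rule card_image, rule inj_on_subset[OF inj]) (rule span_superset)
  also have "\<dots> = card E - card D" using E(1) D(4) by (simp add: card_Diff_subset)
  finally show ?thesis
    using cE D(5) card_mono[OF fE E(1)] by (simp add: K_def)
qed

lemma linear_factor_through:
  fixes \<phi> :: "'a::real_vector \<Rightarrow> 'b::real_vector" and L :: "'a \<Rightarrow> 'c::real_vector"
  assumes "linear \<phi>" "linear L" "subspace U" "\<And>x. x \<in> U \<Longrightarrow> \<phi> x = 0 \<Longrightarrow> L x = 0"
  obtains M where "linear M" "\<And>x. x \<in> U \<Longrightarrow> M (\<phi> x) = L x"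
proof -
  obtain g where g: "range g \<subseteq> U" "linear g" "\<forall>v\<in>\<phi> ` U. \<phi> (g v) = v"
    using real_vector.linear_exists_right_inverse_on[OF assms(1,3)] by blast
  have "L (g (\<phi> x)) = L x" if "x \<in> U" for x
  proof -
    have "g (\<phi> x) - x \<in> U" using g(1) that assms(3) by (simp add: range_subsetD subspace_diff)
    moreover have "\<phi> (g (\<phi> x) - x) = 0" using g(3) that by (simp add: linear_diff[OF assms(1)])
    ultimately show ?thesis using assms(4) linear_diff[OF assms(2)] by fastforce
  qed
  then show ?thesis using that[of "L \<circ> g"] linear_compose[OF g(2) assms(2)] by simp
qed

section \<open>Convex cones\<close>

lemma span_convex_cone_hull: "span (convex_cone hull V) = span V"
proof
  have "convex_cone hull V \<subseteq> span V"
    by (rule hull_minimal) (auto simp: convex_cone_span intro: span_base)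
  then show "span (convex_cone hull V) \<subseteq> span V" by (simp add: span_minimal)
  show "span V \<subseteq> span (convex_cone hull V)"
    by (rule span_mono) (rule hull_subset)
qed

lemma span_convex_cone:
  assumes "convex_cone S" "y \<in> span S"
  obtains a b where "a \<in> S" "b \<in> S" "y = a - b"
proof -
  have "subspace {a - b | a b. a \<in> S \<and> b \<in> S}" (is "subspace ?T")
  proof (rule real_vector.subspaceI)
    show "0 \<in> ?T" using convex_cone_contains_0[OF assms(1)] by force
    show "x + y \<in> ?T" if xy: "x \<in> ?T" "y \<in> ?T" for x y
    proof -
      obtain a b c d where h: "a \<in> S" "b \<in> S" "c \<in> S" "d \<in> S" "x = a - b" "y = c - d" 
        using xy by blast
      then have "x + y = (a + c) - (b + d)" "a + c \<in> S" "b + d \<in> S"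
        using convex_cone_add[OF assms(1)] by auto
      then show ?thesis by blast
    qed
    show "c *\<^sub>R x \<in> ?T" if x: "x \<in> ?T" for c x
    proof -
      obtain a b where ab: "a \<in> S" "b \<in> S" "x = a - b" using x by blast
      show ?thesis
      proof (cases "c \<ge> 0")
        case True
        then have "c *\<^sub>R x = c *\<^sub>R a - c *\<^sub>R b" "c *\<^sub>R a \<in> S" "c *\<^sub>R b \<in> S"
          using ab convex_cone_scaleR[OF assms(1)] by (auto simp: scaleR_diff_right)
        then show ?thesis by blast
      next
        case False
        then have "c *\<^sub>R x = (-c) *\<^sub>R b - (-c) *\<^sub>R a" "(-c) *\<^sub>R a \<in> S" "(-c) *\<^sub>R b \<in> S"
          using ab convex_cone_scaleR[OF assms(1), of "-c"] by (auto simp: scaleR_diff_right)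
        then show ?thesis by blast
      qed
    qed
  qed
  moreover have "S \<subseteq> ?T" using convex_cone_contains_0[OF assms(1)] by force
  ultimately have "y \<in> ?T" using assms(2) span_minimal by blast
  then show ?thesis using that by blast
qed

text \<open>The source of all generic choices. Given \<open>x\<close> off the earlier subspaces and
  \<open>y\<close> off the new one, two of the infinitely many points \<open>x + n y\<close> would
  lie in one common subspace, which would then contain both \<open>y\<close> and
  \<open>x\<close>.\<close>

lemma convex_cone_avoids_subspaces:
  assumes S: "convex_cone S" and "finite \<W>" "\<And>W. W \<in> \<W> \<Longrightarrow> subspace W \<and> \<not> S \<subseteq> W"
  obtains y where "y \<in> S" "\<And>W. W \<in> \<W> \<Longrightarrow> y \<notin> W"
proof -
  have "\<exists>y\<in>S. \<forall>W\<in>\<W>. y \<notin> W"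
    using assms(2,3)
  proof (induction \<W> rule: finite_induct)
    case empty
    then show ?case using convex_cone_contains_0[OF S] by blast
  next
    case (insert W \<W>)
    then obtain x where x: "x \<in> S" "\<forall>W\<in>\<W>. x \<notin> W" by blast
    obtain y where y: "y \<in> S" "y \<notin> W" using insert.prems by blast
    show ?case
    proof (rule ccontr)
      assume "\<not> ?thesis"
      then have cov: "\<exists>V\<in>insert W \<W>. z \<in> V" if "z \<in> S" for z using that by blast
      have "x + real n *\<^sub>R y \<in> S" for n
        using x(1) y(1) S by (simp add: convex_cone_add convex_cone_scaleR)
      then have "\<forall>n. \<exists>V. V \<in> insert W \<W> \<and> x + real n *\<^sub>R y \<in> V" using cov by blast
      then obtain c where c: "\<And>n. c n \<in> insert W \<W>" "\<And>n. x + real n *\<^sub>R y \<in> c n" by metis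
      have "\<not> inj c"
        using c(1) insert.hyps(1) finite_subset[of "range c" "insert W \<W>"] finite_imageD[of c UNIV]
        by auto
      then obtain m n where mn: "m \<noteq> n" "c m = c n" by (auto simp: inj_on_def)
      define V where "V = c m"
      have V: "V \<in> insert W \<W>" "subspace V" using c(1) insert.prems by (auto simp: V_def)
      have h: "x + real m *\<^sub>R y \<in> V" "x + real n *\<^sub>R y \<in> V" using c(2) mn by (auto simp: V_def)
      have "(x + real m *\<^sub>R y) - (x + real n *\<^sub>R y) \<in> V" 
        using h V(2) by (rule_tac subspace_diff)
      then have "(real m - real n) *\<^sub>R y \<in> V" by (simp add: scaleR_diff_left)
      then have "inverse (real m - real n) *\<^sub>R ((real m - real n) *\<^sub>R y) \<in> V" 
        using V(2) subspace_scale by blast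
      then have yV: "y \<in> V" using mn(1) by simp
      then have "x + real m *\<^sub>R y - real m *\<^sub>R y \<in> V"
        using h(1) V(2) subspace_diff subspace_scale by blast
      then have "x \<in> V" by simp
      then show False using x(2) y(2) yV V(1) by blast
    qed
  qed
  then show ?thesis using that by blast
qed

lemma strongly_convex_D:
  assumes "strongly_convex S" "x \<in> S" "- x \<in> S"
  shows "x = 0"
proof -
  have "x \<in> uminus ` S" using assms(3) by force
  then show ?thesis using assms(1,2) by (auto simp: strongly_convex_def)
qed

text \<open>Along a subsequence the directions \<open>x n\<close> converge to a point of
  \<open>K\<close>, which is non-zero; therefore the coefficients, being quotients of norms,
  converge as well.\<close>

lemma closed_cone_over_compact:
  fixes K :: "'a::real_normed_vector set"
  assumes "compact K" "0 \<notin> K"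
  shows "closed {c *\<^sub>R x | c x. c \<ge> 0 \<and> x \<in> K}"
proof (cases "K = {}")
  case True
  then show ?thesis by simp
next
  case False
  show ?thesis unfolding closed_sequential_limits
  proof (intro allI impI)
    fix z l assume h: "(\<forall>n. z n \<in> {c *\<^sub>R x | c x. c \<ge> 0 \<and> x \<in> K}) \<and> z \<longlonglongrightarrow> l"
    then have "\<forall>n. \<exists>c x. c \<ge> 0 \<and> x \<in> K \<and> z n = c *\<^sub>R x" by blast
    then obtain c x where cx: "\<And>n. c n \<ge> 0" "\<And>n. x n \<in> K" "\<And>n. z n = c n *\<^sub>R x n" by metis
    obtain k r where k: "k \<in> K" "strict_mono r" "(x \<circ> r) \<longlonglongrightarrow> k"
      using assms(1) cx(2) unfolding compact_def by metis
    have k0: "k \<noteq> 0" using k(1) assms(2) by blast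
    have x0: "x n \<noteq> 0" for n using cx(2) assms(2) by metis
    have ceq: "c n = norm (z n) / norm (x n)" for n
      using cx(1)[of n] cx(3)[of n] x0[of n] by simp
    have zr: "(\<lambda>n. z (r n)) \<longlonglongrightarrow> l"
      using h k(2) LIMSEQ_subseq_LIMSEQ[of z l r] by (simp add: o_def)
    have xr: "(\<lambda>n. x (r n)) \<longlonglongrightarrow> k" using k(3) by (simp add: o_def)
    have "(\<lambda>n. c (r n)) \<longlonglongrightarrow> norm l / norm k"
      unfolding ceq by (intro tendsto_intros zr xr) (use k0 in simp)
    then have "(\<lambda>n. c (r n) *\<^sub>R x (r n)) \<longlonglongrightarrow> (norm l / norm k) *\<^sub>R k"
      by (intro tendsto_intros xr)
    then have "(\<lambda>n. z (r n)) \<longlonglongrightarrow> (norm l / norm k) *\<^sub>R k" by (simp add: cx(3))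
    then have "l = (norm l / norm k) *\<^sub>R k" using zr LIMSEQ_unique by blast
    then show "l \<in> {c *\<^sub>R x | c x. c \<ge> 0 \<and> x \<in> K}" 
      using k(1) by (smt (verit) divide_nonneg_nonneg mem_Collect_eq norm_ge_zero)
  qed
qed

text \<open>The cone is a cone over the convex hull of its non-zero generators, which is compact and
  avoids 0 by strong convexity.\<close>

lemma closed_strongly_convex_hull:
  assumes "finite V" "strongly_convex (convex_cone hull V)"
  shows "closed (convex_cone hull V)"
proof -
  define S where "S = convex_cone hull V"
  have cS: "convex_cone S" by (simp add: S_def convex_cone_convex_cone_hull)
  have VS: "V \<subseteq> S" by (simp add: S_def hull_subset)
  define W where "W = V - {0}"
  have W: "finite W" "W \<subseteq> S" "0 \<notin> W" using VS assms(1) by (auto simp: W_def)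
  have SW: "S = convex_cone hull W"
  proof
    show "S \<subseteq> convex_cone hull W" unfolding S_def
    proof (rule hull_minimal)
      show "V \<subseteq> convex_cone hull W"
        using hull_subset[of W convex_cone] convex_cone_hull_contains_0 by (auto simp: W_def)
    qed (rule convex_cone_convex_cone_hull)
    show "convex_cone hull W \<subseteq> S" by (rule hull_minimal) (use W cS in auto)
  qed
  \<comment> \<open>In a convex combination equal to 0, a summand with non-zero coefficient is the
    negative of the sum of the others; so it and its negative both lie in \<open>S\<close>.\<close>
  have hW: "0 \<notin> convex hull W"
  proof
    assume "0 \<in> convex hull W"
    then obtain u where u: "\<forall>x\<in>W. 0 \<le> u x" "sum u W = 1" "(\<Sum>x\<in>W. u x *\<^sub>R x) = 0"
      using convex_hull_finite[OF W(1)] by auto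
    then obtain w where w: "w \<in> W" "u w \<noteq> 0" by (metis sum.neutral zero_neq_one)
    have sumS: "(\<Sum>x\<in>X. u x *\<^sub>R x) \<in> S" if "X \<subseteq> W" for X
    proof -
      have "finite X" using that W(1) finite_subset by blast
      then show ?thesis using that
      proof (induction X rule: finite_induct)
        case empty
        then show ?case using convex_cone_contains_0[OF cS] by simp
      next
        case (insert y Y)
        then show ?case using convex_cone_add[OF cS] convex_cone_scaleR[OF cS] u(1) W(2) 
          by (simp add: subset_iff)
      qed
    qed
    have "(\<Sum>x\<in>W. u x *\<^sub>R x) = u w *\<^sub>R w + (\<Sum>x\<in>W - {w}. u x *\<^sub>R x)"
      using W(1) w(1) by (simp add: sum.remove)
    then have "- (u w *\<^sub>R w) = (\<Sum>x\<in>W - {w}. u x *\<^sub>R x)"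
      using u(3) by (metis add.inverse_unique)
    moreover have "(\<Sum>x\<in>W - {w}. u x *\<^sub>R x) \<in> S" by (rule sumS) auto
    ultimately have "- (u w *\<^sub>R w) \<in> S" by simp
    moreover have "u w *\<^sub>R w \<in> S" using w(1) u(1) W(2) convex_cone_scaleR[OF cS] by blast
    ultimately have "u w *\<^sub>R w = 0" using strongly_convex_D assms(2) S_def by blast
    then show False using w W(3) by auto
  qed
  show ?thesis
  proof (cases "W = {}")
    case True
    then show ?thesis using SW S_def by simp
  next
    case False
    have "S = {c *\<^sub>R x | c x. c \<ge> 0 \<and> x \<in> convex hull W}"
      unfolding SW convex_cone_hull_convex_hull_nonempty[OF False] by auto
    then show ?thesis
      using closed_cone_over_compact[OF finite_imp_compact_convex_hull[OF W(1)] hW] S_def by simp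
  qed
qed

text \<open>For a finitely generated cone this is the relative interior, expressed without topology:
  from \<open>z\<close> one can step back a little in the direction of every point of the
  cone.\<close>

definition arint :: "'a::real_vector set \<Rightarrow> 'a set" where
  "arint S = {z \<in> S. \<forall>y\<in>S. \<exists>e>0. z - e *\<^sub>R y \<in> S}"

lemma arint_subset: "arint S \<subseteq> S"
  by (auto simp: arint_def)

lemma cone_sub_mono:
  assumes "convex_cone S" "y \<in> S" "z - e *\<^sub>R y \<in> S" "t \<le> e"
  shows "z - t *\<^sub>R y \<in> S"
proof -
  have "z - t *\<^sub>R y = (z - e *\<^sub>R y) + (e - t) *\<^sub>R y" by (simp add: algebra_simps)
  also have "\<dots> \<in> S" using assms by (simp add: convex_cone_add convex_cone_scaleR)
  finally show ?thesis .
qed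

text \<open>The sum \<open>p\<close> of the generators is an interior point: subtracting one
  generator leaves the sum of the others, and the directions in which one can step back from
  \<open>p\<close> form a convex cone.\<close>

lemma arint_nonempty:
  assumes "finite V"
  shows "arint (convex_cone hull V) \<noteq> {}"
proof -
  define S where "S = convex_cone hull V"
  have cS: "convex_cone S" by (simp add: S_def convex_cone_convex_cone_hull)
  have VS: "V \<subseteq> S" by (simp add: S_def hull_subset)
  have sumS: "(\<Sum>x\<in>X. x) \<in> S" if "X \<subseteq> V" for X
  proof -
    have "finite X" using that assms finite_subset by blast
    then show ?thesis using that
    proof (induction X rule: finite_induct)
      case empty
      then show ?case using convex_cone_contains_0[OF cS] by simp
    next
      case (insert y Y)
      then show ?case using convex_cone_add[OF cS] VS by (simp add: subset_iff)
    qed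
  qed
  define p where "p = (\<Sum>x\<in>V. x)"
  have pS: "p \<in> S" using sumS by (simp add: p_def)
  let ?T = "{y \<in> S. \<exists>e>0. p - e *\<^sub>R y \<in> S}"
  have "S \<subseteq> ?T" unfolding S_def
  proof (rule hull_minimal)
    show "V \<subseteq> {y \<in> convex_cone hull V. \<exists>e>0. p - e *\<^sub>R y \<in> convex_cone hull V}"
    proof
      fix v assume v: "v \<in> V"
      have "p - 1 *\<^sub>R v = (\<Sum>x\<in>V - {v}. x)" using v assms by (simp add: p_def sum_diff1)
      then have "p - 1 *\<^sub>R v \<in> S" using sumS[of "V - {v}"] by auto
      then show "v \<in> {y \<in> convex_cone hull V. \<exists>e>0. p - e *\<^sub>R y \<in> convex_cone hull V}"
        using v VS S_def zero_less_one by blast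
    qed
    have "convex_cone ?T" unfolding convex_cone_iff
    proof (intro conjI ballI allI impI)
      show "0 \<in> ?T" using convex_cone_contains_0[OF cS] pS by (auto intro: exI[of _ 1])
      fix x assume x: "x \<in> ?T"
      then obtain e where e: "e > 0" "p - e *\<^sub>R x \<in> S" by blast
      show "x + y \<in> ?T" if y: "y \<in> ?T" for y
      proof -
        obtain d where d: "d > 0" "p - d *\<^sub>R y \<in> S" using y by blast
        define m where "m = min e d"
        have m: "p - m *\<^sub>R x \<in> S" "p - m *\<^sub>R y \<in> S" "m > 0"
          using cone_sub_mono[OF cS] x y e d by (auto simp: m_def)
        have "p - (m/2) *\<^sub>R (x + y) = (1/2) *\<^sub>R (p - m *\<^sub>R x) + (1/2) *\<^sub>R (p - m *\<^sub>R y)"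
          by (simp add: algebra_simps flip: scaleR_add_left)
        then have "p - (m/2) *\<^sub>R (x + y) \<in> S" 
          using m by (simp add: convex_cone_add[OF cS] convex_cone_scaleR[OF cS])
        then show ?thesis using m(3) x y convex_cone_add[OF cS] half_gt_zero by blast
      qed
      show "c *\<^sub>R x \<in> ?T" if "c \<ge> 0" for c
      proof -
        \<comment> \<open>The denominator \<open>c + 1\<close> instead of \<open>c\<close> covers
          \<open>c = 0\<close>.\<close>
        have "p - (e/(c+1)) *\<^sub>R (c *\<^sub>R x) \<in> S"
          using cone_sub_mono[OF cS _ e(2), of "e * c / (c+1)"] x e that by (simp add: field_simps)
        moreover have "e / (c+1) > 0" using e that by simp
        ultimately show ?thesis using x that convex_cone_scaleR[OF cS] by blast
      qed
    qed
    then show "convex_cone {y \<in> convex_cone hull V. \<exists>e>0. p - e *\<^sub>R y \<in> convex_cone hull V}"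
      by (simp add: S_def)
  qed
  then have "p \<in> arint S" using pS by (auto simp: arint_def)
  then show ?thesis by (auto simp: S_def)
qed

text \<open>Interior points tolerate small moves along the whole span: in \<open>y = a - b\<close>,
  adding multiples of \<open>a\<close> never leaves the cone, and subtracting multiples of
  \<open>b\<close> is allowed by interiority.\<close>

lemma arint_span:
  assumes "convex_cone S" "p \<in> arint S" "y \<in> span S"
  obtains e where "e > 0" "\<And>t. 0 \<le> t \<Longrightarrow> t \<le> e \<Longrightarrow> p + t *\<^sub>R y \<in> S"
proof -
  obtain a b where ab: "a \<in> S" "b \<in> S" "y = a - b" using span_convex_cone assms by metis
  obtain e where e: "e > 0" "p - e *\<^sub>R b \<in> S" using assms(2) ab by (auto simp: arint_def)
  have "p + t *\<^sub>R y \<in> S" if "0 \<le> t" "t \<le> e" for t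
  proof -
    have "p - t *\<^sub>R b + t *\<^sub>R a \<in> S"
      using cone_sub_mono[OF assms(1) ab(2) e(2)] that ab assms(1) 
      by (simp add: convex_cone_add convex_cone_scaleR)
    then show ?thesis by (simp add: ab algebra_simps)
  qed
  then show ?thesis using that e by blast
qed

text \<open>The face property of cones with sums in place of open segments; in this form it passes
  to images and to spans by linear algebra alone.\<close>

definition extremal :: "'a::real_vector set \<Rightarrow> 'a set \<Rightarrow> bool" where
  "extremal T S \<longleftrightarrow> T \<subseteq> S \<and> (\<forall>a\<in>S. \<forall>b\<in>S. a + b \<in> T \<longrightarrow> a \<in> T \<and> b \<in> T)"

text \<open>Rescaling by 2 makes \<open>a + b\<close> the midpoint of \<open>2 a\<close> and
  \<open>2 b\<close>, so that the segment condition of a face applies. For \<open>a = b\<close>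
  there is no open segment; then convexity and \<open>0 \<in> T\<close> are used instead.\<close>

lemma cone_face_extremal:
  assumes "cone_face T S" "convex_cone S"
  shows "extremal T S"
proof -
  have f: "T face_of S" "T \<noteq> {}" using assms(1) by (auto simp: cone_face_def)
  have TS: "T \<subseteq> S" and cT: "convex T" using f face_of_imp_subset face_of_imp_convex by auto
  have 0: "0 \<in> T"
  proof -
    obtain t where t: "t \<in> T" using f by blast
    show ?thesis
    proof (cases "t = 0")
      case False
      have "t = (1 - 1/2) *\<^sub>R 0 + (1/2) *\<^sub>R (2 *\<^sub>R t)" by simp
      then have "t \<in> open_segment 0 (2 *\<^sub>R t)" 
        using False unfolding in_segment by (intro conjI exI[of _ "1/2"]) auto
      moreover have "2 *\<^sub>R t \<in> S" "0 \<in> S"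
        using t TS assms(2) by (auto simp: convex_cone_scaleR convex_cone_contains_0)
      ultimately show ?thesis using face_ofD[OF f(1)] t by blast
    qed (use t in simp)
  qed
  have half: "a \<in> T" if "2 *\<^sub>R a \<in> T" for a
  proof -
    have "(1/2) *\<^sub>R 0 + (1/2) *\<^sub>R (2 *\<^sub>R a) \<in> T" 
      using cT 0 that by (intro convexD) auto
    then show ?thesis by simp
  qed
  have "a \<in> T \<and> b \<in> T" if h: "a \<in> S" "b \<in> S" "a + b \<in> T" for a b
  proof (cases "a = b")
    case True
    then show ?thesis using half h(3) by (simp add: scaleR_2)
  next
    case False
    have "a + b = (1 - 1/2) *\<^sub>R (2 *\<^sub>R a) + (1/2) *\<^sub>R (2 *\<^sub>R b)" by simp
    then have "a + b \<in> open_segment (2 *\<^sub>R a) (2 *\<^sub>R b)"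
      using False unfolding in_segment by (intro conjI exI[of _ "1/2"]) auto
    moreover have "2 *\<^sub>R a \<in> S" "2 *\<^sub>R b \<in> S"
      using h assms(2) by (simp_all add: convex_cone_scaleR)
    ultimately show ?thesis using face_ofD[OF f(1)] h(3) half by blast
  qed
  then show ?thesis using TS by (simp add: extremal_def)
qed

text \<open>For \<open>y\<close> in \<open>R\<close> the point \<open>p\<close> splits as
  \<open>(p - e y) + e y\<close> with both summands in \<open>R\<close>; as \<open>p\<close> lies in
  \<open>T\<close>, so does \<open>e y\<close>.\<close>

lemma extremal_arint_subset:
  assumes "extremal T S" "R \<subseteq> S" "p \<in> arint R" "p \<in> T" "convex_cone T" "convex_cone R"
  shows "R \<subseteq> T"
proof
  fix y assume y: "y \<in> R"
  then obtain e where e: "e > 0" "p - e *\<^sub>R y \<in> R" using assms(3) by (auto simp: arint_def)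
  have "e *\<^sub>R y \<in> R" using y e assms(6) convex_cone_scaleR by (meson less_imp_le)
  moreover have "(p - e *\<^sub>R y) + e *\<^sub>R y \<in> T" using assms(4) by simp
  ultimately have "e *\<^sub>R y \<in> T" using assms(1,2) e(2) unfolding extremal_def by blast
  then have "(1/e) *\<^sub>R (e *\<^sub>R y) \<in> T" by (rule convex_cone_scaleR[OF assms(5), rotated]) (use e(1) in simp)
  moreover have "(1/e) *\<^sub>R (e *\<^sub>R y) = y" using e by simp
  ultimately show "y \<in> T" by (simp only:)
qed

text \<open>\<open>T\<close> is the smallest face through \<open>p\<close>, so every point of a cone
  is interior to some face.\<close>

lemma minimal_face:
  assumes "convex_cone S" "p \<in> S"
  defines "T \<equiv> {y \<in> S. \<exists>e>0. p - e *\<^sub>R y \<in> S}"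
  shows "cone_face T S" "p \<in> arint T"
proof -
  have p: "p \<in> T" using assms convex_cone_contains_0[OF assms(1)] by (auto simp: T_def intro: exI[of _ 1])
  have "\<exists>e>0. p - e *\<^sub>R y \<in> T" if y: "y \<in> T" for y
  proof -
    obtain e where e: "e > 0" "p - e *\<^sub>R y \<in> S" using y by (auto simp: T_def)
    \<comment> \<open>To see that \<open>p - e y\<close> is itself in \<open>T\<close>, step back
      from \<open>p\<close> by half of it: a non-negative combination of \<open>p\<close> and
      \<open>y\<close> remains.\<close>
    have "p - (1/2) *\<^sub>R (p - e *\<^sub>R y) = (1 - 1/2) *\<^sub>R p + (e/2) *\<^sub>R y"
      by (simp only: scaleR_diff_left scaleR_diff_right) simp
    also have "\<dots> \<in> S" using assms(1,2) y e(1) by (simp add: convex_cone_add convex_cone_scaleR T_def)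
    finally have "\<exists>s>0. p - s *\<^sub>R (p - e *\<^sub>R y) \<in> S" by (intro exI[of _ "1/2"]) simp
    then have "p - e *\<^sub>R y \<in> T" using e(2) by (simp add: T_def)
    then show ?thesis using e(1) by blast
  qed
  then show "p \<in> arint T" using p by (simp add: arint_def)
  have "convex T"
  proof (rule convexI)
    fix x y :: vec and u v :: real
    assume h: "x \<in> T" "y \<in> T" "0 \<le> u" "0 \<le> v" "u + v = 1"
    obtain d e where de: "d > 0" "p - d *\<^sub>R x \<in> S" "e > 0" "p - e *\<^sub>R y \<in> S" 
      using h by (auto simp: T_def)
    define m where "m = min d e"
    have m: "p - m *\<^sub>R x \<in> S" "p - m *\<^sub>R y \<in> S" "m > 0"
      using cone_sub_mono[OF assms(1)] h de by (auto simp: m_def T_def)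
    have cS: "convex S" using assms(1) by (simp add: convex_cone_def)
    have "p - m *\<^sub>R (u *\<^sub>R x + v *\<^sub>R y) = (u + v) *\<^sub>R p - m *\<^sub>R (u *\<^sub>R x + v *\<^sub>R y)"
      using h by simp
    also have "\<dots> = u *\<^sub>R (p - m *\<^sub>R x) + v *\<^sub>R (p - m *\<^sub>R y)" by (simp add: algebra_simps)
    also have "\<dots> \<in> S" using convexD[OF cS m(1,2)] h by simp
    finally have "p - m *\<^sub>R (u *\<^sub>R x + v *\<^sub>R y) \<in> S" .
    moreover have "u *\<^sub>R x + v *\<^sub>R y \<in> S" using convexD[OF cS] h by (simp add: T_def)
    ultimately show "u *\<^sub>R x + v *\<^sub>R y \<in> T" using m(3) by (auto simp: T_def)
  qed
  moreover have "a \<in> T \<and> b \<in> T" 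
    if h: "a \<in> S" "b \<in> S" "x \<in> T" "x \<in> open_segment a b" for a b x
  proof -
    obtain u where u: "0 < u" "u < 1" "x = (1 - u) *\<^sub>R a + u *\<^sub>R b" using h(4) by (auto simp: in_segment)
    obtain e where e: "e > 0" "p - e *\<^sub>R x \<in> S" using h(3) by (auto simp: T_def)
    have "p - (e * (1 - u)) *\<^sub>R a = (p - e *\<^sub>R x) + (e * u) *\<^sub>R b"
      "p - (e * u) *\<^sub>R b = (p - e *\<^sub>R x) + (e * (1 - u)) *\<^sub>R a"
      unfolding u(3) by (simp_all add: algebra_simps)
    moreover have "(p - e *\<^sub>R x) + (e * u) *\<^sub>R b \<in> S" "(p - e *\<^sub>R x) + (e * (1 - u)) *\<^sub>R a \<in> S"
      using u(1,2) e h(1,2) assms(1) by (simp_all add: convex_cone_add convex_cone_scaleR)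
    ultimately have "p - (e * (1 - u)) *\<^sub>R a \<in> S" "p - (e * u) *\<^sub>R b \<in> S" by metis+
    moreover have "e * (1 - u) > 0" "e * u > 0" using u e by simp_all
    ultimately show ?thesis using h(1,2) unfolding T_def by blast
  qed
  ultimately have "T face_of S" unfolding face_of_def using T_def by blast
  then show "cone_face T S" using p by (auto simp: cone_face_def)
qed

section \<open>Continuity of linear forms\<close>

lemma lookup_scaleR_vec: "Poly_Mapping.lookup (c *\<^sub>R x) i = c * Poly_Mapping.lookup (x :: vec) i"
proof -
  have "finite {i. c * Poly_Mapping.lookup x i \<noteq> 0}"
    by (rule finite_subset[of _ "Poly_Mapping.keys x"]) (auto simp: in_keys_iff)
  then show ?thesis by (simp add: scaleR_poly_mapping_def Abs_poly_mapping_inverse)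
qed

lemma bounded_linear_lookup: "bounded_linear (\<lambda>x :: vec. Poly_Mapping.lookup x i)"
proof (rule bounded_linear_intro[where K = 1])
  show "norm (Poly_Mapping.lookup x i) \<le> norm x * 1" for x :: vec
  proof (cases "i \<in> Poly_Mapping.keys x")
    case True
    then show ?thesis
      using member_le_sum[of i "Poly_Mapping.keys x" "\<lambda>n. \<bar>Poly_Mapping.lookup x n\<bar>"]
      by (simp add: norm_poly_mapping_def dist_poly_mapping_def dist_real_def)
  next
    case False
    then show ?thesis by (simp add: in_keys_iff)
  qed
qed (simp_all add: lookup_add lookup_scaleR_vec)

text \<open>Linear forms on the infinite-dimensional ambient space may be discontinuous. The vectors
  in the span of a finite set have their non-zero coordinates in one finite set \<open>K\<close>, so
  there the form is a finite combination of coordinates.\<close>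

lemma continuous_on_linear_span:
  fixes l :: "vec \<Rightarrow> real"
  assumes "linear l" "finite V"
  shows "continuous_on (span V) l"
proof -
  define K where "K = (\<Union>v\<in>V. Poly_Mapping.keys v)"
  have K: "finite K" using assms(2) by (simp add: K_def)
  have "subspace {x :: vec. \<forall>i. i \<notin> K \<longrightarrow> Poly_Mapping.lookup x i = 0}"
    by (rule real_vector.subspaceI) (auto simp: lookup_add lookup_scaleR_vec)
  moreover have "V \<subseteq> {x. \<forall>i. i \<notin> K \<longrightarrow> Poly_Mapping.lookup x i = 0}"
    by (auto simp: K_def in_keys_iff)
  ultimately have sub: "span V \<subseteq> {x. \<forall>i. i \<notin> K \<longrightarrow> Poly_Mapping.lookup x i = 0}"
    by (rule_tac span_minimal)
  have eq: "l x = (\<Sum>i\<in>K. Poly_Mapping.lookup x i * l (Poly_Mapping.single i 1))" if "x \<in> span V" for x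
  proof -
    have "x = (\<Sum>i\<in>K. Poly_Mapping.lookup x i *\<^sub>R Poly_Mapping.single i (1::real))"
    proof (rule poly_mapping_eqI)
      fix k
      have "Poly_Mapping.lookup (\<Sum>i\<in>K. Poly_Mapping.lookup x i *\<^sub>R Poly_Mapping.single i (1::real)) k
        = (\<Sum>i\<in>K. if i = k then Poly_Mapping.lookup x i else 0)"
        unfolding lookup_sum lookup_scaleR_vec by (intro sum.cong) (auto simp: lookup_single when_def)
      also have "\<dots> = Poly_Mapping.lookup x k"
        using K sub that by auto
      finally show "Poly_Mapping.lookup x k = 
        Poly_Mapping.lookup (\<Sum>i\<in>K. Poly_Mapping.lookup x i *\<^sub>R Poly_Mapping.single i (1::real)) k" by simp
    qed
    then have "l x = l (\<Sum>i\<in>K. Poly_Mapping.lookup x i *\<^sub>R Poly_Mapping.single i (1::real))" by simp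
    then show ?thesis by (simp add: linear_sum[OF assms(1)] linear_scale[OF assms(1)])
  qed
  have "continuous_on (span V) (\<lambda>x. \<Sum>i\<in>K. Poly_Mapping.lookup x i * l (Poly_Mapping.single i 1))"
    by (intro continuous_intros bounded_linear.continuous_on[OF bounded_linear_lookup])
  then show ?thesis using eq by (simp cong: continuous_on_cong)
qed

section \<open>Lattices\<close>

lemma lattice_of_int_sums:
  assumes "N = {\<Sum>b\<in>B. of_int (k b) *\<^sub>R b | k :: vec \<Rightarrow> int. True}" "finite B"
  shows "0 \<in> N" "\<And>x y. x \<in> N \<Longrightarrow> y \<in> N \<Longrightarrow> x + y \<in> N" "\<And>x. x \<in> N \<Longrightarrow> of_int j *\<^sub>R x \<in> N" "B \<subseteq> N"
proof -
  show "0 \<in> N" unfolding assms(1) by (auto intro!: exI[of _ "\<lambda>_. 0"])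
  show "x + y \<in> N" if xy: "x \<in> N" "y \<in> N" for x y
  proof -
    obtain k m where "x = (\<Sum>b\<in>B. of_int (k b) *\<^sub>R b)" "y = (\<Sum>b\<in>B. of_int (m b) *\<^sub>R b)"
      using xy unfolding assms(1) by blast
    then have "x + y = (\<Sum>b\<in>B. of_int (k b + m b) *\<^sub>R b)"
      by (simp add: scaleR_add_left sum.distrib)
    then show ?thesis unfolding assms(1) by (intro CollectI exI[of _ "\<lambda>b. k b + m b"]) simp
  qed
  show "of_int j *\<^sub>R x \<in> N" if x: "x \<in> N" for x
  proof -
    obtain k where "x = (\<Sum>b\<in>B. of_int (k b) *\<^sub>R b)" using x unfolding assms(1) by blast
    then have "of_int j *\<^sub>R x = (\<Sum>b\<in>B. of_int (j * k b) *\<^sub>R b)"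
      by (simp add: scaleR_sum_right)
    then show ?thesis unfolding assms(1) by (intro CollectI exI[of _ "\<lambda>b. j * k b"]) simp
  qed
  show "B \<subseteq> N"
  proof
    fix c assume c: "c \<in> B"
    have "c = (\<Sum>b\<in>B. of_int (if b = c then 1 else 0) *\<^sub>R b)"
      using c assms(2) by (simp add: if_distrib[of "\<lambda>k. of_int k *\<^sub>R _"] sum.delta cong: if_cong)
    then show "c \<in> N" unfolding assms(1) by (intro CollectI exI[of _ "\<lambda>b. if b = c then 1 else 0"]) simp
  qed
qed

lemma lattice_closed:
  assumes "is_lattice N"
  shows "0 \<in> N" "\<And>x y. x \<in> N \<Longrightarrow> y \<in> N \<Longrightarrow> x + y \<in> N" "\<And>x. x \<in> N \<Longrightarrow> of_int j *\<^sub>R x \<in> N"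
    "\<And>x y. x \<in> N \<Longrightarrow> y \<in> N \<Longrightarrow> x - y \<in> N"
proof -
  obtain B where B: "finite B" "N = {\<Sum>b\<in>B. of_int (k b) *\<^sub>R b | k :: vec \<Rightarrow> int. True}"
    using assms unfolding is_lattice_def by blast
  note * = lattice_of_int_sums[OF B(2,1)]
  show "0 \<in> N" "\<And>x y. x \<in> N \<Longrightarrow> y \<in> N \<Longrightarrow> x + y \<in> N" "\<And>x. x \<in> N \<Longrightarrow> of_int j *\<^sub>R x \<in> N"
    using * by blast+
  show "x - y \<in> N" if "x \<in> N" "y \<in> N" for x y
    using *(2)[OF that(1) *(3)[OF that(2), of "-1"]] by simp
qed

lemma lat_of_closed:
  assumes "is_lattice N"
  shows "0 \<in> lat_of N S" "\<And>x y. x \<in> lat_of N S \<Longrightarrow> y \<in> lat_of N S \<Longrightarrow> x + y \<in> lat_of N S" 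
    "\<And>x. x \<in> lat_of N S \<Longrightarrow> of_int j *\<^sub>R x \<in> lat_of N S"
    "\<And>x y. x \<in> lat_of N S \<Longrightarrow> y \<in> lat_of N S \<Longrightarrow> x - y \<in> lat_of N S"
  using lattice_closed[OF assms]
  by (auto simp: lat_of_def intro: span_zero span_add 
      span_scale span_diff)

text \<open>
  Over \<open>\<rat>\<close>, a basis of the lattice can be chosen to extend a maximal independent subset of \<open>S\<close>;
  by counting, it is also independent over \<open>\<real>\<close>.
\<close>

lemma rational_form_extend:
  fixes m :: "vec \<Rightarrow> real"
  assumes "is_lattice N" "S \<subseteq> N" "linear m" "\<And>x. x \<in> S \<Longrightarrow> m x \<in> \<rat>"
  obtains l where "linear l" "\<And>x. x \<in> span S \<Longrightarrow> l x = m x" "\<And>x. x \<in> N \<Longrightarrow> l x \<in> \<rat>"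
proof -
  \<comment> \<open>The same group of vectors with rational scalars. Independence over the reals
    implies independence over the rationals; the converse fails in general and has to be earned for
    \<open>B\<close> below.\<close>
  interpret rq: vector_space "\<lambda>(r::rat) (v::vec). of_rat r *\<^sub>R v"
    by unfold_locales (simp_all add: of_rat_add of_rat_mult scaleR_add_left scaleR_add_right)
  obtain B0 where B0: "finite B0" "independent B0" "N = {\<Sum>b\<in>B0. of_int (k b) *\<^sub>R b | k :: vec \<Rightarrow> int. True}"
    using assms unfolding is_lattice_def by blast
  have B0N: "B0 \<subseteq> N" using lattice_of_int_sums[OF B0(3,1)] by blast
  have qind: "\<not> rq.dependent X" if X: "independent X" for X
  proof
    assume "rq.dependent X"
    then obtain t u where "finite t" "t \<subseteq> X" "(\<Sum>v\<in>t. of_rat (u v) *\<^sub>R v) = 0" "\<exists>v\<in>t. u v \<noteq> 0"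
      unfolding rq.dependent_explicit by blast
    then have "dependent X" unfolding real_vector.dependent_explicit
      by (intro exI[of _ t] exI[of _ "\<lambda>v. of_rat (u v)"]) auto
    then show False using X by blast
  qed
  have qspan: "rq.span X \<subseteq> span X" for X
  proof
    fix x assume "x \<in> rq.span X"
    then show "x \<in> span X"
      by (induction rule: rq.span_induct_alt)
        (auto intro: span_zero span_add span_scale span_base)
  qed
  have NB0: "N \<subseteq> rq.span B0"
  proof
    fix x assume "x \<in> N"
    then obtain k :: "vec \<Rightarrow> int" where "x = (\<Sum>b\<in>B0. of_int (k b) *\<^sub>R b)" using B0(3) by blast
    then have "x = (\<Sum>b\<in>B0. of_rat (of_int (k b)) *\<^sub>R b)" by simp
    also have "\<dots> \<in> rq.span B0"
      by (intro rq.span_sum rq.span_scale rq.span_base)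
    finally show "x \<in> rq.span B0" .
  qed
  obtain A where A: "A \<subseteq> S" "\<not> rq.dependent A" "S \<subseteq> rq.span A"
    using rq.maximal_independent_subset by metis
  have "A \<subseteq> N" using A(1) assms(2) by blast
  then obtain B where B: "A \<subseteq> B" "B \<subseteq> N" "\<not> rq.dependent B" "N \<subseteq> rq.span B"
    using rq.maximal_independent_subset_extend[OF _ A(2)] by metis
  have finB: "finite B" "card B \<le> card B0"
    using rq.independent_span_bound[OF B0(1) B(3)] B(2) NB0 by blast+
  have B0B: "B0 \<subseteq> span B" using B0N B(4) qspan by blast
  \<comment> \<open>A real basis \<open>D\<close> extracted from \<open>B\<close> spans
    \<open>B0\<close> and so has at least \<open>card B0\<close> elements, whereas \<open>B\<close>
    has at most that many. Hence \<open>D = B\<close>.\<close>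
  obtain D where D: "D \<subseteq> B" "independent D" "B \<subseteq> span D"
    using real_vector.maximal_independent_subset by metis
  have finD: "finite D" using D(1) finB(1) finite_subset by blast
  have "B0 \<subseteq> span D" using B0B D(3) span_minimal[OF D(3)] by auto
  then have "card B0 \<le> card D" using real_vector.independent_span_bound[OF finD B0(2)] by blast
  then have "D = B" using D(1) finB card_subset_eq card_mono by (metis le_antisym le_trans)
  then have ind: "independent B" using D(2) by blast
  obtain l where l: "linear l" "\<forall>b\<in>B. l b = (if b \<in> A then m b else 0)"
    using linear_independent_extend[OF ind, of "\<lambda>b. if b \<in> A then m b else 0"] by blast
  have "l x = m x" if x: "x \<in> span S" for x
  proof (rule linear_eq_on[OF l(1) assms(3)])
    have "S \<subseteq> span A" using A(3) qspan by blast
    then show "x \<in> span A" using x span_minimal[of S "span A"] by auto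
  qed (use l(2) B(1) in auto)
  moreover have "l x \<in> \<rat>" if "x \<in> N" for x
  proof -
    have "x \<in> rq.span B" using that B(4) by blast
    then show ?thesis
    proof (induction rule: rq.span_induct_alt)
      case base
      then show ?case by (simp add: linear_0[OF l(1)])
    next
      case (step c x y)
      have "l x \<in> \<rat>" using step(1) l(2) assms(4) A(1) by auto
      then show ?case using step(2) by (simp add: linear_add[OF l(1)] linear_scale[OF l(1)])
    qed
  qed
  ultimately show ?thesis using that l(1) by blast
qed

lemma common_denominator:
  assumes "finite X" "X \<subseteq> \<rat>"
  obtains D :: nat where "D > 0" "\<And>x :: real. x \<in> X \<Longrightarrow> of_nat D * x \<in> \<int>"
proof -
  have "\<exists>D::nat. D > 0 \<and> (\<forall>x\<in>X. of_nat D * x \<in> \<int>)"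
    using assms
  proof (induction X rule: finite_induct)
    case empty
    then show ?case by blast
  next
    case (insert x X)
    then obtain D :: nat where D: "D > 0" "\<forall>x\<in>X. of_nat D * x \<in> \<int>" by auto
    obtain a b :: int where ab: "b > 0" "x = of_int a / of_int b"
      using insert.prems by (auto elim: Rats_cases')
    have 1: "of_nat (nat b) * x = of_int a" using ab by simp
    have "of_nat (D * nat b) * x = of_int (int D * a)" 
      by (simp add: 1 mult.assoc del: of_nat_nat)
    then have "of_nat (D * nat b) * x \<in> \<int>" by (metis Ints_of_int)
    moreover have "of_nat (D * nat b) * y \<in> \<int>" if "y \<in> X" for y
    proof -
      have "of_nat (D * nat b) * y = of_nat (nat b) * (of_nat D * y)" by (simp add: algebra_simps)
      also have "\<dots> \<in> \<int>" using D(2) that Ints_mult[OF Ints_of_nat] by blast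
      finally show ?thesis .
    qed
    moreover have "D * nat b > 0" using D(1) ab(1) by simp
    ultimately show ?case by blast
  qed
  then show ?thesis using that by blast
qed

text \<open>Extending the form to all of \<open>N\<close> leaves only the denominators at the
  finitely many basis vectors of \<open>N\<close> to be cleared, and avoids the search for a basis
  of the sublattice.\<close>

lemma bounded_denominator:
  fixes m :: "vec \<Rightarrow> real"
  assumes "is_lattice N" "S \<subseteq> N" "linear m" "\<And>x. x \<in> N \<inter> span S \<Longrightarrow> m x \<in> \<rat>"
  obtains D :: nat where "D > 0" "\<And>x. x \<in> N \<inter> span S \<Longrightarrow> of_nat D * m x \<in> \<int>"
proof -
  have mS: "m x \<in> \<rat>" if "x \<in> S" for x
    using that assms(2,4) span_base by blast
  obtain l where l: "linear l" "\<And>x. x \<in> span S \<Longrightarrow> l x = m x" "\<And>x. x \<in> N \<Longrightarrow> l x \<in> \<rat>"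
    using rational_form_extend[OF assms(1-3) mS] by blast
  obtain B where B: "finite B" "N = {\<Sum>b\<in>B. of_int (k b) *\<^sub>R b | k :: vec \<Rightarrow> int. True}"
    using assms unfolding is_lattice_def by blast
  have "l ` B \<subseteq> \<rat>" using l(3) lattice_of_int_sums(4)[OF B(2,1)] by blast
  then obtain D :: nat where D: "D > 0" "\<And>x. x \<in> l ` B \<Longrightarrow> of_nat D * x \<in> \<int>"
    using common_denominator[of "l ` B"] B(1) by blast
  have "of_nat D * m x \<in> \<int>" if x: "x \<in> N \<inter> span S" for x
  proof -
    obtain k where k: "x = (\<Sum>b\<in>B. of_int (k b) *\<^sub>R b)" using x B(2) by blast
    have "of_nat D * m x = of_nat D * l x" using x l(2) by simp
    also have "\<dots> = (\<Sum>b\<in>B. of_int (k b) * (of_nat D * l b))"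
      unfolding k by (simp add: linear_sum[OF l(1)] linear_scale[OF l(1)] sum_distrib_left algebra_simps)
    also have "\<dots> \<in> \<int>" using D(2) by (intro Ints_sum Ints_mult[OF Ints_of_int]) auto
    finally show ?thesis .
  qed
  then show ?thesis using that D(1) by blast
qed

section \<open>Normal vectors\<close>

lemma rational_coneE:
  assumes "rational_cone N \<sigma>"
  obtains V where "finite V" "V \<subseteq> N" "V \<subseteq> \<sigma>" "\<sigma> = convex_cone hull V" "span \<sigma> = span V"
  using assms span_convex_cone_hull hull_subset unfolding rational_cone_def by metis

lemma rational_cone_convex_cone: "rational_cone N \<sigma> \<Longrightarrow> convex_cone \<sigma>"
  by (metis convex_cone_convex_cone_hull rational_coneE)

lemma dim_insert_span:
  fixes A B :: "'a::real_vector set"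
  assumes "A \<subseteq> span B" "finite B" "x \<notin> span A"
  shows "dim (insert x A) = Suc (dim A)"
proof -
  obtain D where D: "D \<subseteq> A" "independent D" "A \<subseteq> span D" "finite D" "card D = dim A"
    using finite_basis assms by metis
  have xD: "x \<notin> span D" using assms(3) D(1) span_mono by blast
  then have "x \<notin> D" using span_base by blast
  show ?thesis
  proof (rule real_vector.dim_unique)
    show "insert x D \<subseteq> insert x A" using D by blast
    show "insert x A \<subseteq> span (insert x D)" 
      using D(3) span_mono[of D "insert x D"] span_base[of x "insert x D"] by auto
    show "independent (insert x D)" using xD D(2) real_vector.independent_insertI by blast
    show "card (insert x D) = Suc (dim A)" using D \<open>x \<notin> D\<close> by simp
  qed
qed

lemma codim_one_span:
  assumes "rational_cone N \<sigma>" "\<tau> \<subseteq> \<sigma>" "dim \<tau> + 1 = dim \<sigma>" "s \<in> span \<sigma>" "s \<notin> span \<tau>"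
  shows "span \<sigma> = span (insert s \<tau>)"
proof -
  obtain V where V: "finite V" "span \<sigma> = span V" using assms(1) rational_coneE by metis
  have \<sigma>V: "\<sigma> \<subseteq> span V" using V span_superset by metis
  then have "dim (insert s \<tau>) = Suc (dim \<tau>)"
    using dim_insert_span[OF _ V(1) assms(5)] assms(2) by blast
  moreover have "insert s \<tau> \<subseteq> span \<sigma>" using assms span_superset by blast
  ultimately show ?thesis
    using span_eq_if_dim_le[OF _ \<sigma>V V(1), of "insert s \<tau>"] assms(3) by simp
qed

lemma codim_one_witness:
  assumes "rational_cone N \<sigma>" "\<tau> \<subseteq> \<sigma>" "dim \<tau> + 1 = dim \<sigma>"
  obtains s where "s \<in> N" "s \<in> \<sigma>" "s \<notin> span \<tau>"
proof -
  obtain V where V: "finite V" "V \<subseteq> N" "V \<subseteq> \<sigma>" "span \<sigma> = span V" using assms(1) rational_coneE by metis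
  have "\<not> V \<subseteq> span \<tau>"
  proof
    assume "V \<subseteq> span \<tau>"
    then have "span \<sigma> = span \<tau>" 
      using V(4) assms(2) span_mono[of \<tau> \<sigma>] span_minimal[of V "span \<tau>"] by auto
    then have "dim \<sigma> = dim \<tau>" using span_eq_dim by blast
    then show False using assms(3) by simp
  qed
  then show ?thesis using that V by blast
qed

lemma span_insert_coeff:
  assumes "y \<in> span (insert s A)"
  obtains c where "y - c *\<^sub>R s \<in> span A"
  using assms span_breakdown_eq by blast

text \<open>The values are prescribed on the independent set \<open>insert s D\<close>, where
  \<open>D\<close> consists of lattice vectors and spans \<open>span \<tau>\<close>; being rational
  there, the form extends with rational values on the lattice.\<close>

lemma separating_form:
  assumes "is_lattice N" "rational_cone N \<tau>" "s \<in> N" "s \<notin> span \<tau>"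
  obtains \<phi> :: "vec \<Rightarrow> real" where "linear \<phi>" "\<And>x. x \<in> span \<tau> \<Longrightarrow> \<phi> x = 0" "\<phi> s = 1" "\<And>x. x \<in> N \<Longrightarrow> \<phi> x \<in> \<rat>"
proof -
  obtain V where V: "finite V" "V \<subseteq> N" "V \<subseteq> \<tau>" "span \<tau> = span V" using assms(2) rational_coneE by metis
  obtain D where D: "D \<subseteq> V" "independent D" "V \<subseteq> span D"
    using real_vector.maximal_independent_subset by metis
  have VD: "span V = span D" 
    using D span_mono[OF D(1)] span_minimal[OF D(3)] by auto
  have sD: "s \<notin> span D" using assms(4) V(4) VD by simp
  have ind: "independent (insert s D)" using sD D(2) real_vector.independent_insertI by blast
  obtain m :: "vec \<Rightarrow> real" where m: "linear m" "\<forall>b\<in>insert s D. m b = (if b = s then 1 else 0)"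
    using linear_independent_extend[OF ind, of "\<lambda>b. if b = s then 1 else 0"] by blast
  have mD: "m b = 0" if "b \<in> D" for b
    using m(2) that sD span_base by (metis insert_iff)
  have m0: "m x = 0" if "x \<in> span \<tau>" for x
    using linear_eq_0_on_span[OF m(1), of D x] mD that V(4) VD by auto
  have "insert s D \<subseteq> N" using assms(3) D(1) V(2) by blast
  moreover have "m x \<in> \<rat>" if "x \<in> insert s D" for x using that m(2) by auto
  ultimately obtain l where l: "linear l" "\<And>x. x \<in> span (insert s D) \<Longrightarrow> l x = m x" "\<And>x. x \<in> N \<Longrightarrow> l x \<in> \<rat>"
    using rational_form_extend[OF assms(1) _ m(1)] by metis
  have "l x = 0" if "x \<in> span \<tau>" for x
  proof -
    have "x \<in> span (insert s D)" using that V(4) VD span_mono[of D "insert s D"] by auto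
    then show ?thesis using l(2) m0 that by simp
  qed
  moreover have "l s = 1" using l(2) m(2) span_base[of s "insert s D"] by simp
  ultimately show ?thesis using that l by blast
qed

text \<open>An integral form \<open>\<psi>\<close> whose kernel in \<open>span \<sigma>\<close> is
  \<open>span \<tau>\<close> embeds \<open>lat_of N \<sigma>\<close> modulo
  \<open>lat_of N \<tau>\<close> into the integers. A lattice point with the least positive value
  generates the quotient, by division with remainder.\<close>

lemma normal_vector_exists:
  assumes "is_lattice N" "rational_cone N \<tau>" "rational_cone N \<sigma>" "\<tau> \<subseteq> \<sigma>" "dim \<tau> + 1 = dim \<sigma>"
  shows "\<exists>v. is_normal_vector N \<tau> \<sigma> v"
proof -
  obtain s where s: "s \<in> N" "s \<in> \<sigma>" "s \<notin> span \<tau>" using codim_one_witness assms(3-5) by metis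
  obtain \<phi> :: "vec \<Rightarrow> real" where \<phi>: "linear \<phi>" "\<And>x. x \<in> span \<tau> \<Longrightarrow> \<phi> x = 0" "\<phi> s = 1" "\<And>x. x \<in> N \<Longrightarrow> \<phi> x \<in> \<rat>"
    using separating_form[OF assms(1,2) s(1,3)] by blast
  obtain D :: nat where D: "D > 0" "\<And>x. x \<in> N \<inter> span N \<Longrightarrow> of_nat D * \<phi> x \<in> \<int>"
    using bounded_denominator[OF assms(1) subset_refl \<phi>(1)] \<phi>(4) by blast
  define \<psi> where "\<psi> x = of_nat D * \<phi> x" for x
  have \<psi>: "linear \<psi>" 
    by (rule linearI) (simp_all add: \<psi>_def linear_add[OF \<phi>(1)] linear_scale[OF \<phi>(1)] algebra_simps)
  have \<psi>Z: "\<psi> x \<in> \<int>" if "x \<in> N" for x using D(2) that span_base unfolding \<psi>_def by blast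
  have \<psi>0: "\<psi> x = 0" if "x \<in> span \<tau>" for x using \<phi>(2) that by (simp add: \<psi>_def)
  have \<psi>s: "\<psi> s = of_nat D" using \<phi>(3) by (simp add: \<psi>_def)
  have ker: "x \<in> span \<tau>" if "x \<in> span \<sigma>" "\<psi> x = 0" for x
  proof -
    have "span \<sigma> = span (insert s \<tau>)" 
      using codim_one_span[OF assms(3-5)] s span_base by blast
    then obtain c where c: "x - c *\<^sub>R s \<in> span \<tau>" using \<open>x \<in> span \<sigma>\<close> span_insert_coeff by blast
    then have "c * of_nat D = 0" 
      using \<psi>0[OF c] that(2) \<psi>s by (simp add: linear_diff[OF \<psi>] linear_scale[OF \<psi>])
    then show ?thesis using c D(1) by simp
  qed
  define P where "P k \<longleftrightarrow> k > 0 \<and> (\<exists>x\<in>lat_of N \<sigma>. \<psi> x = of_nat k)" for k :: nat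
  have "P D" using D(1) s \<psi>s span_base unfolding P_def lat_of_def by blast
  then have "P (LEAST k. P k)" by (rule LeastI)
  then obtain m v where m: "m = (LEAST k. P k)" "m > 0" "v \<in> lat_of N \<sigma>" "\<psi> v = of_nat m"
    unfolding P_def by blast
  have gen: "\<exists>k :: int. x - of_int k *\<^sub>R v \<in> lat_of N \<tau>" if x: "x \<in> lat_of N \<sigma>" for x
  proof -
    obtain j :: int where j: "\<psi> x = of_int j" using \<psi>Z x by (auto simp: lat_of_def elim: Ints_cases)
    define k where "k = j div int m"
    define y where "y = x - of_int k *\<^sub>R v"
    have y: "y \<in> lat_of N \<sigma>" using x m(3) lat_of_closed[OF assms(1)] by (simp add: y_def)
    have "\<psi> y = of_int (j - k * int m)" 
      by (simp add: y_def linear_diff[OF \<psi>] linear_scale[OF \<psi>] j m(4))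
    also have "j - k * int m = j mod int m" by (simp add: k_def minus_div_mult_eq_mod)
    finally have \<psi>y: "\<psi> y = of_nat (nat (j mod int m))" using m(2) by simp
    have "nat (j mod int m) < m" using m(2) by (simp add: nat_less_iff)
    then have "\<not> P (nat (j mod int m))" using m(1) not_less_Least by metis
    then have "nat (j mod int m) = 0" using y \<psi>y by (auto simp: P_def)
    then have "\<psi> y = 0" using \<psi>y by simp
    then have "y \<in> lat_of N \<tau>" using y ker by (auto simp: lat_of_def)
    then show ?thesis using y_def by blast
  qed
  \<comment> \<open>Both vectors have the same value under \<open>\<psi>\<close>, so
    \<open>v\<close> agrees modulo \<open>span \<tau>\<close> with a positive multiple of the point
    \<open>s\<close> of \<open>\<sigma>\<close>: the generator is on the correct side.\<close>
  have "v - (of_nat m / of_nat D) *\<^sub>R s \<in> span \<tau>"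
  proof (rule ker)
    show "v - (of_nat m / of_nat D) *\<^sub>R s \<in> span \<sigma>"
      using m(3) s by (auto simp: lat_of_def intro: span_diff span_scale span_base)
    show "\<psi> (v - (of_nat m / of_nat D) *\<^sub>R s) = 0"
      using \<psi>s m(4) D(1) by (simp add: linear_diff[OF \<psi>] linear_scale[OF \<psi>])
  qed
  moreover have "(of_nat m / of_nat D) *\<^sub>R s \<in> \<sigma>"
    by (rule convex_cone_scaleR[OF rational_cone_convex_cone[OF assms(3)]]) (use s in auto)
  ultimately show ?thesis using m(3) gen unfolding is_normal_vector_def by blast
qed

lemma normal_vector_lat: "is_normal_vector N \<tau> \<sigma> v \<Longrightarrow> v \<in> lat_of N \<sigma>"
  by (simp add: is_normal_vector_def)

lemma normal_vector_span: "is_normal_vector N \<tau> \<sigma> v \<Longrightarrow> v \<in> span \<sigma>"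
  by (simp add: is_normal_vector_def lat_of_def)

text \<open>Extends extremality from \<open>\<tau>\<close> to its span: an interior point
  \<open>p\<close> of \<open>\<tau>\<close> stays in \<open>\<tau>\<close> after adding
  \<open>e (a + b)\<close>, and the result is a sum of points of \<open>\<sigma>\<close> with
  \<open>e a\<close> or \<open>e b\<close> as one summand.\<close>

lemma extremal_sum_span:
  assumes "extremal \<tau> \<sigma>" "convex_cone \<tau>" "convex_cone \<sigma>" "arint \<tau> \<noteq> {}"
    "a \<in> \<sigma>" "b \<in> \<sigma>" "a + b \<in> span \<tau>"
  shows "a \<in> \<tau>" "b \<in> \<tau>"
proof -
  obtain p where p: "p \<in> arint \<tau>" using assms(4) by blast
  obtain e where e: "e > 0" "\<And>t. 0 \<le> t \<Longrightarrow> t \<le> e \<Longrightarrow> p + t *\<^sub>R (a + b) \<in> \<tau>"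
    using arint_span[OF assms(2) p assms(7)] by blast
  have eq: "p + e *\<^sub>R (a + b) = (p + e *\<^sub>R b) + e *\<^sub>R a" "p + e *\<^sub>R (a + b) = (p + e *\<^sub>R a) + e *\<^sub>R b"
    by (simp_all add: algebra_simps)
  have p\<sigma>: "p \<in> \<sigma>" using p arint_subset assms(1) by (auto simp: extremal_def)
  have mem: "e *\<^sub>R a \<in> \<sigma>" "e *\<^sub>R b \<in> \<sigma>" "p + e *\<^sub>R b \<in> \<sigma>" "p + e *\<^sub>R a \<in> \<sigma>"
    using assms p\<sigma> e(1) by (simp_all add: convex_cone_add convex_cone_scaleR)
  have "p + e *\<^sub>R (a + b) \<in> \<tau>" using e by simp
  then have "e *\<^sub>R a \<in> \<tau>" "e *\<^sub>R b \<in> \<tau>"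
    using assms(1) mem eq unfolding extremal_def by metis+
  then have "(1/e) *\<^sub>R (e *\<^sub>R a) \<in> \<tau>" "(1/e) *\<^sub>R (e *\<^sub>R b) \<in> \<tau>"
    by (auto intro!: convex_cone_scaleR[OF assms(2)] simp del: scaleR_scaleR) (use e in auto)
  then show "a \<in> \<tau>" "b \<in> \<tau>" using e by simp_all
qed

lemma rational_cone_arint: "rational_cone N \<tau> \<Longrightarrow> arint \<tau> \<noteq> {}"
  using arint_nonempty rational_coneE by metis

lemma normal_vector_not_span:
  assumes "is_normal_vector N \<tau> \<sigma> v" "rational_cone N \<sigma>" "\<tau> \<subseteq> \<sigma>" "dim \<tau> + 1 = dim \<sigma>"
  shows "v \<notin> span \<tau>"
proof
  assume v: "v \<in> span \<tau>"
  obtain s where s: "s \<in> N" "s \<in> \<sigma>" "s \<notin> span \<tau>" using codim_one_witness assms(2-4) by metis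
  then have "s \<in> lat_of N \<sigma>" using span_base by (auto simp: lat_of_def)
  then obtain k :: int where "s - of_int k *\<^sub>R v \<in> span \<tau>"
    using assms(1) by (auto simp: is_normal_vector_def lat_of_def)
  then have "(s - of_int k *\<^sub>R v) + of_int k *\<^sub>R v \<in> span \<tau>"
    using v span_add span_scale by blast
  then show False using s(3) by simp
qed

text \<open>Two generators of an infinite cyclic quotient agree up to sign. Opposite signs would
  give \<open>s\<close> and \<open>t\<close> in \<open>\<sigma>\<close> with \<open>s + t\<close> in
  \<open>span \<tau>\<close>, and extremality would force \<open>s\<close>, hence \<open>v\<close>,
  into \<open>span \<tau>\<close>.\<close>

lemma normal_vector_unique:
  assumes v: "is_normal_vector N \<tau> \<sigma> v" and w: "is_normal_vector N \<tau> \<sigma> w"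
    and \<tau>: "rational_cone N \<tau>" and \<sigma>: "rational_cone N \<sigma>" 
    and face: "extremal \<tau> \<sigma>" "dim \<tau> + 1 = dim \<sigma>"
  shows "v - w \<in> span \<tau>"
proof -
  have \<tau>\<sigma>: "\<tau> \<subseteq> \<sigma>" using face(1) by (simp add: extremal_def)
  obtain k :: int where k: "v - of_int k *\<^sub>R w \<in> span \<tau>"
    using v w by (auto simp: is_normal_vector_def lat_of_def)
  obtain j :: int where j: "w - of_int j *\<^sub>R v \<in> span \<tau>"
    using v w by (auto simp: is_normal_vector_def lat_of_def)
  have vs: "v \<notin> span \<tau>" using normal_vector_not_span[OF v \<sigma> \<tau>\<sigma> face(2)] .
  have "(v - of_int k *\<^sub>R w) + of_int k *\<^sub>R (w - of_int j *\<^sub>R v) \<in> span \<tau>"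
    using k j span_add span_scale by blast
  moreover have "(v - of_int k *\<^sub>R w) + of_int k *\<^sub>R (w - of_int j *\<^sub>R v) = (1 - of_int (k * j)) *\<^sub>R v"
    by (simp add: algebra_simps)
  ultimately have h: "(1 - of_int (k * j)) *\<^sub>R v \<in> span \<tau>" by simp
  have "k * j = 1"
  proof (rule ccontr)
    assume "k * j \<noteq> 1"
    then have nz: "1 - real_of_int (k * j) \<noteq> 0" by (metis eq_iff_diff_eq_0 of_int_eq_1_iff)
    have "(1 / (1 - real_of_int (k * j))) *\<^sub>R ((1 - of_int (k * j)) *\<^sub>R v) \<in> span \<tau>" 
      using h span_scale by blast
    then show False using vs nz by simp
  qed
  then have "k = 1 \<or> k = -1" by (metis zmult_eq_1_iff)
  moreover have "k \<noteq> -1"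
  proof
    assume "k = -1"
    then have vw: "v + w \<in> span \<tau>" using k by simp
    obtain s t where st: "s \<in> \<sigma>" "v - s \<in> span \<tau>" "t \<in> \<sigma>" "w - t \<in> span \<tau>"
      using v w by (auto simp: is_normal_vector_def)
    have "(v + w) - (v - s) - (w - t) \<in> span \<tau>" using vw st span_diff by blast
    then have "s + t \<in> span \<tau>" by (simp add: algebra_simps)
    then have "s \<in> \<tau>"
      using extremal_sum_span[OF face(1) _ _ _ st(1,3)] \<tau> \<sigma> 
        rational_cone_arint rational_cone_convex_cone by blast
    then have "v - s + s \<in> span \<tau>" using st(2) span_add span_base by blast
    then show False using vs by simp
  qed
  ultimately show ?thesis using k by simp
qed

section \<open>Cones of a fan\<close>

lemma fan_cone:
  assumes "rational_fan F" "\<sigma> \<in> cones F"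
  shows "rational_cone (lat F) \<sigma>" "convex_cone \<sigma>" "arint \<sigma> \<noteq> {}" "0 \<in> \<sigma>" "strongly_convex \<sigma>" "closed \<sigma>"
proof -
  show r: "rational_cone (lat F) \<sigma>" and s: "strongly_convex \<sigma>" using assms by (auto simp: rational_fan_def)
  then show "convex_cone \<sigma>" "arint \<sigma> \<noteq> {}" "0 \<in> \<sigma>"
    using rational_cone_convex_cone rational_cone_arint convex_cone_contains_0 by blast+
  show "closed \<sigma>" using r s closed_strongly_convex_hull rational_coneE by metis
qed

lemma fan_lattice: "rational_fan F \<Longrightarrow> is_lattice (lat F)"
  by (simp add: rational_fan_def)

lemma fan_finite: "rational_fan F \<Longrightarrow> finite (cones F)"
  by (simp add: rational_fan_def)

lemma fan_inter:
  assumes "rational_fan F" "\<sigma> \<in> cones F" "\<sigma>' \<in> cones F"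
  shows "\<sigma> \<inter> \<sigma>' \<in> cones F" "extremal (\<sigma> \<inter> \<sigma>') \<sigma>"
proof -
  have "cone_face (\<sigma> \<inter> \<sigma>') \<sigma>" using assms by (simp add: rational_fan_def)
  then show "\<sigma> \<inter> \<sigma>' \<in> cones F" "extremal (\<sigma> \<inter> \<sigma>') \<sigma>"
    using assms cone_face_extremal[OF _ fan_cone(2)] by (auto simp: rational_fan_def)
qed

lemma fan_extremal:
  assumes "rational_fan F" "\<tau> \<in> cones F" "\<sigma> \<in> cones F" "\<tau> \<subseteq> \<sigma>"
  shows "extremal \<tau> \<sigma>"
  using fan_inter(2)[OF assms(1,3,2)] assms(4) by (simp add: Int_absorb1)

text \<open>The intersection of the two cones is a face of \<open>\<tau>\<close> through an interior
  point of \<open>\<tau>\<close>, hence all of \<open>\<tau>\<close>. This is the usual way below to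
  show that one cone contains another.\<close>

lemma fan_arint_subset:
  assumes "rational_fan F" "\<tau> \<in> cones F" "\<sigma> \<in> cones F" "p \<in> arint \<tau>" "p \<in> \<sigma>"
  shows "\<tau> \<subseteq> \<sigma>"
proof -
  have "\<tau> \<subseteq> \<tau> \<inter> \<sigma>"
    using assms arint_subset
    by (intro extremal_arint_subset[OF fan_inter(2)[OF assms(1-3)] _ assms(4)] fan_cone(2)[OF assms(1)] fan_inter) auto
  then show ?thesis by blast
qed

lemma fan_span_face:
  assumes "rational_fan F" "\<tau> \<in> cones F" "\<sigma> \<in> cones F" "\<tau> \<subseteq> \<sigma>" "y \<in> \<sigma>" "y \<in> span \<tau>"
  shows "y \<in> \<tau>"
  using extremal_sum_span(1)[OF fan_extremal[OF assms(1-4)] fan_cone(2)[OF assms(1,2)] 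
      fan_cone(2)[OF assms(1,3)] fan_cone(3)[OF assms(1,2)] assms(5) fan_cone(4)[OF assms(1,3)]] assms(6)
  by simp

lemma cone_span_finite:
  assumes "rational_cone N \<sigma>"
  obtains V where "finite V" "\<sigma> \<subseteq> span V" "span \<sigma> = span V"
proof -
  obtain V where V: "finite V" "span \<sigma> = span V" using assms by (rule rational_coneE)
  show ?thesis using that[OF V(1) _ V(2)] span_superset[of \<sigma>] V(2) by simp
qed

lemma rational_cone_dim_mono:
  assumes "rational_cone N \<sigma>" "\<tau> \<subseteq> span \<sigma>"
  shows "dim \<tau> \<le> dim \<sigma>" "dim \<tau> = dim \<sigma> \<Longrightarrow> span \<tau> = span \<sigma>"
proof -
  obtain V where "finite V" "\<sigma> \<subseteq> span V" using assms(1) cone_span_finite by metis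
  then show "dim \<tau> \<le> dim \<sigma>" "dim \<tau> = dim \<sigma> \<Longrightarrow> span \<tau> = span \<sigma>"
    using dim_mono_span[OF assms(2)] span_eq_if_dim_le[OF assms(2)] by auto
qed

lemma fan_dim_mono:
  assumes "rational_fan F" "\<sigma> \<in> cones F" "\<tau> \<subseteq> \<sigma>"
  shows "dim \<tau> \<le> dim \<sigma>" "dim \<tau> = dim \<sigma> \<Longrightarrow> span \<tau> = span \<sigma>"
proof -
  have "\<tau> \<subseteq> span \<sigma>" using assms(3) span_superset[of \<sigma>] by (rule subset_trans)
  then show "dim \<tau> \<le> dim \<sigma>" "dim \<tau> = dim \<sigma> \<Longrightarrow> span \<tau> = span \<sigma>"
    using rational_cone_dim_mono[OF fan_cone(1)[OF assms(1,2)]] by blast+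
qed

lemma fan_dim_eq:
  assumes "rational_fan F" "\<tau> \<in> cones F" "\<sigma> \<in> cones F" "\<tau> \<subseteq> \<sigma>" "dim \<tau> \<ge> dim \<sigma>"
  shows "\<tau> = \<sigma>"
proof -
  have "span \<tau> = span \<sigma>" using fan_dim_mono[OF assms(1,3,4)] assms(5) by simp
  then show ?thesis using fan_span_face[OF assms(1-4)] assms(4) span_base by blast
qed

lemma fan_min_cone:
  assumes "rational_fan F" "x \<in> support F"
  obtains \<mu> where "\<mu> \<in> cones F" "x \<in> arint \<mu>"
proof -
  obtain \<sigma> where \<sigma>: "\<sigma> \<in> cones F" "x \<in> \<sigma>" using assms(2) by (auto simp: support_def)
  show ?thesis
    using that minimal_face[OF fan_cone(2)[OF assms(1) \<sigma>(1)] \<sigma>(2)] assms(1) \<sigma>(1)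
    by (auto simp: rational_fan_def)
qed

lemma fan_dim_ge: "rational_fan F \<Longrightarrow> \<sigma> \<in> cones F \<Longrightarrow> dim \<sigma> \<le> fan_dim F"
  by (simp add: fan_dim_def rational_fan_def)

lemma facet_dim_ge: 
  "rational_fan F \<Longrightarrow> \<sigma> \<in> cones F \<Longrightarrow> \<phi> \<in> facets F \<Longrightarrow> \<phi> \<subseteq> \<sigma> \<Longrightarrow> \<sigma> = \<phi>"
  using fan_dim_eq[of F \<phi> \<sigma>] fan_dim_ge[of F \<sigma>] by (auto simp: facets_def)

lemma tropical_rational: "tropical_fan F \<Longrightarrow> rational_fan F"
  by (simp add: tropical_fan_def)

lemma cone_in_facet:
  assumes "tropical_fan F" "\<sigma> \<in> cones F"
  obtains \<phi> where "\<phi> \<in> facets F" "\<sigma> \<subseteq> \<phi>"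
proof -
  define A where "A = {\<tau> \<in> cones F. \<sigma> \<subseteq> \<tau>}"
  have "finite A" "\<sigma> \<in> A" using assms by (simp_all add: A_def fan_finite tropical_rational)
  then obtain \<phi> where "\<phi> \<in> A" "\<forall>b\<in>A. \<phi> \<subseteq> b \<longrightarrow> \<phi> = b"
    using finite_has_maximal2[of A \<sigma>] by blast
  then have \<phi>: "\<phi> \<in> cones F" "\<sigma> \<subseteq> \<phi>" "\<And>\<tau>. \<tau> \<in> cones F \<Longrightarrow> \<sigma> \<subseteq> \<tau> \<Longrightarrow> \<phi> \<subseteq> \<tau> \<Longrightarrow> \<phi> = \<tau>"
    by (auto simp: A_def)
  have "\<forall>\<tau>\<in>cones F. \<phi> \<subseteq> \<tau> \<longrightarrow> \<tau> = \<phi>" using \<phi> by blast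
  then have "\<phi> \<in> facets F"
    using assms(1) \<phi>(1) by (simp add: facets_def tropical_fan_def pure_dim_def)
  then show ?thesis using that \<phi>(2) by blast
qed

lemma finite_facets: "rational_fan F \<Longrightarrow> finite (facets F)"
  by (simp add: facets_def fan_finite)

lemma facet_cone: "\<sigma> \<in> facets F \<Longrightarrow> \<sigma> \<in> cones F"
  by (simp add: facets_def)

lemma ridge_cone: "\<tau> \<in> ridges F \<Longrightarrow> \<tau> \<in> cones F"
  by (simp add: ridges_def)

lemma ridge_facet_dim: "\<tau> \<in> ridges F \<Longrightarrow> \<sigma> \<in> facets F \<Longrightarrow> dim \<tau> + 1 = dim \<sigma>"
  by (simp add: ridges_def facets_def)

lemma ridge_facet_unique:
  assumes "rational_fan F" "\<tau> \<in> ridges F" "\<sigma> \<in> facets F" "\<tau> \<subseteq> \<sigma>" 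
    "is_normal_vector (lat F) \<tau> \<sigma> v" "is_normal_vector (lat F) \<tau> \<sigma> w"
  shows "v - w \<in> span \<tau>"
proof -
  have "\<tau> \<in> cones F" "\<sigma> \<in> cones F" using assms ridge_cone facet_cone by auto
  then show ?thesis
    using normal_vector_unique[OF assms(5,6)] fan_cone(1)[OF assms(1)] fan_extremal[OF assms(1)] 
      ridge_facet_dim[OF assms(2,3)] assms(4) by simp
qed

lemma ridge_facet_normal:
  assumes "rational_fan F" "\<tau> \<in> ridges F" "\<sigma> \<in> facets F" "\<tau> \<subseteq> \<sigma>"
  shows "is_normal_vector (lat F) \<tau> \<sigma> (normal_vector (lat F) \<tau> \<sigma>)"
proof -
  have "\<exists>v. is_normal_vector (lat F) \<tau> \<sigma> v"
    using normal_vector_exists assms fan_lattice fan_cone(1) ridge_facet_dim ridge_cone facet_cone by metis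
  then show ?thesis unfolding normal_vector_def by (rule someI_ex)
qed

text \<open>The balancing condition of a tropical fan, freed from the selected
  \<open>normal_vector\<close>: another choice changes each summand by an element of
  \<open>span \<tau>\<close>.\<close>

lemma normal_sum_in_span:
  assumes "tropical_fan F" "\<tau> \<in> ridges F"
    "\<And>\<sigma>. \<sigma> \<in> facets F \<Longrightarrow> \<tau> \<subseteq> \<sigma> \<Longrightarrow> is_normal_vector (lat F) \<tau> \<sigma> (n \<sigma>)"
  shows "(\<Sum>\<sigma> | \<sigma> \<in> facets F \<and> \<tau> \<subseteq> \<sigma>. n \<sigma>) \<in> span \<tau>"
proof -
  have rf: "rational_fan F" using assms(1) tropical_rational by blast
  have "(\<Sum>\<sigma> | \<sigma> \<in> facets F \<and> \<tau> \<subseteq> \<sigma>. n \<sigma> - normal_vector (lat F) \<tau> \<sigma>) \<in> span \<tau>"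
    using ridge_facet_unique[OF rf assms(2)] ridge_facet_normal[OF rf assms(2)] assms(3)
    by (intro span_sum) blast
  moreover have "normal_sum F \<tau> \<in> span \<tau>" 
    using assms(1,2) by (auto simp: tropical_fan_def lat_of_def)
  ultimately have "(\<Sum>\<sigma> | \<sigma> \<in> facets F \<and> \<tau> \<subseteq> \<sigma>. n \<sigma> - normal_vector (lat F) \<tau> \<sigma>) + normal_sum F \<tau> \<in> span \<tau>"
    by (rule span_add)
  then show ?thesis by (simp add: normal_sum_def sum_subtractf)
qed

section \<open>Div-faithfulness at a cone\<close>

text \<open>
  A function on the star fan at \<open>\<eta>\<close> is replaced by a compatible family of linear forms on the cones
  containing \<open>\<eta>\<close>; the family need not vanish on \<open>\<eta>\<close>, and it suffices that its values on the
  lattices are rational.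
\<close>

definition local_family :: "fan \<Rightarrow> vec set \<Rightarrow> (vec set \<Rightarrow> vec \<Rightarrow> real) \<Rightarrow> bool" where
  "local_family F \<eta> l \<longleftrightarrow>
     (\<forall>\<sigma>\<in>cones F. \<eta> \<subseteq> \<sigma> \<longrightarrow> linear (l \<sigma>) \<and> (\<forall>x\<in>lat_of (lat F) \<sigma>. l \<sigma> x \<in> \<rat>)) \<and>
     (\<forall>\<sigma>\<in>cones F. \<forall>\<sigma>'\<in>cones F. \<eta> \<subseteq> \<sigma> \<longrightarrow> \<sigma> \<subseteq> \<sigma>' \<longrightarrow> (\<forall>x\<in>\<sigma>. l \<sigma> x = l \<sigma>' x))"

text \<open>Corresponds to the vanishing of \<open>ord_at\<close>. The normal vectors are quantified
  existentially because the selected ones are not preserved when a fan is mapped to another.\<close>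

definition balanced_at :: "fan \<Rightarrow> vec set \<Rightarrow> (vec set \<Rightarrow> vec \<Rightarrow> real) \<Rightarrow> bool" where
  "balanced_at F \<tau> l \<longleftrightarrow>
     (\<exists>n. (\<forall>\<sigma>\<in>facets F. \<tau> \<subseteq> \<sigma> \<longrightarrow> is_normal_vector (lat F) \<tau> \<sigma> (n \<sigma>)) \<and>
        (\<Sum>\<sigma> | \<sigma> \<in> facets F \<and> \<tau> \<subseteq> \<sigma>. l \<sigma> (n \<sigma>)) = l \<tau> (\<Sum>\<sigma> | \<sigma> \<in> facets F \<and> \<tau> \<subseteq> \<sigma>. n \<sigma>))"

definition balanced_family :: "fan \<Rightarrow> vec set \<Rightarrow> (vec set \<Rightarrow> vec \<Rightarrow> real) \<Rightarrow> bool" where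
  "balanced_family F \<eta> l \<longleftrightarrow> local_family F \<eta> l \<and> (\<forall>\<tau>\<in>ridges F. \<eta> \<subseteq> \<tau> \<longrightarrow> balanced_at F \<tau> l)"

definition local_faithful :: "fan \<Rightarrow> vec set \<Rightarrow> bool" where
  "local_faithful F \<eta> \<longleftrightarrow> (\<forall>l. balanced_family F \<eta> l \<longrightarrow>
     (\<exists>L. linear L \<and> (\<forall>\<sigma>\<in>cones F. \<eta> \<subseteq> \<sigma> \<longrightarrow> (\<forall>x\<in>\<sigma>. l \<sigma> x = L x))))"

lemma local_family_linear: "local_family F \<eta> l \<Longrightarrow> \<sigma> \<in> cones F \<Longrightarrow> \<eta> \<subseteq> \<sigma> \<Longrightarrow> linear (l \<sigma>)"
  by (simp add: local_family_def)

lemma local_family_rational: 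
  "local_family F \<eta> l \<Longrightarrow> \<sigma> \<in> cones F \<Longrightarrow> \<eta> \<subseteq> \<sigma> \<Longrightarrow> x \<in> lat_of (lat F) \<sigma> \<Longrightarrow> l \<sigma> x \<in> \<rat>"
  by (simp add: local_family_def)

lemma local_family_compat:
  assumes "local_family F \<eta> l" "\<sigma> \<in> cones F" "\<sigma>' \<in> cones F" "\<eta> \<subseteq> \<sigma>" "\<sigma> \<subseteq> \<sigma>'" "x \<in> span \<sigma>"
  shows "l \<sigma> x = l \<sigma>' x"
proof (rule linear_eq_on[OF _ _ assms(6)])
  show "linear (l \<sigma>)" "linear (l \<sigma>')" using assms by (auto simp: local_family_def)
  show "l \<sigma> b = l \<sigma>' b" if "b \<in> \<sigma>" for b 
    using assms that unfolding local_family_def by blast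
qed

text \<open>A change of normal vectors alters both sides equally, since \<open>l \<sigma>\<close>
  and \<open>l \<tau>\<close> agree on \<open>span \<tau>\<close>. Uniqueness is an assumption so
  that the lemma also applies to targets of projections, which are not known to be fans.\<close>

lemma balanced_any_normals_if_unique:
  assumes l: "local_family F \<eta> l" and \<tau>: "\<tau> \<in> ridges F" "\<eta> \<subseteq> \<tau>" and b: "balanced_at F \<tau> l"
    and uniq: "\<And>\<sigma> v w. \<sigma> \<in> facets F \<Longrightarrow> \<tau> \<subseteq> \<sigma> \<Longrightarrow> is_normal_vector (lat F) \<tau> \<sigma> v \<Longrightarrow>
      is_normal_vector (lat F) \<tau> \<sigma> w \<Longrightarrow> v - w \<in> span \<tau>"
    and n: "\<And>\<sigma>. \<sigma> \<in> facets F \<Longrightarrow> \<tau> \<subseteq> \<sigma> \<Longrightarrow> is_normal_vector (lat F) \<tau> \<sigma> (n \<sigma>)"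
  shows "(\<Sum>\<sigma> | \<sigma> \<in> facets F \<and> \<tau> \<subseteq> \<sigma>. l \<sigma> (n \<sigma>)) = l \<tau> (\<Sum>\<sigma> | \<sigma> \<in> facets F \<and> \<tau> \<subseteq> \<sigma>. n \<sigma>)"
proof -
  obtain m where m: "\<And>\<sigma>. \<sigma> \<in> facets F \<Longrightarrow> \<tau> \<subseteq> \<sigma> \<Longrightarrow> is_normal_vector (lat F) \<tau> \<sigma> (m \<sigma>)"
    "(\<Sum>\<sigma> | \<sigma> \<in> facets F \<and> \<tau> \<subseteq> \<sigma>. l \<sigma> (m \<sigma>)) = l \<tau> (\<Sum>\<sigma> | \<sigma> \<in> facets F \<and> \<tau> \<subseteq> \<sigma>. m \<sigma>)"
    using b unfolding balanced_at_def by blast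
  have lt: "linear (l \<tau>)" using l \<tau> ridge_cone local_family_linear by blast
  have "l \<sigma> (n \<sigma>) - l \<tau> (n \<sigma>) = l \<sigma> (m \<sigma>) - l \<tau> (m \<sigma>)" if s: "\<sigma> \<in> facets F" "\<tau> \<subseteq> \<sigma>" for \<sigma>
  proof -
    have ls: "linear (l \<sigma>)" using l s \<tau>(2) facet_cone local_family_linear by blast
    have "n \<sigma> - m \<sigma> \<in> span \<tau>" using uniq[OF s n m(1)] s by blast
    then have "l \<tau> (n \<sigma> - m \<sigma>) = l \<sigma> (n \<sigma> - m \<sigma>)"
      using local_family_compat[OF l] \<tau> s ridge_cone facet_cone by blast
    then show ?thesis by (simp add: linear_diff[OF lt] linear_diff[OF ls])
  qed
  then have "(\<Sum>\<sigma> | \<sigma> \<in> facets F \<and> \<tau> \<subseteq> \<sigma>. l \<sigma> (n \<sigma>) - l \<tau> (n \<sigma>)) 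
      = (\<Sum>\<sigma> | \<sigma> \<in> facets F \<and> \<tau> \<subseteq> \<sigma>. l \<sigma> (m \<sigma>) - l \<tau> (m \<sigma>))"
    by (intro sum.cong) auto
  then show ?thesis using m(2) by (simp add: sum_subtractf linear_sum[OF lt])
qed

lemma balanced_any_normals:
  assumes F: "rational_fan F" and l: "local_family F \<eta> l" and \<tau>: "\<tau> \<in> ridges F" "\<eta> \<subseteq> \<tau>" and b: "balanced_at F \<tau> l"
    and n: "\<And>\<sigma>. \<sigma> \<in> facets F \<Longrightarrow> \<tau> \<subseteq> \<sigma> \<Longrightarrow> is_normal_vector (lat F) \<tau> \<sigma> (n \<sigma>)"
  shows "(\<Sum>\<sigma> | \<sigma> \<in> facets F \<and> \<tau> \<subseteq> \<sigma>. l \<sigma> (n \<sigma>)) = l \<tau> (\<Sum>\<sigma> | \<sigma> \<in> facets F \<and> \<tau> \<subseteq> \<sigma>. n \<sigma>)"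
  by (rule balanced_any_normals_if_unique[OF l \<tau> b]) (fact ridge_facet_unique[OF F \<tau>(1)], fact n)

lemma local_faithfulD:
  assumes "local_faithful F \<eta>" "local_family F \<eta> l" "\<And>\<tau>. \<tau> \<in> ridges F \<Longrightarrow> \<eta> \<subseteq> \<tau> \<Longrightarrow> balanced_at F \<tau> l"
  obtains L where "linear L" "\<And>\<sigma> x. \<sigma> \<in> cones F \<Longrightarrow> \<eta> \<subseteq> \<sigma> \<Longrightarrow> x \<in> span \<sigma> \<Longrightarrow> l \<sigma> x = L x"
proof -
  obtain L where L: "linear L" "\<And>\<sigma> x. \<sigma> \<in> cones F \<Longrightarrow> \<eta> \<subseteq> \<sigma> \<Longrightarrow> x \<in> \<sigma> \<Longrightarrow> l \<sigma> x = L x"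
    using assms unfolding local_faithful_def balanced_family_def by metis
  have "l \<sigma> x = L x" if "\<sigma> \<in> cones F" "\<eta> \<subseteq> \<sigma>" "x \<in> span \<sigma>" for \<sigma> x
    using linear_eq_on[OF _ L(1) that(3), of "l \<sigma>"] L(2) that assms(2) local_family_linear by blast
  then show ?thesis using that L(1) by blast
qed

lemma local_faithfulI:
  assumes "\<And>l. local_family F \<eta> l \<Longrightarrow> (\<And>\<tau>. \<tau> \<in> ridges F \<Longrightarrow> \<eta> \<subseteq> \<tau> \<Longrightarrow> balanced_at F \<tau> l) \<Longrightarrow>
     \<exists>L. linear L \<and> (\<forall>\<sigma>\<in>cones F. \<eta> \<subseteq> \<sigma> \<longrightarrow> (\<forall>x\<in>\<sigma>. l \<sigma> x = L x))"
  shows "local_faithful F \<eta>"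
  unfolding local_faithful_def balanced_family_def
proof (intro allI impI)
  fix l assume "local_family F \<eta> l \<and> (\<forall>\<tau>\<in>ridges F. \<eta> \<subseteq> \<tau> \<longrightarrow> balanced_at F \<tau> l)"
  then show "\<exists>L. linear L \<and> (\<forall>\<sigma>\<in>cones F. \<eta> \<subseteq> \<sigma> \<longrightarrow> (\<forall>x\<in>\<sigma>. l \<sigma> x = L x))"
    using assms[of l] by simp
qed

text \<open>Together with \<open>balanced_at_add\<close> this allows a family to be normalised by a
  global form without disturbing balancing.\<close>

lemma local_family_add:
  assumes "local_family F \<eta> l" "linear L" "\<And>x. x \<in> lat F \<Longrightarrow> L x \<in> \<rat>"
  shows "local_family F \<eta> (\<lambda>\<sigma> x. l \<sigma> x + L x)"
  unfolding local_family_def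
proof (intro conjI ballI impI)
  fix \<sigma> assume s: "\<sigma> \<in> cones F" "\<eta> \<subseteq> \<sigma>"
  show "linear (\<lambda>x. l \<sigma> x + L x)"
    using local_family_linear[OF assms(1) s] assms(2) by (rule linear_compose_add)
  show "l \<sigma> x + L x \<in> \<rat>" if "x \<in> lat_of (lat F) \<sigma>" for x
    using local_family_rational[OF assms(1) s that] assms(3)[of x] that by (simp add: lat_of_def)
next
  fix \<sigma> \<sigma>' x assume h: "\<sigma> \<in> cones F" "\<sigma>' \<in> cones F" "\<eta> \<subseteq> \<sigma>" "\<sigma> \<subseteq> \<sigma>'" "x \<in> \<sigma>"
  show "l \<sigma> x + L x = l \<sigma>' x + L x"
    using local_family_compat[OF assms(1) h(1-4)] span_base[OF h(5)] by simp
qed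

lemma balanced_at_add:
  assumes "linear L" "balanced_at F \<tau> l"
  shows "balanced_at F \<tau> (\<lambda>\<sigma> x. l \<sigma> x + L x)"
proof -
  obtain n where n: "\<forall>\<sigma>\<in>facets F. \<tau> \<subseteq> \<sigma> \<longrightarrow> is_normal_vector (lat F) \<tau> \<sigma> (n \<sigma>)"
    "(\<Sum>\<sigma> | \<sigma> \<in> facets F \<and> \<tau> \<subseteq> \<sigma>. l \<sigma> (n \<sigma>)) = l \<tau> (\<Sum>\<sigma> | \<sigma> \<in> facets F \<and> \<tau> \<subseteq> \<sigma>. n \<sigma>)"
    using assms(2) unfolding balanced_at_def by blast
  show ?thesis unfolding balanced_at_def
    by (intro exI[of _ n] conjI n(1)) (simp add: n(2) sum.distrib linear_sum[OF assms(1)])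
qed

section \<open>Transport along a linear map\<close>

text \<open>\<open>G\<close> is not assumed to be a fan, nor \<open>lat G\<close> a lattice: what is
  needed about the cones containing \<open>\<theta>\<close> is derived from \<open>F\<close>. In
  \<open>codim\<close>, the correction is the dimension that each cone containing
  \<open>\<eta>\<close> loses under \<open>\<phi>\<close>.\<close>

locale fan_projection =
  fixes F G :: fan and \<eta> \<theta> :: "vec set" and \<phi> :: "vec \<Rightarrow> vec"
  assumes F: "tropical_fan F" and \<eta>: "\<eta> \<in> cones F" and \<phi>: "linear \<phi>"
    and star: "{\<sigma> \<in> cones G. \<theta> \<subseteq> \<sigma>} = (`) \<phi> ` {\<sigma> \<in> cones F. \<eta> \<subseteq> \<sigma>}"
    and ker: "\<And>x. x \<in> span (\<Union>{\<sigma> \<in> cones F. \<eta> \<subseteq> \<sigma>}) \<Longrightarrow> \<phi> x = 0 \<Longrightarrow> x \<in> span \<eta>"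
    and lat_image: "\<And>\<sigma>. \<sigma> \<in> cones F \<Longrightarrow> \<eta> \<subseteq> \<sigma> \<Longrightarrow> \<phi> ` lat_of (lat F) \<sigma> = lat_of (lat G) (\<phi> ` \<sigma>)"
    and codim: "fan_dim G + dim {x \<in> span \<eta>. \<phi> x = 0} = fan_dim F"
begin

abbreviation st where "st \<equiv> {\<sigma> \<in> cones F. \<eta> \<subseteq> \<sigma>}"

lemma rF: "rational_fan F"
  using F tropical_rational by blast

lemma st_rational: "\<sigma> \<in> st \<Longrightarrow> rational_cone (lat F) \<sigma>"
  using fan_cone(1)[OF rF] by simp

lemma st_image: "\<sigma> \<in> st \<Longrightarrow> \<phi> ` \<sigma> \<in> cones G" "\<sigma> \<in> st \<Longrightarrow> \<theta> \<subseteq> \<phi> ` \<sigma>"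
  using star by blast+

lemma st_cases:
  assumes "\<sigma>' \<in> cones G" "\<theta> \<subseteq> \<sigma>'"
  obtains \<sigma> where "\<sigma> \<in> st" "\<sigma>' = \<phi> ` \<sigma>"
  using assms star by blast

lemma span_phi: "span (\<phi> ` A) = \<phi> ` span A"
  by (rule linear_span_image[OF \<phi>])

lemma ker_diff:
  assumes "\<sigma> \<in> st" "\<sigma>' \<in> st" "x \<in> span \<sigma>" "y \<in> span \<sigma>'" "\<phi> x = \<phi> y"
  shows "x - y \<in> span \<eta>"
proof (rule ker)
  have "span \<sigma> \<subseteq> span (\<Union>st)" "span \<sigma>' \<subseteq> span (\<Union>st)"
    using assms by (auto intro!: span_mono)
  then show "x - y \<in> span (\<Union>st)" using assms by (blast intro: span_diff)
  show "\<phi> (x - y) = 0" using assms by (simp add: linear_diff[OF \<phi>])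
qed

lemma span_eta: "\<sigma> \<in> st \<Longrightarrow> span \<eta> \<subseteq> span \<sigma>"
  by (auto intro!: span_mono)

text \<open>Adding a large multiple of an interior point of \<open>\<eta>\<close> absorbs a vector of \<open>span \<eta>\<close>.\<close>

lemma absorb:
  assumes "\<sigma> \<in> st" "\<sigma>' \<in> st" "x \<in> \<sigma>" "y \<in> \<sigma>'" "x - y \<in> span \<eta>"
  obtains p where "p \<in> \<eta>" "x + p \<in> \<sigma> \<inter> \<sigma>'"
proof -
  obtain p where p: "p \<in> arint \<eta>" using fan_cone(3)[OF rF \<eta>] by blast
  obtain e where e: "e > 0" "p + e *\<^sub>R (x - y) \<in> \<eta>" 
    using arint_span[OF fan_cone(2)[OF rF \<eta>] p assms(5)] by (metis less_imp_le order_refl)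
  have c: "convex_cone \<sigma>" "convex_cone \<sigma>'" "convex_cone \<eta>" using assms(1,2) \<eta> fan_cone(2)[OF rF] by auto
  define q where "q = (1/e) *\<^sub>R p"
  have q: "q \<in> \<eta>" using p arint_subset e(1) convex_cone_scaleR[OF c(3), of "1/e"] by (auto simp: q_def)
  have "(1/e) *\<^sub>R (p + e *\<^sub>R (x - y)) \<in> \<eta>"
    using convex_cone_scaleR[OF c(3) _ e(2), of "1/e"] e(1) by simp
  moreover have "(1/e) *\<^sub>R (p + e *\<^sub>R (x - y)) = q + (x - y)" 
    using e(1) by (simp add: q_def scaleR_add_right)
  ultimately have "q + (x - y) \<in> \<sigma>'" using assms(2) by auto
  then have "y + (q + (x - y)) \<in> \<sigma>'" using assms(4) convex_cone_add[OF c(2)] by blast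
  then have "x + q \<in> \<sigma>'" by (simp add: algebra_simps)
  moreover have "x + q \<in> \<sigma>" using assms(1,3) q convex_cone_add[OF c(1)] by blast
  ultimately show ?thesis using that q by blast
qed

text \<open>\<open>\<phi>\<close> need not be injective on a cone, but points with equal images
  differ by a vector of \<open>span \<eta>\<close>. A point \<open>p\<close> of
  \<open>\<eta>\<close> absorbs it, so that \<open>x + p\<close> lies in both cones, and extremality
  of the intersection gives \<open>x\<close> back.\<close>

lemma image_subset_iff_st:
  assumes "\<sigma> \<in> st" "\<sigma>' \<in> st"
  shows "\<phi> ` \<sigma> \<subseteq> \<phi> ` \<sigma>' \<longleftrightarrow> \<sigma> \<subseteq> \<sigma>'"
proof
  assume h: "\<phi> ` \<sigma> \<subseteq> \<phi> ` \<sigma>'"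
  show "\<sigma> \<subseteq> \<sigma>'"
  proof
    fix x assume x: "x \<in> \<sigma>"
    then obtain y where y: "y \<in> \<sigma>'" "\<phi> x = \<phi> y" using h by blast
    have "x - y \<in> span \<eta>" using ker_diff[OF assms] x y span_base by blast
    then obtain p where p: "p \<in> \<eta>" "x + p \<in> \<sigma> \<inter> \<sigma>'" using absorb[OF assms x y(1)] by blast
    have "extremal (\<sigma> \<inter> \<sigma>') \<sigma>" using fan_inter(2)[OF rF] assms by blast
    then show "x \<in> \<sigma>'" using p x assms(1) unfolding extremal_def by blast
  qed
qed blast

lemma inj_image: "inj_on ((`) \<phi>) st"
  using image_subset_iff_st by (intro inj_onI) blast

lemma dim_image:
  assumes "\<sigma> \<in> st"
  shows "dim (\<phi> ` \<sigma>) + dim {x \<in> span \<eta>. \<phi> x = 0} = dim \<sigma>"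
proof -
  have "{x \<in> span \<sigma>. \<phi> x = 0} = {x \<in> span \<eta>. \<phi> x = 0}"
    using ker_diff[OF assms assms _ span_zero] span_eta[OF assms] by (auto simp: linear_0[OF \<phi>])
  moreover obtain V where "finite V" "\<sigma> \<subseteq> span V" by (rule cone_span_finite[OF st_rational[OF assms]])
  ultimately show ?thesis using dim_kernel_image[OF \<phi>, of \<sigma> V] by simp
qed

lemma facet_iff: "\<sigma> \<in> st \<Longrightarrow> \<phi> ` \<sigma> \<in> facets G \<longleftrightarrow> \<sigma> \<in> facets F"
  using dim_image[of \<sigma>] codim st_image(1)[of \<sigma>] by (auto simp: facets_def)

lemma ridge_iff: "\<sigma> \<in> st \<Longrightarrow> \<phi> ` \<sigma> \<in> ridges G \<longleftrightarrow> \<sigma> \<in> ridges F"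
  using dim_image[of \<sigma>] codim st_image(1)[of \<sigma>] by (auto simp: ridges_def)

lemma rational_cone_image:
  assumes "\<sigma> \<in> st"
  shows "rational_cone (lat G) (\<phi> ` \<sigma>)"
proof -
  obtain V where V: "finite V" "V \<subseteq> lat F" "V \<subseteq> \<sigma>" "\<sigma> = convex_cone hull V"
    by (rule rational_coneE[OF st_rational[OF assms]])
  have "V \<subseteq> lat_of (lat F) \<sigma>" using V span_base by (auto simp: lat_of_def)
  moreover have "\<phi> ` lat_of (lat F) \<sigma> = lat_of (lat G) (\<phi> ` \<sigma>)" using lat_image assms by simp
  ultimately have "\<phi> ` V \<subseteq> lat G" unfolding lat_of_def by blast
  then show ?thesis unfolding rational_cone_def
    using V(1,4) convex_cone_hull_linear_image[OF \<phi>, of V] by (intro exI[of _ "\<phi> ` V"]) auto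
qed

text \<open>Together with \<open>rational_cone_image\<close> this provides the hypotheses of
  \<open>normal_vector_unique\<close> on the side of \<open>G\<close>.\<close>

lemma extremal_image:
  assumes "\<tau> \<in> st" "\<sigma> \<in> st" "\<tau> \<subseteq> \<sigma>"
  shows "extremal (\<phi> ` \<tau>) (\<phi> ` \<sigma>)"
  unfolding extremal_def
proof (intro conjI ballI impI)
  show "\<phi> ` \<tau> \<subseteq> \<phi> ` \<sigma>" using assms(3) by blast
  fix a' b' assume "a' \<in> \<phi> ` \<sigma>" "b' \<in> \<phi> ` \<sigma>" "a' + b' \<in> \<phi> ` \<tau>"
  then obtain a b t where h: "a \<in> \<sigma>" "b \<in> \<sigma>" "t \<in> \<tau>" "a' = \<phi> a" "b' = \<phi> b" "\<phi> (a + b) = \<phi> t"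
    by (auto simp: linear_add[OF \<phi>])
  have "a + b - t \<in> span \<eta>" 
    using ker_diff[OF assms(2,1) _ _ h(6)] h span_base span_add by blast
  then have "a + b - t \<in> span \<tau>" using span_eta[OF assms(1)] by blast
  then have "a + b \<in> span \<tau>" 
    using span_add[OF _ span_base[OF h(3)]] by fastforce
  then have "a \<in> \<tau>" "b \<in> \<tau>"
    using extremal_sum_span[OF fan_extremal[OF rF] fan_cone(2)[OF rF] fan_cone(2)[OF rF] fan_cone(3)[OF rF] h(1,2)]
      assms by blast+
  then show "a' \<in> \<phi> ` \<tau>" "b' \<in> \<phi> ` \<tau>" using h by blast+
qed

lemma normal_image:
  assumes "\<tau> \<in> st" "\<sigma> \<in> st" "is_normal_vector (lat F) \<tau> \<sigma> v"
  shows "is_normal_vector (lat G) (\<phi> ` \<tau>) (\<phi> ` \<sigma>) (\<phi> v)"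
  unfolding is_normal_vector_def
proof (intro conjI ballI)
  have lats: "lat_of (lat G) (\<phi> ` \<sigma>) = \<phi> ` lat_of (lat F) \<sigma>" "lat_of (lat G) (\<phi> ` \<tau>) = \<phi> ` lat_of (lat F) \<tau>"
    using lat_image assms by auto
  show "\<phi> v \<in> lat_of (lat G) (\<phi> ` \<sigma>)" using assms(3) lats by (auto simp: is_normal_vector_def)
  fix x' assume "x' \<in> lat_of (lat G) (\<phi> ` \<sigma>)"
  then obtain x where x: "x \<in> lat_of (lat F) \<sigma>" "x' = \<phi> x" using lats by blast
  then obtain k :: int where "x - of_int k *\<^sub>R v \<in> lat_of (lat F) \<tau>"
    using assms(3) by (auto simp: is_normal_vector_def)
  then have "\<phi> (x - of_int k *\<^sub>R v) \<in> lat_of (lat G) (\<phi> ` \<tau>)" using lats by blast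
  then show "\<exists>k :: int. x' - of_int k *\<^sub>R \<phi> v \<in> lat_of (lat G) (\<phi> ` \<tau>)"
    using x(2) by (auto simp: linear_diff[OF \<phi>] linear_scale[OF \<phi>])
next
  obtain s where s: "s \<in> \<sigma>" "v - s \<in> span \<tau>" using assms(3) by (auto simp: is_normal_vector_def)
  then have "\<phi> v - \<phi> s \<in> span (\<phi> ` \<tau>)" unfolding span_phi by (metis imageI linear_diff[OF \<phi>])
  then show "\<exists>s\<in>\<phi> ` \<sigma>. \<phi> v - s \<in> span (\<phi> ` \<tau>)" using s by blast
qed

lemma unique_image:
  assumes "\<tau>' \<in> ridges G" "\<theta> \<subseteq> \<tau>'" "\<sigma>' \<in> facets G" "\<tau>' \<subseteq> \<sigma>'" 
    "is_normal_vector (lat G) \<tau>' \<sigma>' v" "is_normal_vector (lat G) \<tau>' \<sigma>' w"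
  shows "v - w \<in> span \<tau>'"
proof -
  obtain \<tau> where \<tau>: "\<tau> \<in> st" "\<tau>' = \<phi> ` \<tau>" using st_cases assms ridge_cone by blast
  obtain \<sigma> where \<sigma>: "\<sigma> \<in> st" "\<sigma>' = \<phi> ` \<sigma>" using st_cases[of \<sigma>'] assms facet_cone by blast
  have "\<tau> \<subseteq> \<sigma>" using assms(4) \<tau> \<sigma> image_subset_iff_st by blast
  then show ?thesis
    using normal_vector_unique[OF assms(5,6)] rational_cone_image[OF \<tau>(1)] rational_cone_image[OF \<sigma>(1)]
      extremal_image[OF \<tau>(1) \<sigma>(1)] ridge_facet_dim[OF assms(1,3)] \<tau>(2) \<sigma>(2) by blast
qed

lemma facets_image:
  assumes "\<tau> \<in> st"
  shows "{\<sigma>'. \<sigma>' \<in> facets G \<and> \<phi> ` \<tau> \<subseteq> \<sigma>'} = (`) \<phi> ` {\<sigma>. \<sigma> \<in> facets F \<and> \<tau> \<subseteq> \<sigma>}"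
proof (intro equalityI subsetI)
  fix \<sigma>' assume h: "\<sigma>' \<in> {\<sigma>'. \<sigma>' \<in> facets G \<and> \<phi> ` \<tau> \<subseteq> \<sigma>'}"
  then have "\<theta> \<subseteq> \<sigma>'" using st_image(2)[OF assms] by blast
  then obtain \<sigma> where \<sigma>: "\<sigma> \<in> st" "\<sigma>' = \<phi> ` \<sigma>" using st_cases[of \<sigma>'] h facet_cone by blast
  then show "\<sigma>' \<in> (`) \<phi> ` {\<sigma>. \<sigma> \<in> facets F \<and> \<tau> \<subseteq> \<sigma>}"
    using h facet_iff[OF \<sigma>(1)] image_subset_iff_st[OF assms \<sigma>(1)] by blast
next
  fix \<sigma>' assume "\<sigma>' \<in> (`) \<phi> ` {\<sigma>. \<sigma> \<in> facets F \<and> \<tau> \<subseteq> \<sigma>}"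
  then obtain \<sigma> where \<sigma>: "\<sigma> \<in> facets F" "\<tau> \<subseteq> \<sigma>" "\<sigma>' = \<phi> ` \<sigma>" by blast
  then have "\<sigma> \<in> st" using assms facet_cone by blast
  then show "\<sigma>' \<in> {\<sigma>'. \<sigma>' \<in> facets G \<and> \<phi> ` \<tau> \<subseteq> \<sigma>'}" using facet_iff \<sigma> by blast
qed

lemma sum_facets_image:
  assumes "\<tau> \<in> st"
  shows "(\<Sum>\<sigma>' | \<sigma>' \<in> facets G \<and> \<phi> ` \<tau> \<subseteq> \<sigma>'. h \<sigma>') = (\<Sum>\<sigma> | \<sigma> \<in> facets F \<and> \<tau> \<subseteq> \<sigma>. h (\<phi> ` \<sigma>))"
proof -
  have "inj_on ((`) \<phi>) {\<sigma>. \<sigma> \<in> facets F \<and> \<tau> \<subseteq> \<sigma>}"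
    using inj_image by (rule inj_on_subset) (use assms facet_cone in blast)
  then show ?thesis unfolding facets_image[OF assms] by (simp add: sum.reindex)
qed

definition lift where "lift \<sigma>' = inv_into st ((`) \<phi>) \<sigma>'"

lemma lift_image: "\<sigma> \<in> st \<Longrightarrow> lift (\<phi> ` \<sigma>) = \<sigma>"
  unfolding lift_def using inv_into_f_f[OF inj_image] by blast

lemma normal_images:
  assumes "\<tau> \<in> st" "\<And>\<sigma>. \<sigma> \<in> facets F \<Longrightarrow> \<tau> \<subseteq> \<sigma> \<Longrightarrow> is_normal_vector (lat F) \<tau> \<sigma> (n \<sigma>)"
    "\<sigma>' \<in> facets G" "\<phi> ` \<tau> \<subseteq> \<sigma>'"
  shows "is_normal_vector (lat G) (\<phi> ` \<tau>) \<sigma>' (\<phi> (n (lift \<sigma>')))"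
proof -
  have "\<sigma>' \<in> (`) \<phi> ` {\<sigma>. \<sigma> \<in> facets F \<and> \<tau> \<subseteq> \<sigma>}" using facets_image[OF assms(1)] assms(3,4) by blast
  then obtain \<sigma> where \<sigma>: "\<sigma> \<in> facets F" "\<tau> \<subseteq> \<sigma>" "\<sigma>' = \<phi> ` \<sigma>" by blast
  then have "\<sigma> \<in> st" using assms facet_cone by blast
  then show ?thesis using normal_image[OF assms(1)] assms(2) \<sigma> lift_image by simp
qed

text \<open>The facets around \<open>\<tau>\<close> and around its image correspond, and so do
  normal vectors and their values, term by term. The tropical condition on \<open>F\<close> puts the
  normal sum into \<open>span \<tau>\<close>, where \<open>m\<close> and \<open>l\<close> can be
  compared.\<close>

lemma balanced_iff:
  assumes \<tau>: "\<tau> \<in> st" "\<tau> \<in> ridges F" and m: "local_family G \<theta> m" 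
    and l: "local_family F \<eta> l" 
    and lm: "\<And>\<sigma> x. \<sigma> \<in> st \<Longrightarrow> x \<in> span \<sigma> \<Longrightarrow> l \<sigma> x = m (\<phi> ` \<sigma>) (\<phi> x)"
  shows "balanced_at G (\<phi> ` \<tau>) m \<longleftrightarrow> balanced_at F \<tau> l"
proof -
  define n where "n = normal_vector (lat F) \<tau>"
  have n: "is_normal_vector (lat F) \<tau> \<sigma> (n \<sigma>)" if "\<sigma> \<in> facets F" "\<tau> \<subseteq> \<sigma>" for \<sigma>
    using ridge_facet_normal[OF rF \<tau>(2) that] by (simp add: n_def)
  define n' where "n' \<sigma>' = \<phi> (n (lift \<sigma>'))" for \<sigma>'
  have n': "is_normal_vector (lat G) (\<phi> ` \<tau>) \<sigma>' (n' \<sigma>')" if "\<sigma>' \<in> facets G" "\<phi> ` \<tau> \<subseteq> \<sigma>'" for \<sigma>'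
    using normal_images[OF \<tau>(1) n that] by (simp add: n'_def)
  have \<tau>': "\<phi> ` \<tau> \<in> ridges G" "\<theta> \<subseteq> \<phi> ` \<tau>" using \<tau> ridge_iff st_image by blast+
  have sub: "\<sigma> \<in> st" if "\<sigma> \<in> facets F" "\<tau> \<subseteq> \<sigma>" for \<sigma> using that \<tau> facet_cone by blast
  have 1: "(\<Sum>\<sigma>' | \<sigma>' \<in> facets G \<and> \<phi> ` \<tau> \<subseteq> \<sigma>'. m \<sigma>' (n' \<sigma>')) = (\<Sum>\<sigma> | \<sigma> \<in> facets F \<and> \<tau> \<subseteq> \<sigma>. l \<sigma> (n \<sigma>))"
    unfolding sum_facets_image[OF \<tau>(1)]
  proof (rule sum.cong[OF refl])
    fix \<sigma> assume "\<sigma> \<in> {\<sigma>. \<sigma> \<in> facets F \<and> \<tau> \<subseteq> \<sigma>}"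
    then have s: "\<sigma> \<in> st" "n \<sigma> \<in> span \<sigma>" using sub n normal_vector_span by blast+
    show "m (\<phi> ` \<sigma>) (n' (\<phi> ` \<sigma>)) = l \<sigma> (n \<sigma>)" unfolding n'_def lift_image[OF s(1)] using lm[OF s] by simp
  qed
  have "(\<Sum>\<sigma>' | \<sigma>' \<in> facets G \<and> \<phi> ` \<tau> \<subseteq> \<sigma>'. n' \<sigma>') = (\<Sum>\<sigma> | \<sigma> \<in> facets F \<and> \<tau> \<subseteq> \<sigma>. \<phi> (n \<sigma>))"
    unfolding sum_facets_image[OF \<tau>(1)]
    by (intro sum.cong) (use sub lift_image in \<open>auto simp: n'_def\<close>)
  also have "\<dots> = \<phi> (\<Sum>\<sigma> | \<sigma> \<in> facets F \<and> \<tau> \<subseteq> \<sigma>. n \<sigma>)" by (simp add: linear_sum[OF \<phi>])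
  finally have 2: "m (\<phi> ` \<tau>) (\<Sum>\<sigma>' | \<sigma>' \<in> facets G \<and> \<phi> ` \<tau> \<subseteq> \<sigma>'. n' \<sigma>') 
      = l \<tau> (\<Sum>\<sigma> | \<sigma> \<in> facets F \<and> \<tau> \<subseteq> \<sigma>. n \<sigma>)"
    using lm[OF \<tau>(1) normal_sum_in_span[OF F \<tau>(2) n]] by simp
  have e\<tau>: "\<eta> \<subseteq> \<tau>" using \<tau> by blast
  show ?thesis
  proof
    assume b: "balanced_at G (\<phi> ` \<tau>) m"
    have "(\<Sum>\<sigma>' | \<sigma>' \<in> facets G \<and> \<phi> ` \<tau> \<subseteq> \<sigma>'. m \<sigma>' (n' \<sigma>')) 
        = m (\<phi> ` \<tau>) (\<Sum>\<sigma>' | \<sigma>' \<in> facets G \<and> \<phi> ` \<tau> \<subseteq> \<sigma>'. n' \<sigma>')"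
      by (rule balanced_any_normals_if_unique[OF m \<tau>' b]) (fact unique_image[OF \<tau>'], fact n')
    then show "balanced_at F \<tau> l" unfolding balanced_at_def using n 1 2 by (intro exI[of _ n]) auto
  next
    assume b: "balanced_at F \<tau> l"
    have "(\<Sum>\<sigma> | \<sigma> \<in> facets F \<and> \<tau> \<subseteq> \<sigma>. l \<sigma> (n \<sigma>)) = l \<tau> (\<Sum>\<sigma> | \<sigma> \<in> facets F \<and> \<tau> \<subseteq> \<sigma>. n \<sigma>)"
      using balanced_any_normals[OF rF l \<tau>(2) e\<tau> b n] by blast
    then show "balanced_at G (\<phi> ` \<tau>) m" unfolding balanced_at_def using n' 1 2 by (intro exI[of _ n']) auto
  qed
qed

lemma local_faithful_image:
  assumes "local_faithful F \<eta>"
  shows "local_faithful G \<theta>"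
proof (rule local_faithfulI)
  fix m assume m: "local_family G \<theta> m" and b: "\<And>\<tau>. \<tau> \<in> ridges G \<Longrightarrow> \<theta> \<subseteq> \<tau> \<Longrightarrow> balanced_at G \<tau> m"
  define l where "l \<sigma> x = m (\<phi> ` \<sigma>) (\<phi> x)" for \<sigma> x
  have l: "local_family F \<eta> l" unfolding local_family_def
  proof (intro conjI ballI impI)
    fix \<sigma> assume s: "\<sigma> \<in> cones F" "\<eta> \<subseteq> \<sigma>"
    then have st: "\<phi> ` \<sigma> \<in> cones G" "\<theta> \<subseteq> \<phi> ` \<sigma>" using st_image by auto
    show "linear (l \<sigma>)" unfolding l_def 
      using linear_compose[OF \<phi> local_family_linear[OF m st]] by (simp add: o_def)
    show "l \<sigma> x \<in> \<rat>" if "x \<in> lat_of (lat F) \<sigma>" for x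
      unfolding l_def using local_family_rational[OF m st] lat_image[OF s] that by blast
  next
    fix \<sigma> \<sigma>' x assume s: "\<sigma> \<in> cones F" "\<sigma>' \<in> cones F" "\<eta> \<subseteq> \<sigma>" "\<sigma> \<subseteq> \<sigma>'" "x \<in> \<sigma>"
    then have s': "\<sigma> \<in> st" "\<sigma>' \<in> st" by auto
    show "l \<sigma> x = l \<sigma>' x"
      unfolding l_def using s s' st_image
      by (intro local_family_compat[OF m]) (auto intro: span_base)
  qed
  have "balanced_at F \<tau> l" if \<tau>: "\<tau> \<in> ridges F" "\<eta> \<subseteq> \<tau>" for \<tau>
  proof -
    have s: "\<tau> \<in> st" using \<tau> ridge_cone by blast
    have "balanced_at G (\<phi> ` \<tau>) m" using b ridge_iff[OF s] st_image[OF s] \<tau> by blast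
    then show ?thesis using balanced_iff[OF s \<tau>(1) m l] by (simp add: l_def)
  qed
  then obtain L where L: "linear L" "\<And>\<sigma> x. \<sigma> \<in> cones F \<Longrightarrow> \<eta> \<subseteq> \<sigma> \<Longrightarrow> x \<in> span \<sigma> \<Longrightarrow> l \<sigma> x = L x"
    using local_faithfulD[OF assms l] by blast
  \<comment> \<open>The kernel lies in \<open>span \<eta>\<close>, where \<open>L\<close> is already
    a form composed with \<open>\<phi>\<close>; so \<open>L\<close> vanishes there and
    descends.\<close>
  have "L x = 0" if x: "x \<in> span (\<Union>st)" "\<phi> x = 0" for x
  proof -
    have "x \<in> span \<eta>" using ker x by blast
    then have "L x = m (\<phi> ` \<eta>) (\<phi> x)" using L(2)[of \<eta> x] \<eta> by (simp add: l_def)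
    then show ?thesis using x(2) linear_0[OF local_family_linear[OF m]] st_image[of \<eta>] \<eta> by simp
  qed
  then obtain M where M: "linear M" "\<And>x. x \<in> span (\<Union>st) \<Longrightarrow> M (\<phi> x) = L x"
    using linear_factor_through[OF \<phi> L(1), of "span (\<Union>st)"] by auto
  have "m \<sigma>' x' = M x'" if s': "\<sigma>' \<in> cones G" "\<theta> \<subseteq> \<sigma>'" "x' \<in> \<sigma>'" for \<sigma>' x'
  proof -
    obtain \<sigma> where \<sigma>: "\<sigma> \<in> st" "\<sigma>' = \<phi> ` \<sigma>" using st_cases s' by blast
    obtain x where x: "x \<in> \<sigma>" "x' = \<phi> x" using s' \<sigma> by blast
    have "x \<in> span (\<Union>st)" using \<sigma> x by (blast intro: span_base)
    then have "M x' = L x" using M(2) x by simp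
    also have "\<dots> = l \<sigma> x" using L(2) \<sigma> x(1) span_base by fastforce
    finally show ?thesis by (simp add: l_def \<sigma>(2) x(2))
  qed
  then show "\<exists>L. linear L \<and> (\<forall>\<sigma>\<in>cones G. \<theta> \<subseteq> \<sigma> \<longrightarrow> (\<forall>x\<in>\<sigma>. m \<sigma> x = L x))"
    using M(1) by blast
qed

text \<open>A family descends along \<open>\<phi>\<close> only if it vanishes on the kernel.
  Therefore a global rational form \<open>L0\<close> that agrees with the family on
  \<open>span \<eta>\<close> is subtracted first and added back at the end.\<close>

lemma local_faithful_preimage:
  assumes "local_faithful G \<theta>"
  shows "local_faithful F \<eta>"
proof (rule local_faithfulI)
  fix l0 assume l0: "local_family F \<eta> l0" and b0: "\<And>\<tau>. \<tau> \<in> ridges F \<Longrightarrow> \<eta> \<subseteq> \<tau> \<Longrightarrow> balanced_at F \<tau> l0"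
  obtain V where V: "finite V" "V \<subseteq> lat F" "V \<subseteq> \<eta>" "\<eta> = convex_cone hull V" "span \<eta> = span V"
    by (rule rational_coneE[OF fan_cone(1)[OF rF \<eta>]])
  have "V \<subseteq> lat_of (lat F) \<eta>" using V span_base by (auto simp: lat_of_def)
  then have rat: "l0 \<eta> x \<in> \<rat>" if "x \<in> V" for x
    using local_family_rational[OF l0 \<eta> order_refl] that by blast
  obtain L0 where L0: "linear L0" "\<And>x. x \<in> span \<eta> \<Longrightarrow> L0 x = l0 \<eta> x" "\<And>x. x \<in> lat F \<Longrightarrow> L0 x \<in> \<rat>"
    unfolding V(5)
    using rational_form_extend[OF fan_lattice[OF rF] V(2) local_family_linear[OF l0 \<eta> order_refl] rat] by blast
  define l where "l \<sigma> x = l0 \<sigma> x + (- L0 x)" for \<sigma> x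
  have nL0: "linear (\<lambda>x. - L0 x)" using L0(1) linear_compose_neg by blast
  have l: "local_family F \<eta> l" unfolding l_def
    using local_family_add[OF l0 nL0] L0(3) by simp
  have b: "balanced_at F \<tau> l" if "\<tau> \<in> ridges F" "\<eta> \<subseteq> \<tau>" for \<tau>
    unfolding l_def using balanced_at_add[OF nL0 b0[OF that]] .
  have l\<eta>: "l \<sigma> x = 0" if "\<sigma> \<in> st" "x \<in> span \<eta>" for \<sigma> x
    using local_family_compat[OF l0 \<eta>, of \<sigma> x] that L0(2) by (simp add: l_def)
  have "\<exists>M. linear M \<and> (\<forall>x\<in>span \<sigma>. M (\<phi> x) = l \<sigma> x)" if \<sigma>: "\<sigma> \<in> st" for \<sigma>
  proof -
    have "l \<sigma> x = 0" if "x \<in> span \<sigma>" "\<phi> x = 0" for x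
      using ker_diff[OF \<sigma> \<sigma> that(1) span_zero] that(2) l\<eta>[OF \<sigma>] by (simp add: linear_0[OF \<phi>])
    then obtain M where "linear M" "\<And>x. x \<in> span \<sigma> \<Longrightarrow> M (\<phi> x) = l \<sigma> x"
      using linear_factor_through[OF \<phi> local_family_linear[OF l, of \<sigma>] subspace_span, of \<sigma>] \<sigma> by blast
    then show ?thesis by blast
  qed
  note exM = this
  define M where "M \<sigma> = (SOME M. linear M \<and> (\<forall>x\<in>span \<sigma>. M (\<phi> x) = l \<sigma> x))" for \<sigma>
  have "linear (M \<sigma>) \<and> (\<forall>x\<in>span \<sigma>. M \<sigma> (\<phi> x) = l \<sigma> x)" if "\<sigma> \<in> st" for \<sigma>
    unfolding M_def using exM[OF that] by (rule someI_ex)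
  then have M: "linear (M \<sigma>)" "x \<in> span \<sigma> \<Longrightarrow> M \<sigma> (\<phi> x) = l \<sigma> x" if "\<sigma> \<in> st" for \<sigma> x
    using that by blast+
  define m where "m \<sigma>' = M (lift \<sigma>')" for \<sigma>'
  have mM: "m (\<phi> ` \<sigma>) = M \<sigma>" if "\<sigma> \<in> st" for \<sigma> using lift_image[OF that] by (simp add: m_def)
  have m: "local_family G \<theta> m" unfolding local_family_def
  proof (intro conjI ballI impI)
    fix \<sigma>' assume s': "\<sigma>' \<in> cones G" "\<theta> \<subseteq> \<sigma>'"
    then obtain \<sigma> where \<sigma>: "\<sigma> \<in> st" "\<sigma>' = \<phi> ` \<sigma>" using st_cases by blast
    show "linear (m \<sigma>')" using M(1) mM \<sigma> by simp
    show "m \<sigma>' x' \<in> \<rat>" if x': "x' \<in> lat_of (lat G) \<sigma>'" for x'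
    proof -
      obtain x where x: "x \<in> lat_of (lat F) \<sigma>" "x' = \<phi> x" using x' lat_image \<sigma> by blast
      then have "m \<sigma>' x' = l \<sigma> x" using M(2)[OF \<sigma>(1)] mM[OF \<sigma>(1)] \<sigma>(2) by (simp add: lat_of_def)
      then show ?thesis using local_family_rational[OF l _ _ x(1)] \<sigma>(1) by simp
    qed
  next
    fix \<sigma>1' \<sigma>2' x' assume s': "\<sigma>1' \<in> cones G" "\<sigma>2' \<in> cones G" "\<theta> \<subseteq> \<sigma>1'" "\<sigma>1' \<subseteq> \<sigma>2'" "x' \<in> \<sigma>1'"
    obtain \<sigma>1 where \<sigma>1: "\<sigma>1 \<in> st" "\<sigma>1' = \<phi> ` \<sigma>1" using st_cases s' by blast
    obtain \<sigma>2 where \<sigma>2: "\<sigma>2 \<in> st" "\<sigma>2' = \<phi> ` \<sigma>2" using st_cases[of \<sigma>2'] s' by blast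
    obtain x where x: "x \<in> \<sigma>1" "x' = \<phi> x" using s' \<sigma>1 by blast
    have sub: "\<sigma>1 \<subseteq> \<sigma>2" using image_subset_iff_st[OF \<sigma>1(1) \<sigma>2(1)] s'(4) \<sigma>1 \<sigma>2 by simp
    have xs: "x \<in> span \<sigma>1" "x \<in> span \<sigma>2" using x sub by (auto intro: span_base)
    have "m \<sigma>1' x' = l \<sigma>1 x" "m \<sigma>2' x' = l \<sigma>2 x" using M(2) mM \<sigma>1 \<sigma>2 x(2) xs by simp_all
    moreover have "l \<sigma>1 x = l \<sigma>2 x" using local_family_compat[OF l _ _ _ sub xs(1)] \<sigma>1(1) \<sigma>2(1) by blast
    ultimately show "m \<sigma>1' x' = m \<sigma>2' x'" by simp
  qed
  have "balanced_at G \<tau>' m" if \<tau>': "\<tau>' \<in> ridges G" "\<theta> \<subseteq> \<tau>'" for \<tau>'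
  proof -
    obtain \<tau> where \<tau>: "\<tau> \<in> st" "\<tau>' = \<phi> ` \<tau>" using st_cases \<tau>' ridge_cone by blast
    have r: "\<tau> \<in> ridges F" using \<tau> \<tau>' ridge_iff by blast
    have "balanced_at F \<tau> l" using b[OF r] \<tau> by blast
    then show ?thesis using balanced_iff[OF \<tau>(1) r m l] M(2) mM \<tau>(2) by simp
  qed
  then obtain L where L: "linear L" "\<And>\<sigma> x. \<sigma> \<in> cones G \<Longrightarrow> \<theta> \<subseteq> \<sigma> \<Longrightarrow> x \<in> span \<sigma> \<Longrightarrow> m \<sigma> x = L x"
    using local_faithfulD[OF assms m] by blast
  have "l0 \<sigma> x = L (\<phi> x) + L0 x" if "\<sigma> \<in> cones F" "\<eta> \<subseteq> \<sigma>" "x \<in> \<sigma>" for \<sigma> x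
  proof -
    have \<sigma>: "\<sigma> \<in> st" using that by blast
    have "l \<sigma> x = m (\<phi> ` \<sigma>) (\<phi> x)" 
      using M(2)[OF \<sigma>] mM[OF \<sigma>] that(3) by (simp add: span_base)
    also have "\<dots> = L (\<phi> x)" using L(2) st_image[OF \<sigma>] that(3) span_base by blast
    finally show ?thesis by (simp add: l_def)
  qed
  moreover have "linear (\<lambda>x. L (\<phi> x) + L0 x)"
    using linear_compose_add[OF linear_compose[OF \<phi> L(1)] L0(1)] by (simp add: o_def)
  ultimately show "\<exists>L. linear L \<and> (\<forall>\<sigma>\<in>cones F. \<eta> \<subseteq> \<sigma> \<longrightarrow> (\<forall>x\<in>\<sigma>. l0 \<sigma> x = L x))"
    by blast
qed

text \<open>Needed to glue a family to a function on the support of \<open>G\<close>. The preimages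
  \<open>a\<close> and \<open>b\<close> of a common point may differ, but for a suitable
  \<open>p\<close> in \<open>\<eta>\<close> both \<open>p\<close> and \<open>a + p\<close> lie in
  the cone \<open>\<sigma>1 \<inter> \<sigma>2\<close>; the forms agree at their images, hence at
  the image of \<open>a\<close>.\<close>

lemma family_well_defined:
  assumes m: "local_family G \<theta> m" and s: "\<sigma>1 \<in> st" "\<sigma>2 \<in> st" and x: "x \<in> \<phi> ` \<sigma>1" "x \<in> \<phi> ` \<sigma>2"
  shows "m (\<phi> ` \<sigma>1) x = m (\<phi> ` \<sigma>2) x"
proof -
  obtain a b where ab: "a \<in> \<sigma>1" "b \<in> \<sigma>2" "x = \<phi> a" "x = \<phi> b" using x by blast
  have "a - b \<in> span \<eta>" using ker_diff[OF s] ab span_base by metis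
  then obtain p where p: "p \<in> \<eta>" "a + p \<in> \<sigma>1 \<inter> \<sigma>2" using absorb[OF s ab(1,2)] by blast
  define \<kappa> where "\<kappa> = \<sigma>1 \<inter> \<sigma>2"
  have \<kappa>: "\<kappa> \<in> st" "\<kappa> \<subseteq> \<sigma>1" "\<kappa> \<subseteq> \<sigma>2" using s fan_inter(1)[OF rF] by (auto simp: \<kappa>_def)
  have eq: "m (\<phi> ` \<kappa>) (\<phi> y) = m (\<phi> ` \<sigma>) (\<phi> y)" if "y \<in> \<kappa>" "\<sigma> \<in> st" "\<kappa> \<subseteq> \<sigma>" for y \<sigma>
    using st_image that \<kappa> by (intro local_family_compat[OF m]) (auto intro: span_base)
  have "p \<in> \<kappa>" "a + p \<in> \<kappa>" using p \<kappa>(1) by (auto simp: \<kappa>_def)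
  then have "m (\<phi> ` \<sigma>1) (\<phi> (a + p)) = m (\<phi> ` \<sigma>2) (\<phi> (a + p))" "m (\<phi> ` \<sigma>1) (\<phi> p) = m (\<phi> ` \<sigma>2) (\<phi> p)"
    using eq[OF _ s(1) \<kappa>(2)] eq[OF _ s(2) \<kappa>(3)] by simp_all
  moreover have "linear (m (\<phi> ` \<sigma>1))" "linear (m (\<phi> ` \<sigma>2))" 
    using local_family_linear[OF m] st_image s by auto
  ultimately show ?thesis by (simp add: ab(3) linear_add[OF \<phi>] linear_add)
qed

text \<open>When \<open>\<eta>\<close> is collapsed, image cones stay strongly convex: if two image
  points cancel, their preimages add up to a vector of \<open>span \<eta>\<close>, so extremality
  places them in \<open>\<eta>\<close> and the image points are 0. Closedness later gives continuity
  of glued functions.\<close>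

lemma closed_image:
  assumes "\<phi> ` \<eta> = {0}" "\<sigma> \<in> st"
  shows "closed (\<phi> ` \<sigma>)"
proof -
  have "strongly_convex (\<phi> ` \<sigma>)" unfolding strongly_convex_def
  proof (intro equalityI subsetI)
    fix x assume "x \<in> \<phi> ` \<sigma> \<inter> uminus ` \<phi> ` \<sigma>"
    then obtain a b where ab: "a \<in> \<sigma>" "b \<in> \<sigma>" "x = \<phi> a" "x = - \<phi> b" by blast
    then have "\<phi> a + \<phi> b = 0" by (metis add.commute add.right_inverse)
    then have "\<phi> (a + b) = \<phi> 0" by (simp add: linear_add[OF \<phi>] linear_0[OF \<phi>])
    then have "a + b - 0 \<in> span \<eta>"
      using ab by (intro ker_diff[OF assms(2,2)]) (auto intro: span_base span_add span_zero)
    then have "a \<in> \<eta>"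
      using extremal_sum_span(1)[OF fan_extremal[OF rF \<eta>] fan_cone(2)[OF rF \<eta>] fan_cone(2)[OF rF] fan_cone(3)[OF rF \<eta>] ab(1,2)]
        assms(2) by simp
    then show "x \<in> {0}" using assms(1) ab(3) by blast
  next
    fix x :: vec assume "x \<in> {0}"
    moreover have "0 \<in> \<phi> ` \<sigma>" using fan_cone(4)[OF rF] assms(2) linear_0[OF \<phi>] by force
    ultimately show "x \<in> \<phi> ` \<sigma> \<inter> uminus ` \<phi> ` \<sigma>" by force
  qed
  then show ?thesis
    using closed_strongly_convex_hull rational_coneE[OF rational_cone_image[OF assms(2)]] by metis
qed

end

section \<open>Functions on a star fan and balanced families of forms\<close>

lemma cone_form:
  assumes "linear l" "\<And>x. x \<in> \<sigma> \<Longrightarrow> f x = l x"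
  shows "linear (cone_form f \<sigma>)" "\<And>x. x \<in> \<sigma> \<Longrightarrow> cone_form f \<sigma> x = f x"
    "\<And>x. x \<in> span \<sigma> \<Longrightarrow> cone_form f \<sigma> x = l x"
proof -
  have *: "linear (cone_form f \<sigma>) \<and> (\<forall>x\<in>\<sigma>. f x = cone_form f \<sigma> x)"
    unfolding cone_form_def by (rule someI[of _ l]) (use assms in blast)
  then show "linear (cone_form f \<sigma>)" "\<And>x. x \<in> \<sigma> \<Longrightarrow> cone_form f \<sigma> x = f x" by simp_all
  show "cone_form f \<sigma> x = l x" if "x \<in> span \<sigma>" for x
    by (rule linear_eq_on[OF _ assms(1) that]) (use * assms(2) in auto)
qed

lemma conewise_form:
  assumes "conewise_integral_linear F f" "\<sigma> \<in> cones F"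
  shows "linear (cone_form f \<sigma>)" "\<And>x. x \<in> \<sigma> \<Longrightarrow> cone_form f \<sigma> x = f x"
    "\<And>x. x \<in> lat_of (lat F) \<sigma> \<Longrightarrow> cone_form f \<sigma> x \<in> \<int>"
proof -
  obtain l where l: "linear l" "\<And>x. x \<in> lat_of (lat F) \<sigma> \<Longrightarrow> l x \<in> \<int>" "\<And>x. x \<in> \<sigma> \<Longrightarrow> f x = l x"
    using assms unfolding conewise_integral_linear_def by blast
  show "linear (cone_form f \<sigma>)" by (rule cone_form(1)[OF l(1)]) (rule l(3))
  show "cone_form f \<sigma> x = f x" if "x \<in> \<sigma>" for x by (rule cone_form(2)[OF l(1) _ that]) (rule l(3))
  show "cone_form f \<sigma> x \<in> \<int>" if "x \<in> lat_of (lat F) \<sigma>" for x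
  proof -
    have "cone_form f \<sigma> x = l x" using that by (intro cone_form(3)[OF l(1)] l(3)) (auto simp: lat_of_def)
    then show ?thesis using l(2)[OF that] by simp
  qed
qed

context fan_projection
begin

lemma div_faithful_if_local:
  assumes \<theta>: "\<And>\<sigma>'. \<sigma>' \<in> cones G \<Longrightarrow> \<theta> \<subseteq> \<sigma>'"
    and lf: "local_faithful G \<theta>" and f: "conewise_integral_linear G f" "div_trivial G f"
  shows "linear_on_fan G f"
proof -
  define m where "m = cone_form f"
  have m: "local_family G \<theta> m" unfolding local_family_def m_def
  proof (intro conjI ballI impI)
    fix \<sigma> assume "\<sigma> \<in> cones G"
    then show "linear (cone_form f \<sigma>)" using conewise_form(1)[OF f(1)] by blast
    show "cone_form f \<sigma> x \<in> \<rat>" if "x \<in> lat_of (lat G) \<sigma>" for x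
      using conewise_form(3)[OF f(1) \<open>\<sigma> \<in> cones G\<close> that] Ints_subset_Rats by blast
  next
    fix \<sigma> \<sigma>' x assume h: "\<sigma> \<in> cones G" "\<sigma>' \<in> cones G" "\<sigma> \<subseteq> \<sigma>'" "x \<in> \<sigma>"
    then have "x \<in> \<sigma>'" by blast
    then show "cone_form f \<sigma> x = cone_form f \<sigma>' x"
      using conewise_form(2)[OF f(1) h(1,4)] conewise_form(2)[OF f(1) h(2)] by simp
  qed
  have "balanced_at G \<tau>' m" if \<tau>': "\<tau>' \<in> ridges G" "\<theta> \<subseteq> \<tau>'" for \<tau>'
  proof -
    obtain \<tau> where \<tau>: "\<tau> \<in> st" "\<tau>' = \<phi> ` \<tau>" using st_cases \<tau>' ridge_cone by blast
    have r: "\<tau> \<in> ridges F" using \<tau> \<tau>' ridge_iff by blast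
    \<comment> \<open>A \<open>SOME\<close> term has the chosen property once a witness exists; the
      image of a normal vector in \<open>F\<close> is one.\<close>
    have n: "is_normal_vector (lat G) \<tau>' \<sigma>' (normal_vector (lat G) \<tau>' \<sigma>')" 
      if "\<sigma>' \<in> facets G" "\<tau>' \<subseteq> \<sigma>'" for \<sigma>'
      using normal_images[OF \<tau>(1) ridge_facet_normal[OF rF r]] that unfolding normal_vector_def \<tau>(2)
      by (rule_tac someI) blast
    have "ord_at G f \<tau>' = 0" using f(2) \<tau>' by (simp add: div_trivial_def)
    then show ?thesis unfolding balanced_at_def
      using n by (intro exI[of _ "normal_vector (lat G) \<tau>'"]) (auto simp: ord_at_def normal_sum_def m_def)
  qed
  then obtain L where L: "linear L" "\<And>\<sigma> x. \<sigma> \<in> cones G \<Longrightarrow> \<theta> \<subseteq> \<sigma> \<Longrightarrow> x \<in> span \<sigma> \<Longrightarrow> m \<sigma> x = L x"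
    using local_faithfulD[OF lf m] by blast
  have "f x = L x" if x: "x \<in> support G" for x
  proof -
    obtain \<sigma> where \<sigma>: "\<sigma> \<in> cones G" "x \<in> \<sigma>" using x by (auto simp: support_def)
    then show ?thesis using L(2)[OF \<sigma>(1) \<theta>] conewise_form(2)[OF f(1)] span_base
      by (fastforce simp: m_def)
  qed
  then show ?thesis unfolding linear_on_fan_def using L(1) by blast
qed

text \<open>A family has rational values, whereas the hypothesis concerns integral functions: the
  family is multiplied by a common denominator \<open>E\<close>, glued to a function
  \<open>f\<close>, and the linear form obtained for \<open>f\<close> is divided by
  \<open>E\<close>.\<close>

lemma local_if_div_faithful:
  assumes \<theta>: "\<And>\<sigma>'. \<sigma>' \<in> cones G \<Longrightarrow> \<theta> \<subseteq> \<sigma>'" "\<phi> ` \<eta> = {0}"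
    and df: "\<And>f. conewise_integral_linear G f \<Longrightarrow> div_trivial G f \<Longrightarrow> linear_on_fan G f"
  shows "local_faithful G \<theta>"
proof (rule local_faithfulI)
  fix m assume m: "local_family G \<theta> m" and b: "\<And>\<tau>. \<tau> \<in> ridges G \<Longrightarrow> \<theta> \<subseteq> \<tau> \<Longrightarrow> balanced_at G \<tau> m"
  have cG: "cones G = (`) \<phi> ` st" using star \<theta>(1) by blast
  have fin: "finite (cones G)" unfolding cG using fan_finite[OF rF] by simp
  \<comment> \<open>The denominators are bounded on \<open>lat F\<close>, after composing with
    \<open>\<phi>\<close>, because \<open>lat G\<close> is not known to be a lattice.\<close>
  have "\<exists>D::nat. D > 0 \<and> (\<forall>x\<in>lat_of (lat G) \<sigma>'. of_nat D * m \<sigma>' x \<in> \<int>)" if s': "\<sigma>' \<in> cones G" for \<sigma>'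
  proof -
    obtain \<sigma> where \<sigma>: "\<sigma> \<in> st" "\<sigma>' = \<phi> ` \<sigma>" by (rule st_cases[OF s' \<theta>(1)[OF s']])
    obtain V where V: "finite V" "V \<subseteq> lat F" "V \<subseteq> \<sigma>" "\<sigma> = convex_cone hull V" "span \<sigma> = span V"
      by (rule rational_coneE[OF st_rational[OF \<sigma>(1)]])
    have lm: "linear (\<lambda>x. m \<sigma>' (\<phi> x))"
      using linear_compose[OF \<phi> local_family_linear[OF m s' \<theta>(1)[OF s']]] by (simp add: o_def)
    have img: "\<phi> ` lat_of (lat F) \<sigma> = lat_of (lat G) \<sigma>'" using lat_image \<sigma> by simp
    have rat: "m \<sigma>' (\<phi> x) \<in> \<rat>" if "x \<in> lat F \<inter> span V" for x
      using local_family_rational[OF m \<open>\<sigma>' \<in> cones G\<close> \<theta>(1)] img \<open>\<sigma>' \<in> cones G\<close> that V(5) 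
      by (auto simp: lat_of_def)
    obtain D :: nat where D: "D > 0" "\<And>x. x \<in> lat F \<inter> span V \<Longrightarrow> of_nat D * m \<sigma>' (\<phi> x) \<in> \<int>"
      using bounded_denominator[OF fan_lattice[OF rF] V(2) lm rat] by blast
    have "of_nat D * m \<sigma>' x \<in> \<int>" if x: "x \<in> lat_of (lat G) \<sigma>'" for x
    proof -
      obtain y where "y \<in> lat_of (lat F) \<sigma>" "x = \<phi> y" using x img by blast
      then show ?thesis using D(2)[of y] V(5) by (simp add: lat_of_def)
    qed
    then show ?thesis using D(1) by blast
  qed
  then obtain D :: "vec set \<Rightarrow> nat" where D: "\<And>\<sigma>'. \<sigma>' \<in> cones G \<Longrightarrow> D \<sigma>' > 0"
    "\<And>\<sigma>' x. \<sigma>' \<in> cones G \<Longrightarrow> x \<in> lat_of (lat G) \<sigma>' \<Longrightarrow> of_nat (D \<sigma>') * m \<sigma>' x \<in> \<int>" by metis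
  define E where "E = (\<Prod>\<sigma>'\<in>cones G. D \<sigma>')"
  have E0: "E > 0" unfolding E_def using D(1) by (intro prod_pos) blast
  have Em: "of_nat E * m \<sigma>' x \<in> \<int>" if "\<sigma>' \<in> cones G" "x \<in> lat_of (lat G) \<sigma>'" for \<sigma>' x
  proof -
    have "E = (\<Prod>\<sigma>'\<in>cones G - {\<sigma>'}. D \<sigma>') * D \<sigma>'"
      unfolding E_def using fin that(1) by (simp add: prod.remove mult.commute)
    then have "of_nat E * m \<sigma>' x = of_nat (\<Prod>\<sigma>'\<in>cones G - {\<sigma>'}. D \<sigma>') * (of_nat (D \<sigma>') * m \<sigma>' x)" 
      by (simp only: of_nat_mult mult.assoc)
    then show ?thesis using D(2)[OF that] Ints_mult[OF Ints_of_nat] by metis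
  qed
  \<comment> \<open>\<open>ch x\<close> is an arbitrary cone through \<open>x\<close>; by
    \<open>family_well_defined\<close> the value of \<open>f\<close> does not depend on it.\<close>
  define ch where "ch x = (SOME \<sigma>'. \<sigma>' \<in> cones G \<and> x \<in> \<sigma>')" for x
  define f where "f x = of_nat E * m (ch x) x" for x
  have f_eq: "f x = of_nat E * m \<sigma>' x" if s: "\<sigma>' \<in> cones G" "x \<in> \<sigma>'" for \<sigma>' x
  proof -
    have c: "ch x \<in> cones G \<and> x \<in> ch x" unfolding ch_def by (rule someI[of _ \<sigma>']) (use s in blast)
    then have c1: "ch x \<in> cones G" ..
    obtain \<sigma>1 where \<sigma>1: "\<sigma>1 \<in> st" "ch x = \<phi> ` \<sigma>1" by (rule st_cases[OF c1 \<theta>(1)[OF c1]])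
    obtain \<sigma>2 where \<sigma>2: "\<sigma>2 \<in> st" "\<sigma>' = \<phi> ` \<sigma>2" by (rule st_cases[OF s(1) \<theta>(1)[OF s(1)]])
    have "m (ch x) x = m \<sigma>' x"
      using family_well_defined[OF m \<sigma>1(1) \<sigma>2(1), of x] s c \<sigma>1 \<sigma>2 by simp
    then show ?thesis by (simp add: f_def)
  qed
  have lin: "linear (\<lambda>x. of_nat E * m \<sigma>' x)" if "\<sigma>' \<in> cones G" for \<sigma>'
  proof -
    have lm: "linear (m \<sigma>')" using local_family_linear[OF m that \<theta>(1)[OF that]] .
    show ?thesis by (rule linearI) (simp_all add: linear_add[OF lm] linear_scale[OF lm] algebra_simps)
  qed
  have "continuous_on (support G) f"
  proof -
    have "continuous_on (\<Union>\<sigma>'\<in>cones G. \<sigma>') f"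
    proof (rule continuous_on_closed_Union[OF fin])
      fix \<sigma>' assume s: "\<sigma>' \<in> cones G"
      obtain \<sigma> where \<sigma>: "\<sigma> \<in> st" "\<sigma>' = \<phi> ` \<sigma>" by (rule st_cases[OF s \<theta>(1)[OF s]])
      show "closed \<sigma>'" using closed_image[OF \<theta>(2)] \<sigma> by blast
      obtain V where V: "finite V" "\<sigma>' \<subseteq> span V" 
        using cone_span_finite[OF rational_cone_image[OF \<sigma>(1)]] unfolding \<sigma>(2) by metis
      have "continuous_on \<sigma>' (\<lambda>x. of_nat E * m \<sigma>' x)"
        using continuous_on_subset[OF continuous_on_linear_span[OF lin[OF s] V(1)] V(2)] .
      then show "continuous_on \<sigma>' f" using f_eq[OF s] by (simp cong: continuous_on_cong)
    qed
    then show ?thesis by (simp add: support_def)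
  qed
  then have cil: "conewise_integral_linear G f"
    unfolding conewise_integral_linear_def
  proof (intro conjI ballI)
    fix \<sigma>' assume s: "\<sigma>' \<in> cones G"
    show "\<exists>l. linear l \<and> (\<forall>x\<in>lat_of (lat G) \<sigma>'. l x \<in> \<int>) \<and> (\<forall>x\<in>\<sigma>'. f x = l x)"
      using lin[OF s] Em[OF s] f_eq[OF s] by (intro exI[of _ "\<lambda>x. of_nat E * m \<sigma>' x"]) simp
  qed
  have "ord_at G f \<tau>' = 0" if \<tau>': "\<tau>' \<in> ridges G" for \<tau>'
  proof -
    obtain \<tau> where \<tau>: "\<tau> \<in> st" "\<tau>' = \<phi> ` \<tau>" 
      by (rule st_cases[OF ridge_cone[OF \<tau>'] \<theta>(1)[OF ridge_cone[OF \<tau>']]])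
    have r: "\<tau> \<in> ridges F" using ridge_iff[OF \<tau>(1)] \<tau>' \<tau>(2) by simp
    have \<tau>'\<theta>: "\<theta> \<subseteq> \<tau>'" using \<theta>(1) \<tau>' ridge_cone by blast
    define n where "n = normal_vector (lat F) \<tau>"
    have n: "is_normal_vector (lat F) \<tau> \<sigma> (n \<sigma>)" if "\<sigma> \<in> facets F" "\<tau> \<subseteq> \<sigma>" for \<sigma>
      using ridge_facet_normal[OF rF r that] by (simp add: n_def)
    define nn where "nn = normal_vector (lat G) \<tau>'"
    define n' where "n' \<sigma>' = \<phi> (n (lift \<sigma>'))" for \<sigma>'
    have n': "is_normal_vector (lat G) \<tau>' \<sigma>' (n' \<sigma>')" if "\<sigma>' \<in> facets G" "\<tau>' \<subseteq> \<sigma>'" for \<sigma>'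
      using normal_images[OF \<tau>(1) n] that by (simp add: n'_def \<tau>(2))
    have nn: "is_normal_vector (lat G) \<tau>' \<sigma>' (nn \<sigma>')" if "\<sigma>' \<in> facets G" "\<tau>' \<subseteq> \<sigma>'" for \<sigma>'
      unfolding nn_def normal_vector_def by (rule someI) (rule n'[OF that])
    \<comment> \<open>\<open>G\<close> is not known to be tropical. That the sum of its selected
      normal vectors lies in \<open>span \<tau>'\<close> follows by comparison with the images of
      normal vectors of \<open>F\<close>, whose sum lies in \<open>span \<tau>\<close>.\<close>
    have "(\<Sum>\<sigma>' | \<sigma>' \<in> facets G \<and> \<tau>' \<subseteq> \<sigma>'. nn \<sigma>' - n' \<sigma>') \<in> span \<tau>'"
      using unique_image[OF \<tau>' \<tau>'\<theta>] nn n' by (intro span_sum) blast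
    moreover have "(\<Sum>\<sigma>' | \<sigma>' \<in> facets G \<and> \<tau>' \<subseteq> \<sigma>'. n' \<sigma>') = \<phi> (\<Sum>\<sigma> | \<sigma> \<in> facets F \<and> \<tau> \<subseteq> \<sigma>. n \<sigma>)"
      unfolding \<tau>(2) sum_facets_image[OF \<tau>(1)] linear_sum[OF \<phi>]
    proof (rule sum.cong[OF refl])
      fix \<sigma> assume "\<sigma> \<in> {\<sigma>. \<sigma> \<in> facets F \<and> \<tau> \<subseteq> \<sigma>}"
      then have "\<sigma> \<in> st" using \<tau>(1) facet_cone by blast
      then show "n' (\<phi> ` \<sigma>) = \<phi> (n \<sigma>)" by (simp add: n'_def lift_image)
    qed
    moreover have "\<phi> (\<Sum>\<sigma> | \<sigma> \<in> facets F \<and> \<tau> \<subseteq> \<sigma>. n \<sigma>) \<in> span \<tau>'"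
      unfolding \<tau>(2) span_phi using normal_sum_in_span[OF F r n] by blast
    ultimately have "(\<Sum>\<sigma>' | \<sigma>' \<in> facets G \<and> \<tau>' \<subseteq> \<sigma>'. nn \<sigma>' - n' \<sigma>') 
       + (\<Sum>\<sigma>' | \<sigma>' \<in> facets G \<and> \<tau>' \<subseteq> \<sigma>'. n' \<sigma>') \<in> span \<tau>'" 
      by (intro span_add) simp_all
    then have sp: "(\<Sum>\<sigma>' | \<sigma>' \<in> facets G \<and> \<tau>' \<subseteq> \<sigma>'. nn \<sigma>') \<in> span \<tau>'" by (simp add: sum_subtractf)
    have cf: "cone_form f \<sigma>' x = of_nat E * m \<sigma>' x" if "\<sigma>' \<in> cones G" "x \<in> span \<sigma>'" for \<sigma>' x
      by (rule cone_form(3)[OF lin[OF that(1)] _ that(2)]) (rule f_eq[OF that(1)])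
    have bal: "(\<Sum>\<sigma>' | \<sigma>' \<in> facets G \<and> \<tau>' \<subseteq> \<sigma>'. m \<sigma>' (nn \<sigma>')) = m \<tau>' (\<Sum>\<sigma>' | \<sigma>' \<in> facets G \<and> \<tau>' \<subseteq> \<sigma>'. nn \<sigma>')"
      by (rule balanced_any_normals_if_unique[OF m \<tau>' \<tau>'\<theta> b[OF \<tau>' \<tau>'\<theta>]]) (fact unique_image[OF \<tau>' \<tau>'\<theta>], fact nn)
    have "(\<Sum>\<sigma>' | \<sigma>' \<in> facets G \<and> \<tau>' \<subseteq> \<sigma>'. cone_form f \<sigma>' (nn \<sigma>')) 
        = (\<Sum>\<sigma>' | \<sigma>' \<in> facets G \<and> \<tau>' \<subseteq> \<sigma>'. of_nat E * m \<sigma>' (nn \<sigma>'))"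
    proof (rule sum.cong[OF refl])
      fix \<sigma>' assume "\<sigma>' \<in> {\<sigma>'. \<sigma>' \<in> facets G \<and> \<tau>' \<subseteq> \<sigma>'}"
      then show "cone_form f \<sigma>' (nn \<sigma>') = of_nat E * m \<sigma>' (nn \<sigma>')"
        using cf facet_cone nn normal_vector_span by blast
    qed
    then have s1: "(\<Sum>\<sigma>' | \<sigma>' \<in> facets G \<and> \<tau>' \<subseteq> \<sigma>'. cone_form f \<sigma>' (nn \<sigma>')) 
        = of_nat E * m \<tau>' (\<Sum>\<sigma>' | \<sigma>' \<in> facets G \<and> \<tau>' \<subseteq> \<sigma>'. nn \<sigma>')"
      by (simp add: bal flip: sum_distrib_left)
    have s2: "cone_form f \<tau>' (\<Sum>\<sigma>' | \<sigma>' \<in> facets G \<and> \<tau>' \<subseteq> \<sigma>'. nn \<sigma>') 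
        = of_nat E * m \<tau>' (\<Sum>\<sigma>' | \<sigma>' \<in> facets G \<and> \<tau>' \<subseteq> \<sigma>'. nn \<sigma>')"
      using cf[OF ridge_cone[OF \<tau>'] sp] .
    show ?thesis unfolding ord_at_def normal_sum_def using s1 s2 by (simp add: nn_def)
  qed
  then have "div_trivial G f" by (simp add: div_trivial_def)
  then obtain L where L: "linear L" "\<And>x. x \<in> support G \<Longrightarrow> f x = L x"
    using df[OF cil] unfolding linear_on_fan_def by blast
  have "m \<sigma>' x = (1 / of_nat E) *\<^sub>R L x" if "\<sigma>' \<in> cones G" "x \<in> \<sigma>'" for \<sigma>' x
  proof -
    have "x \<in> support G" using that by (auto simp: support_def)
    then have "L x = of_nat E * m \<sigma>' x" using L(2) f_eq[OF that] by simp
    then show ?thesis using E0 by simp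
  qed
  moreover have "linear (\<lambda>x. (1 / of_nat E) *\<^sub>R L x)" 
    by (rule linearI) (simp_all add: linear_add[OF L(1)] linear_scale[OF L(1)] algebra_simps add_divide_distrib)
  ultimately show "\<exists>L. linear L \<and> (\<forall>\<sigma>\<in>cones G. \<theta> \<subseteq> \<sigma> \<longrightarrow> (\<forall>x\<in>\<sigma>. m \<sigma> x = L x))" by blast
qed

end

lemma dim_singleton_0: "dim {0 :: 'a::real_vector} = 0"
  using real_vector.dim_le_card[of "{0 :: 'a}" "{}"] by simp

lemma fan_dimI:
  assumes "finite (cones F)" "\<sigma> \<in> cones F" "dim \<sigma> = d" "\<And>\<tau>. \<tau> \<in> cones F \<Longrightarrow> dim \<tau> \<le> d"
  shows "fan_dim F = d"
  unfolding fan_dim_def using assms by (intro Max_eqI) auto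

lemma tropical_facet_exists:
  assumes "tropical_fan F"
  obtains \<sigma> where "\<sigma> \<in> facets F"
proof -
  obtain \<sigma> where "\<sigma> \<in> cones F" using tropical_rational[OF assms] by (auto simp: rational_fan_def)
  then obtain \<phi> where "\<phi> \<in> facets F" using cone_in_facet[OF assms] by metis
  then show ?thesis by (rule that)
qed

section \<open>Star fans\<close>

text \<open>With \<open>\<theta> = {0}\<close> every cone of the star fan counts. For the lattices:
  if a lattice point and a vector of \<open>span \<sigma>\<close> have the same image, they differ
  by a vector of \<open>span \<eta>\<close>, so the lattice point is in \<open>span \<sigma>\<close>
  too.\<close>

lemma star_fan_projection:
  assumes F: "tropical_fan F" and \<eta>: "\<eta> \<in> cones F"
  shows "fan_projection F (star_fan F \<eta>) \<eta> {0} (quotient_map (span \<eta>))"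
proof -
  have rF: "rational_fan F" using F tropical_rational by blast
  define q where "q = quotient_map (span \<eta>)"
  have q: "linear q" "{x. q x = 0} = span \<eta>"
    using quotient_map[OF subspace_span[of \<eta>]] by (simp_all add: q_def)
  have q0: "q x = 0 \<longleftrightarrow> x \<in> span \<eta>" for x using q(2) by blast
  have G: "star_fan F \<eta> = Fan (q ` lat F) ((`) q ` {\<tau> \<in> cones F. \<eta> \<subseteq> \<tau>})"
    by (simp add: star_fan_def q_def Let_def)
  have dim: "dim (q ` \<sigma>) + dim \<eta> = dim \<sigma>" if \<sigma>: "\<sigma> \<in> cones F" "\<eta> \<subseteq> \<sigma>" for \<sigma>
  proof -
    obtain V where V: "finite V" "\<sigma> \<subseteq> span V" by (rule cone_span_finite[OF fan_cone(1)[OF rF \<sigma>(1)]])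
    have "{x \<in> span \<sigma>. q x = 0} = span \<eta>"
      using span_mono[OF \<sigma>(2)] by (auto simp: q0)
    then show ?thesis using dim_kernel_image[OF q(1) V(2,1)] by simp
  qed
  obtain \<psi> where \<psi>: "\<psi> \<in> facets F" "\<eta> \<subseteq> \<psi>" using cone_in_facet[OF F \<eta>] by blast
  have d\<psi>: "dim \<psi> = fan_dim F" using \<psi>(1) by (simp add: facets_def)
  have fd: "fan_dim (star_fan F \<eta>) = fan_dim F - dim \<eta>"
  proof (rule fan_dimI)
    show "finite (cones (star_fan F \<eta>))" using fan_finite[OF rF] by (simp add: G)
    show "q ` \<psi> \<in> cones (star_fan F \<eta>)" using \<psi> facet_cone by (simp add: G)
    show "dim (q ` \<psi>) = fan_dim F - dim \<eta>" using dim[OF facet_cone[OF \<psi>(1)] \<psi>(2)] d\<psi> by simp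
    fix \<tau> assume "\<tau> \<in> cones (star_fan F \<eta>)"
    then obtain \<sigma> where \<sigma>: "\<sigma> \<in> cones F" "\<eta> \<subseteq> \<sigma>" "\<tau> = q ` \<sigma>" by (auto simp: G)
    then show "dim \<tau> \<le> fan_dim F - dim \<eta>" using dim[OF \<sigma>(1,2)] fan_dim_ge[OF rF \<sigma>(1)] by simp
  qed
  show ?thesis unfolding fan_projection_def q_def[symmetric]
  proof (intro conjI allI impI)
    show "tropical_fan F" "\<eta> \<in> cones F" "linear q" by (fact F \<eta> q(1))+
    have "0 \<in> q ` \<sigma>" if "\<sigma> \<in> cones F" for \<sigma>
      using fan_cone(4)[OF rF that] linear_0[OF q(1)] by force
    then show "{\<sigma> \<in> cones (star_fan F \<eta>). {0} \<subseteq> \<sigma>} = (`) q ` {\<sigma> \<in> cones F. \<eta> \<subseteq> \<sigma>}"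
      by (auto simp: G)
    show "x \<in> span \<eta>" if "q x = 0" for x using that q0 by blast
    have "{x \<in> span \<eta>. q x = 0} = span \<eta>" by (auto simp: q0)
    then show "fan_dim (star_fan F \<eta>) + dim {x \<in> span \<eta>. q x = 0} = fan_dim F"
      using fd fan_dim_ge[OF rF \<eta>] by simp
    fix \<sigma> assume \<sigma>: "\<sigma> \<in> cones F" "\<eta> \<subseteq> \<sigma>"
    show "q ` lat_of (lat F) \<sigma> = lat_of (lat (star_fan F \<eta>)) (q ` \<sigma>)"
    proof (intro equalityI subsetI)
      fix y assume "y \<in> q ` lat_of (lat F) \<sigma>"
      then show "y \<in> lat_of (lat (star_fan F \<eta>)) (q ` \<sigma>)"
        by (auto simp: G lat_of_def linear_span_image[OF q(1)])
    next
      fix y assume "y \<in> lat_of (lat (star_fan F \<eta>)) (q ` \<sigma>)"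
      then obtain x z where xz: "x \<in> lat F" "z \<in> span \<sigma>" "y = q x" "y = q z"
        by (auto simp: G lat_of_def linear_span_image[OF q(1)])
      then have "q (x - z) = 0" by (simp add: linear_diff[OF q(1)])
      then have "x - z \<in> span \<sigma>" using q0 span_mono[OF \<sigma>(2)] by blast
      then have "(x - z) + z \<in> span \<sigma>" using xz(2) by (rule span_add)
      then show "y \<in> q ` lat_of (lat F) \<sigma>" using xz by (simp add: lat_of_def)
    qed
  qed
qed

text \<open>Transport along the quotient by \<open>span \<eta>\<close>, in both directions. From
  here on div-faithfulness is handled only through families.\<close>

theorem div_faithful_iff_local:
  assumes "tropical_fan F"
  shows "div_faithful F \<longleftrightarrow> (\<forall>\<eta>\<in>cones F. local_faithful F \<eta>)"
proof -
  have "(\<forall>f. conewise_integral_linear (star_fan F \<eta>) f \<longrightarrow> div_trivial (star_fan F \<eta>) f \<longrightarrow>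
      linear_on_fan (star_fan F \<eta>) f) \<longleftrightarrow> local_faithful F \<eta>" if \<eta>: "\<eta> \<in> cones F" for \<eta>
  proof -
    define q where "q = quotient_map (span \<eta>)"
    interpret fan_projection F "star_fan F \<eta>" \<eta> "{0}" q
      unfolding q_def by (rule star_fan_projection[OF assms \<eta>])
    have q: "{x. q x = 0} = span \<eta>"
      using quotient_map[OF subspace_span[of \<eta>]] by (simp add: q_def)
    have G: "cones (star_fan F \<eta>) = (`) q ` {\<tau> \<in> cones F. \<eta> \<subseteq> \<tau>}"
      by (simp add: star_fan_def q_def Let_def)
    have "q ` \<eta> \<subseteq> {0}" using q span_base by blast
    moreover have z: "0 \<in> q ` \<sigma>" if "\<sigma> \<in> cones F" for \<sigma>
      using fan_cone(4)[OF rF that] linear_0[OF \<phi>] by force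
    ultimately have q\<eta>: "q ` \<eta> = {0}" using \<eta> by blast
    have all: "{0} \<subseteq> \<sigma>'" if "\<sigma>' \<in> cones (star_fan F \<eta>)" for \<sigma>'
      using that z by (auto simp: G)
    show ?thesis
    proof
      assume h: "\<forall>f. conewise_integral_linear (star_fan F \<eta>) f \<longrightarrow> div_trivial (star_fan F \<eta>) f \<longrightarrow>
        linear_on_fan (star_fan F \<eta>) f"
      have "local_faithful (star_fan F \<eta>) {0}"
        by (rule local_if_div_faithful[OF _ q\<eta>]) (use all h in auto)
      then show "local_faithful F \<eta>" by (rule local_faithful_preimage)
    next
      assume "local_faithful F \<eta>"
      then have lf: "local_faithful (star_fan F \<eta>) {0}" by (rule local_faithful_image)
      show "\<forall>f. conewise_integral_linear (star_fan F \<eta>) f \<longrightarrow> div_trivial (star_fan F \<eta>) f \<longrightarrow>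
        linear_on_fan (star_fan F \<eta>) f"
        using div_faithful_if_local[OF _ lf] all by blast
    qed
  qed
  then show ?thesis unfolding div_faithful_def by blast
qed

section \<open>Isomorphisms\<close>

text \<open>\<open>\<phi>\<close> is injective and compatible with the lattices on the span of the
  support only; all cones and their spans lie inside it, so \<open>fan_projection\<close> applies
  with zero kernel at every cone.\<close>

lemma div_faithful_iso:
  assumes F: "tropical_fan F" and G: "tropical_fan G" and df: "div_faithful F" and iso: "fan_iso F G"
  shows "div_faithful G"
proof -
  have rF: "rational_fan F" and rG: "rational_fan G" using F G tropical_rational by blast+
  obtain \<phi> where \<phi>: "linear \<phi>" "bij_betw \<phi> (span (support F)) (span (support G))"
    "\<phi> ` lat_of (lat F) (support F) = lat_of (lat G) (support G)" "bij_betw ((`) \<phi>) (cones F) (cones G)"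
    using iso unfolding fan_iso_def by blast
  have inj: "inj_on \<phi> (span (support F))" using \<phi>(2) by (rule bij_betw_imp_inj_on)
  have cG: "cones G = (`) \<phi> ` cones F" using bij_betw_imp_surj_on[OF \<phi>(4)] by simp
  have sup: "span \<sigma> \<subseteq> span (support F)" if "\<sigma> \<in> cones F" for \<sigma>
    using that by (intro span_mono) (auto simp: support_def)
  have supG: "span \<sigma> \<subseteq> span (support G)" if "\<sigma> \<in> cones G" for \<sigma>
    using that by (intro span_mono) (auto simp: support_def)
  have zero: "x = 0" if "x \<in> span (support F)" "\<phi> x = 0" for x
    using inj_onD[OF inj, of x 0] that span_zero[of "support F"] linear_0[OF \<phi>(1)] by simp
  have k0: "{x \<in> span \<sigma>. \<phi> x = 0} = {0}" if "\<sigma> \<in> cones F" for \<sigma>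
  proof (intro equalityI subsetI)
    show "x \<in> {0}" if "x \<in> {x \<in> span \<sigma>. \<phi> x = 0}" for x
      using zero[of x] sup[OF \<open>\<sigma> \<in> cones F\<close>] that by auto
  qed (simp add: span_zero linear_0[OF \<phi>(1)])
  have dims: "dim (\<phi> ` \<sigma>) = dim \<sigma>" if s: "\<sigma> \<in> cones F" for \<sigma>
  proof -
    obtain V where V: "finite V" "\<sigma> \<subseteq> span V" by (rule cone_span_finite[OF fan_cone(1)[OF rF s]])
    show ?thesis using dim_kernel_image[OF \<phi>(1) V(2,1)] by (simp add: k0[OF s] dim_singleton_0)
  qed
  have "dim ` cones G = dim ` cones F" unfolding cG image_image using dims by (intro image_cong) auto
  then have fd: "fan_dim G = fan_dim F" by (simp add: fan_dim_def)
  have "local_faithful G \<theta>" if \<theta>: "\<theta> \<in> cones G" for \<theta>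
  proof -
    obtain \<eta> where \<eta>: "\<eta> \<in> cones F" "\<theta> = \<phi> ` \<eta>" using \<theta> cG by blast
    have "fan_projection F G \<eta> \<theta> \<phi>" unfolding fan_projection_def
    proof (intro conjI allI impI)
      show "tropical_fan F" "\<eta> \<in> cones F" "linear \<phi>" by (fact F \<eta>(1) \<phi>(1))+
      have "\<eta> \<subseteq> \<sigma>" if s: "\<sigma> \<in> cones F" "\<phi> ` \<eta> \<subseteq> \<phi> ` \<sigma>" for \<sigma>
      proof
        fix x assume x: "x \<in> \<eta>"
        then obtain y where y: "y \<in> \<sigma>" "\<phi> x = \<phi> y" using s(2) by blast
        have "x = y" using inj_onD[OF inj y(2)] sup[OF s(1)] sup[OF \<eta>(1)] x y(1) span_base by blast
        then show "x \<in> \<sigma>" using y(1) by simp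
      qed
      then show "{\<sigma> \<in> cones G. \<theta> \<subseteq> \<sigma>} = (`) \<phi> ` {\<sigma> \<in> cones F. \<eta> \<subseteq> \<sigma>}"
        unfolding cG \<eta>(2) by blast
      show "x \<in> span \<eta>" if "x \<in> span (\<Union> {\<sigma> \<in> cones F. \<eta> \<subseteq> \<sigma>})" "\<phi> x = 0" for x
      proof -
        have "\<Union> {\<sigma> \<in> cones F. \<eta> \<subseteq> \<sigma>} \<subseteq> support F" by (auto simp: support_def)
        then have "x \<in> span (support F)" using that(1) span_mono by blast
        then show ?thesis using zero that(2) span_zero by blast
      qed
      show "fan_dim G + dim {x \<in> span \<eta>. \<phi> x = 0} = fan_dim F"
        using fd k0[OF \<eta>(1)] dim_singleton_0 by simp
      fix \<sigma> assume \<sigma>: "\<sigma> \<in> cones F" "\<eta> \<subseteq> \<sigma>"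
      have \<sigma>G: "\<phi> ` \<sigma> \<in> cones G" using \<sigma>(1) cG by blast
      show "\<phi> ` lat_of (lat F) \<sigma> = lat_of (lat G) (\<phi> ` \<sigma>)"
      proof (intro equalityI subsetI)
        fix y assume "y \<in> \<phi> ` lat_of (lat F) \<sigma>"
        then obtain x where x: "x \<in> lat F" "x \<in> span \<sigma>" "y = \<phi> x" by (auto simp: lat_of_def)
        then have "x \<in> lat_of (lat F) (support F)" using sup[OF \<sigma>(1)] by (auto simp: lat_of_def)
        then have "y \<in> lat G" using \<phi>(3) x(3) by (auto simp: lat_of_def)
        then show "y \<in> lat_of (lat G) (\<phi> ` \<sigma>)" using x by (simp add: lat_of_def linear_span_image[OF \<phi>(1)])
      next
        fix y assume y: "y \<in> lat_of (lat G) (\<phi> ` \<sigma>)"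
        then have "y \<in> lat_of (lat G) (support G)" using supG[OF \<sigma>G] by (auto simp: lat_of_def)
        then obtain x where x: "x \<in> lat_of (lat F) (support F)" "y = \<phi> x" using \<phi>(3) by blast
        obtain s where s: "s \<in> span \<sigma>" "y = \<phi> s" using y by (auto simp: lat_of_def linear_span_image[OF \<phi>(1)])
        have "x = s" using inj_onD[OF inj] x s sup[OF \<sigma>(1)] by (auto simp: lat_of_def)
        then show "y \<in> \<phi> ` lat_of (lat F) \<sigma>" using x s by (auto simp: lat_of_def)
      qed
    qed
    then show ?thesis 
      by (rule fan_projection.local_faithful_image) (use df div_faithful_iff_local[OF F] \<eta>(1) in blast)
  qed
  then show ?thesis using div_faithful_iff_local[OF G] by blast
qed

section \<open>Products\<close>

lift_definition vfst :: "vec \<Rightarrow> vec" is "\<lambda>z n. z (2 * n)"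
proof -
  fix z :: "nat \<Rightarrow> real" assume "finite {n. z n \<noteq> 0}"
  then have "finite ((\<lambda>n. 2 * n) -` {n. z n \<noteq> 0})" by (intro finite_vimageI) (auto simp: inj_def)
  then show "finite {n. z (2 * n) \<noteq> 0}" by (simp add: vimage_def)
qed

lift_definition vsnd :: "vec \<Rightarrow> vec" is "\<lambda>z n. z (2 * n + 1)"
proof -
  fix z :: "nat \<Rightarrow> real" assume "finite {n. z n \<noteq> 0}"
  then have "finite ((\<lambda>n. 2 * n + 1) -` {n. z n \<noteq> 0})" by (intro finite_vimageI) (auto simp: inj_def)
  then show "finite {n. z (2 * n + 1) \<noteq> 0}" by (simp add: vimage_def)
qed

lemma vfst_vpair [simp]: "vfst (vpair x y) = x"
  by (rule poly_mapping_eqI) (simp add: vfst.rep_eq vpair.rep_eq)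

lemma vsnd_vpair [simp]: "vsnd (vpair x y) = y"
  by (rule poly_mapping_eqI) (simp add: vsnd.rep_eq vpair.rep_eq)

lemma linear_vfst: "linear vfst"
  by (rule linearI; rule poly_mapping_eqI) (simp_all add: vfst.rep_eq lookup_add lookup_scaleR_vec)

lemma linear_vsnd: "linear vsnd"
  by (rule linearI; rule poly_mapping_eqI) (simp_all add: vsnd.rep_eq lookup_add lookup_scaleR_vec)

lemma vpair_add: "vpair x y + vpair x' y' = vpair (x + x') (y + y')"
  by (rule poly_mapping_eqI) (simp add: vpair.rep_eq lookup_add)

lemma vpair_scale: "c *\<^sub>R vpair x y = vpair (c *\<^sub>R x) (c *\<^sub>R y)"
  by (rule poly_mapping_eqI) (simp add: vpair.rep_eq lookup_scaleR_vec)

lemma vpair_diff: "vpair x y - vpair x' y' = vpair (x - x') (y - y')"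
  by (rule poly_mapping_eqI) (simp add: vpair.rep_eq lookup_minus)

lemma vpair_0: "vpair 0 0 = 0"
  by (rule poly_mapping_eqI) (simp add: vpair.rep_eq)

lemma linear_vpair_left: "linear (\<lambda>x. vpair x 0)"
  by (rule linearI) (simp_all add: vpair_add vpair_scale)

lemma linear_vpair_right: "linear (\<lambda>y. vpair 0 y)"
  by (rule linearI) (simp_all add: vpair_add vpair_scale)

definition vprod :: "vec set \<Rightarrow> vec set \<Rightarrow> vec set" where
  "vprod A B = {vpair x y | x y. x \<in> A \<and> y \<in> B}"

lemma vpair_in_vprod [simp]: "vpair x y \<in> vprod A B \<longleftrightarrow> x \<in> A \<and> y \<in> B"
  by (auto simp: vprod_def vpair_inject)

lemma vprod_subset_iff:
  assumes "0 \<in> A" "0 \<in> B"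
  shows "vprod A B \<subseteq> vprod C D \<longleftrightarrow> A \<subseteq> C \<and> B \<subseteq> D"
proof
  assume h: "vprod A B \<subseteq> vprod C D"
  have "x \<in> C" if "x \<in> A" for x using h assms(2) that vpair_in_vprod[of x 0] by blast
  moreover have "y \<in> D" if "y \<in> B" for y using h assms(1) that vpair_in_vprod[of 0 y] by blast
  ultimately show "A \<subseteq> C \<and> B \<subseteq> D" by blast
next
  assume "A \<subseteq> C \<and> B \<subseteq> D"
  then show "vprod A B \<subseteq> vprod C D" unfolding vprod_def by blast
qed

lemma span_vprod:
  assumes "0 \<in> A" "0 \<in> B"
  shows "span (vprod A B) = vprod (span A) (span B)"
proof
  have "subspace (vprod (span A) (span B))"
  proof (rule real_vector.subspaceI)
    have "vpair 0 0 \<in> vprod (span A) (span B)" by (simp add: span_zero)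
    then show "0 \<in> vprod (span A) (span B)" by (simp only: vpair_0)
  qed (auto simp: vprod_def vpair_inject vpair_add vpair_scale span_add span_scale)
  moreover have "vprod A B \<subseteq> vprod (span A) (span B)" by (auto simp: vprod_def vpair_inject span_base)
  ultimately show "span (vprod A B) \<subseteq> vprod (span A) (span B)" by (rule_tac span_minimal)
  show "vprod (span A) (span B) \<subseteq> span (vprod A B)"
  proof
    fix z assume "z \<in> vprod (span A) (span B)"
    then obtain x y where xy: "z = vpair x y" "x \<in> span A" "y \<in> span B" by (auto simp: vprod_def)
    have "vpair x 0 \<in> span ((\<lambda>x. vpair x 0) ` A)"
      unfolding linear_span_image[OF linear_vpair_left] using xy(2) by blast
    moreover have "(\<lambda>x. vpair x 0) ` A \<subseteq> vprod A B" using assms by auto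
    ultimately have 1: "vpair x 0 \<in> span (vprod A B)" using span_mono by blast
    have "vpair 0 y \<in> span ((\<lambda>y. vpair 0 y) ` B)"
      unfolding linear_span_image[OF linear_vpair_right] using xy(3) by blast
    moreover have "(\<lambda>y. vpair 0 y) ` B \<subseteq> vprod A B" using assms by auto
    ultimately have 2: "vpair 0 y \<in> span (vprod A B)" using span_mono by blast
    show "z \<in> span (vprod A B)" using span_add[OF 1 2] by (simp add: xy(1) vpair_add)
  qed
qed

text \<open>Rank-nullity for \<open>vfst\<close>, whose kernel on the span is a copy of
  \<open>span B\<close>.\<close>

lemma dim_vprod:
  assumes "0 \<in> A" "0 \<in> B" "B \<subseteq> span V" "finite V" "vprod A B \<subseteq> span W" "finite W"
  shows "dim (vprod A B) = dim A + dim B"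
proof -
  have 1: "vfst ` vprod A B = A" using assms(2) by (force simp: vprod_def)
  have "{z \<in> span (vprod A B). vfst z = 0} = (\<lambda>y. vpair 0 y) ` span B"
    unfolding span_vprod[OF assms(1,2)] 
    using span_zero[of A] by (auto simp: vprod_def)
  also have "\<dots> = span ((\<lambda>y. vpair 0 y) ` B)" by (simp add: linear_span_image[OF linear_vpair_right])
  finally have 2: "dim {z \<in> span (vprod A B). vfst z = 0} = dim ((\<lambda>y. vpair 0 y) ` B)" by simp
  have "{y \<in> span B. vpair 0 y = 0} = {0}"
  proof (intro equalityI subsetI)
    show "y \<in> {0}" if "y \<in> {y \<in> span B. vpair 0 y = 0}" for y
      using that vsnd_vpair[of 0 y] linear_0[OF linear_vsnd] by simp
  qed (simp add: span_zero vpair_0)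
  then have "dim ((\<lambda>y. vpair 0 y) ` B) = dim B"
    using dim_kernel_image[OF linear_vpair_right assms(3,4)] by (simp add: dim_singleton_0)
  then show ?thesis using dim_kernel_image[OF linear_vfst assms(5,6)] 1 2 by simp
qed

text \<open>Restriction of a family to a slice of \<open>P\<close>. In contrast to
  \<open>fan_projection\<close>, the cone \<open>\<beta> \<sigma>\<close> only contains the image of
  \<open>\<sigma>\<close>; what matters is that facets around a ridge correspond under
  \<open>\<beta>\<close> and that normal vectors are carried along by
  \<open>\<iota>\<close>.\<close>

lemma balanced_slice:
  assumes F: "tropical_fan F" and g: "local_family P \<theta> g" "\<And>\<tau>. \<tau> \<in> ridges P \<Longrightarrow> \<theta> \<subseteq> \<tau> \<Longrightarrow> balanced_at P \<tau> g"
    and P: "rational_fan P" and \<iota>: "linear \<iota>"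
    and \<beta>: "\<And>\<sigma>. \<sigma> \<in> cones F \<Longrightarrow> \<eta> \<subseteq> \<sigma> \<Longrightarrow> \<beta> \<sigma> \<in> cones P \<and> \<theta> \<subseteq> \<beta> \<sigma> \<and> \<iota> ` \<sigma> \<subseteq> \<beta> \<sigma> \<and> 
      \<iota> ` lat_of (lat F) \<sigma> \<subseteq> lat_of (lat P) (\<beta> \<sigma>)"
    and mono: "\<And>\<sigma> \<sigma>'. \<sigma> \<in> cones F \<Longrightarrow> \<sigma>' \<in> cones F \<Longrightarrow> \<eta> \<subseteq> \<sigma> \<Longrightarrow> \<sigma> \<subseteq> \<sigma>' \<Longrightarrow> \<beta> \<sigma> \<subseteq> \<beta> \<sigma>'"
    and inj: "inj_on \<beta> {\<sigma> \<in> cones F. \<eta> \<subseteq> \<sigma>}"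
    and ridge: "\<And>\<tau>. \<tau> \<in> ridges F \<Longrightarrow> \<eta> \<subseteq> \<tau> \<Longrightarrow> \<beta> \<tau> \<in> ridges P"
    and facet: "\<And>\<tau>. \<tau> \<in> ridges F \<Longrightarrow> \<eta> \<subseteq> \<tau> \<Longrightarrow> 
      {\<sigma>'. \<sigma>' \<in> facets P \<and> \<beta> \<tau> \<subseteq> \<sigma>'} = \<beta> ` {\<sigma>. \<sigma> \<in> facets F \<and> \<tau> \<subseteq> \<sigma>}"
    and normal: "\<And>\<tau> \<sigma> v. \<tau> \<in> ridges F \<Longrightarrow> \<eta> \<subseteq> \<tau> \<Longrightarrow> \<sigma> \<in> facets F \<Longrightarrow> \<tau> \<subseteq> \<sigma> \<Longrightarrow> 
      is_normal_vector (lat F) \<tau> \<sigma> v \<Longrightarrow> is_normal_vector (lat P) (\<beta> \<tau>) (\<beta> \<sigma>) (\<iota> v)"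
  defines "l \<equiv> \<lambda>\<sigma> x. g (\<beta> \<sigma>) (\<iota> x)"
  shows "balanced_family F \<eta> l"
proof -
  have rF: "rational_fan F" using F tropical_rational by blast
  have lf: "local_family F \<eta> l" unfolding local_family_def
  proof (intro conjI ballI impI)
    fix \<sigma> assume s: "\<sigma> \<in> cones F" "\<eta> \<subseteq> \<sigma>"
    then have b: "\<beta> \<sigma> \<in> cones P" "\<theta> \<subseteq> \<beta> \<sigma>" using \<beta> by auto
    show "linear (l \<sigma>)" unfolding l_def
      using linear_compose[OF \<iota> local_family_linear[OF g(1) b]] by (simp add: o_def)
    show "l \<sigma> x \<in> \<rat>" if "x \<in> lat_of (lat F) \<sigma>" for x
      unfolding l_def using local_family_rational[OF g(1) b] \<beta>[OF s] that by blast
  next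
    fix \<sigma> \<sigma>' x assume s: "\<sigma> \<in> cones F" "\<sigma>' \<in> cones F" "\<eta> \<subseteq> \<sigma>" "\<sigma> \<subseteq> \<sigma>'" "x \<in> \<sigma>"
    have \<sigma>': "\<eta> \<subseteq> \<sigma>'" using s by blast
    have "\<iota> x \<in> span (\<beta> \<sigma>)" using \<beta>[OF s(1,3)] s(5) span_base by blast
    moreover have "\<beta> \<sigma> \<in> cones P" "\<beta> \<sigma>' \<in> cones P" "\<theta> \<subseteq> \<beta> \<sigma>" using \<beta>[OF s(1,3)] \<beta>[OF s(2) \<sigma>'] by simp_all
    ultimately show "l \<sigma> x = l \<sigma>' x" unfolding l_def
      using local_family_compat[OF g(1) _ _ _ mono[OF s(1-4)]] by simp
  qed
  have "balanced_at F \<tau> l" if \<tau>: "\<tau> \<in> ridges F" "\<eta> \<subseteq> \<tau>" for \<tau>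
  proof -
  define n where "n = normal_vector (lat F) \<tau>"
  have n: "is_normal_vector (lat F) \<tau> \<sigma> (n \<sigma>)" if "\<sigma> \<in> facets F" "\<tau> \<subseteq> \<sigma>" for \<sigma>
    using ridge_facet_normal[OF rF \<tau>(1) that] by (simp add: n_def)
  define inv where "inv = inv_into {\<sigma> \<in> cones F. \<eta> \<subseteq> \<sigma>} \<beta>"
  have inv: "inv (\<beta> \<sigma>) = \<sigma>" if "\<sigma> \<in> facets F" "\<tau> \<subseteq> \<sigma>" for \<sigma>
    unfolding inv_def using inv_into_f_f[OF inj] that \<tau>(2) facet_cone by blast
  define n' where "n' \<sigma>' = \<iota> (n (inv \<sigma>'))" for \<sigma>'
  have n': "is_normal_vector (lat P) (\<beta> \<tau>) \<sigma>' (n' \<sigma>')" if "\<sigma>' \<in> facets P" "\<beta> \<tau> \<subseteq> \<sigma>'" for \<sigma>'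
  proof -
    have "\<sigma>' \<in> \<beta> ` {\<sigma>. \<sigma> \<in> facets F \<and> \<tau> \<subseteq> \<sigma>}" using facet[OF \<tau>] that by blast
    then obtain \<sigma> where \<sigma>: "\<sigma> \<in> facets F" "\<tau> \<subseteq> \<sigma>" "\<sigma>' = \<beta> \<sigma>" by blast
    show ?thesis using normal[OF \<tau> \<sigma>(1,2) n[OF \<sigma>(1,2)]] inv[OF \<sigma>(1,2)] by (simp add: n'_def \<sigma>(3))
  qed
  have "\<beta> \<tau> \<in> ridges P" "\<theta> \<subseteq> \<beta> \<tau>" "balanced_at P (\<beta> \<tau>) g"
    using ridge[OF \<tau>] \<beta>[OF ridge_cone[OF \<tau>(1)] \<tau>(2)] g(2) by blast+
  then have "(\<Sum>\<sigma>' | \<sigma>' \<in> facets P \<and> \<beta> \<tau> \<subseteq> \<sigma>'. g \<sigma>' (n' \<sigma>')) 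
      = g (\<beta> \<tau>) (\<Sum>\<sigma>' | \<sigma>' \<in> facets P \<and> \<beta> \<tau> \<subseteq> \<sigma>'. n' \<sigma>')"
    using n' by (intro balanced_any_normals[OF P g(1)]) auto
  moreover have injf: "inj_on \<beta> {\<sigma>. \<sigma> \<in> facets F \<and> \<tau> \<subseteq> \<sigma>}"
    by (rule inj_on_subset[OF inj]) (use \<tau>(2) facet_cone in blast)
  ultimately have "(\<Sum>\<sigma> | \<sigma> \<in> facets F \<and> \<tau> \<subseteq> \<sigma>. g (\<beta> \<sigma>) (n' (\<beta> \<sigma>))) 
      = g (\<beta> \<tau>) (\<Sum>\<sigma> | \<sigma> \<in> facets F \<and> \<tau> \<subseteq> \<sigma>. n' (\<beta> \<sigma>))"
    unfolding facet[OF \<tau>] by (simp add: sum.reindex)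
  moreover have "n' (\<beta> \<sigma>) = \<iota> (n \<sigma>)" if "\<sigma> \<in> facets F \<and> \<tau> \<subseteq> \<sigma>" for \<sigma>
    using that inv by (simp add: n'_def)
  ultimately have "(\<Sum>\<sigma> | \<sigma> \<in> facets F \<and> \<tau> \<subseteq> \<sigma>. g (\<beta> \<sigma>) (\<iota> (n \<sigma>))) 
      = g (\<beta> \<tau>) (\<Sum>\<sigma> | \<sigma> \<in> facets F \<and> \<tau> \<subseteq> \<sigma>. \<iota> (n \<sigma>))" by simp
  then show "balanced_at F \<tau> l" unfolding balanced_at_def l_def
    using n by (intro exI[of _ n]) (simp add: linear_sum[OF \<iota>])
  qed
  then show ?thesis using lf by (simp add: balanced_family_def)
qed

locale fan_product =
  fixes F G P
  assumes F: "tropical_fan F" and G: "tropical_fan G" and P: "tropical_fan P" and P_def: "P = fan_prod F G"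
begin

lemma rational_fans: "rational_fan F" "rational_fan G" "rational_fan P"
  using F G P tropical_rational by blast+

lemma cones_P: "cones P = {vprod \<sigma> \<tau> | \<sigma> \<tau>. \<sigma> \<in> cones F \<and> \<tau> \<in> cones G}"
  by (simp add: P_def fan_prod_def vprod_def)

lemma lat_P: "lat P = vprod (lat F) (lat G)"
  by (simp add: P_def fan_prod_def vprod_def)

lemma prod_cone: "\<sigma> \<in> cones F \<Longrightarrow> \<tau> \<in> cones G \<Longrightarrow> vprod \<sigma> \<tau> \<in> cones P"
  unfolding cones_P by blast

lemma zero_mem: "\<sigma> \<in> cones F \<Longrightarrow> 0 \<in> \<sigma>" "\<tau> \<in> cones G \<Longrightarrow> 0 \<in> \<tau>"
  using fan_cone(4) rational_fans by blast+

lemma lat_of_P: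
  assumes "\<sigma> \<in> cones F" "\<tau> \<in> cones G"
  shows "lat_of (lat P) (vprod \<sigma> \<tau>) = vprod (lat_of (lat F) \<sigma>) (lat_of (lat G) \<tau>)"
proof -
  have Int: "vprod A B \<inter> vprod C D = vprod (A \<inter> C) (B \<inter> D)" for A B C D
    by (auto simp: vprod_def vpair_inject)
  show ?thesis unfolding lat_of_def lat_P span_vprod[OF zero_mem(1)[OF assms(1)] zero_mem(2)[OF assms(2)]]
    by (rule Int)
qed

lemma dim_P:
  assumes "\<sigma> \<in> cones F" "\<tau> \<in> cones G"
  shows "dim (vprod \<sigma> \<tau>) = dim \<sigma> + dim \<tau>"
proof -
  obtain V where V: "finite V" "\<tau> \<subseteq> span V" by (rule cone_span_finite[OF fan_cone(1)[OF rational_fans(2) assms(2)]])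
  obtain W where W: "finite W" "vprod \<sigma> \<tau> \<subseteq> span W" 
    by (rule cone_span_finite[OF fan_cone(1)[OF rational_fans(3) prod_cone[OF assms]]])
  show ?thesis using dim_vprod[OF zero_mem(1)[OF assms(1)] zero_mem(2)[OF assms(2)] V(2,1) W(2,1)] .
qed

lemma fan_dim_P: "fan_dim P = fan_dim F + fan_dim G"
proof -
  obtain \<sigma> where \<sigma>: "\<sigma> \<in> facets F" using tropical_facet_exists[OF F] by blast
  obtain \<tau> where \<tau>: "\<tau> \<in> facets G" using tropical_facet_exists[OF G] by blast
  show ?thesis
  proof (rule fan_dimI[OF fan_finite[OF rational_fans(3)] prod_cone[OF facet_cone[OF \<sigma>] facet_cone[OF \<tau>]]])
    show "dim (vprod \<sigma> \<tau>) = fan_dim F + fan_dim G"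
      using dim_P[OF facet_cone[OF \<sigma>] facet_cone[OF \<tau>]] \<sigma> \<tau> by (simp add: facets_def)
    fix \<mu> assume "\<mu> \<in> cones P"
    then obtain \<sigma>' \<tau>' where h: "\<mu> = vprod \<sigma>' \<tau>'" "\<sigma>' \<in> cones F" "\<tau>' \<in> cones G" unfolding cones_P by blast
    then show "dim \<mu> \<le> fan_dim F + fan_dim G"
      using dim_P[OF h(2,3)] fan_dim_ge[OF rational_fans(1) h(2)] fan_dim_ge[OF rational_fans(2) h(3)] by simp
  qed
qed

lemma facet_P:
  assumes "\<sigma> \<in> cones F" "\<tau> \<in> cones G"
  shows "vprod \<sigma> \<tau> \<in> facets P \<longleftrightarrow> \<sigma> \<in> facets F \<and> \<tau> \<in> facets G"
proof -
  have "vprod \<sigma> \<tau> \<in> facets P \<longleftrightarrow> dim \<sigma> + dim \<tau> = fan_dim F + fan_dim G"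
    using prod_cone[OF assms] by (simp add: facets_def dim_P[OF assms] fan_dim_P)
  also have "\<dots> \<longleftrightarrow> dim \<sigma> = fan_dim F \<and> dim \<tau> = fan_dim G"
    using fan_dim_ge[OF rational_fans(1) assms(1)] fan_dim_ge[OF rational_fans(2) assms(2)] by linarith
  finally show ?thesis using assms by (simp add: facets_def)
qed

lemma subset_P:
  assumes "\<sigma> \<in> cones F" "\<tau> \<in> cones G"
  shows "vprod \<sigma> \<tau> \<subseteq> vprod \<sigma>' \<tau>' \<longleftrightarrow> \<sigma> \<subseteq> \<sigma>' \<and> \<tau> \<subseteq> \<tau>'"
  using vprod_subset_iff[OF zero_mem(1)[OF assms(1)] zero_mem(2)[OF assms(2)]] .

text \<open>Fixing a facet \<open>\<kappa>\<close> of \<open>G\<close> makes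
  \<open>\<tau> \<times> \<kappa>\<close> a ridge of the product for each ridge
  \<open>\<tau>\<close> of \<open>F\<close>. No other cone of \<open>G\<close> contains
  \<open>\<kappa>\<close>, so the facets around it are the
  \<open>\<sigma> \<times> \<kappa>\<close>, with normal vectors \<open>(v, 0)\<close>.\<close>

lemma slice_left:
  assumes \<eta>: "\<eta> \<in> cones F" and \<kappa>: "\<kappa> \<in> facets G" "\<theta> \<subseteq> \<kappa>" and lf: "local_faithful F \<eta>"
    and g: "local_family P (vprod \<eta> \<theta>) g" 
      "\<And>\<tau>. \<tau> \<in> ridges P \<Longrightarrow> vprod \<eta> \<theta> \<subseteq> \<tau> \<Longrightarrow> balanced_at P \<tau> g"
  obtains L where "linear L" "\<And>\<sigma> x. \<sigma> \<in> cones F \<Longrightarrow> \<eta> \<subseteq> \<sigma> \<Longrightarrow> x \<in> span \<sigma> \<Longrightarrow> g (vprod \<sigma> \<kappa>) (vpair x 0) = L x"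
proof -
  have c\<kappa>: "\<kappa> \<in> cones G" using facet_cone \<kappa> by blast
  have 0: "0 \<in> lat_of (lat G) \<kappa>" "0 \<in> \<kappa>" "0 \<in> span \<kappa>"
    using lat_of_closed(1)[OF fan_lattice[OF rational_fans(2)]] zero_mem c\<kappa> span_zero by auto
  have sp: "span (vprod \<sigma> \<kappa>) = vprod (span \<sigma>) (span \<kappa>)" if "\<sigma> \<in> cones F" for \<sigma>
    using span_vprod zero_mem c\<kappa> that by blast
  have "balanced_family F \<eta> (\<lambda>\<sigma> x. g (vprod \<sigma> \<kappa>) (vpair x 0))"
  proof (rule balanced_slice[OF F g rational_fans(3) linear_vpair_left]; assumption?)
    fix \<sigma> assume s: "\<sigma> \<in> cones F" "\<eta> \<subseteq> \<sigma>"
    have "vprod \<eta> \<theta> \<subseteq> vprod \<sigma> \<kappa>" using s(2) \<kappa>(2) unfolding vprod_def by blast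
    then show "vprod \<sigma> \<kappa> \<in> cones P \<and> vprod \<eta> \<theta> \<subseteq> vprod \<sigma> \<kappa> \<and> (\<lambda>x. vpair x 0) ` \<sigma> \<subseteq> vprod \<sigma> \<kappa> \<and>
         (\<lambda>x. vpair x 0) ` lat_of (lat F) \<sigma> \<subseteq> lat_of (lat P) (vprod \<sigma> \<kappa>)"
      using 0 prod_cone[OF s(1) c\<kappa>] unfolding lat_of_P[OF s(1) c\<kappa>] by auto
  next
    fix \<sigma> \<sigma>' :: "vec set" assume "\<sigma> \<subseteq> \<sigma>'"
    then show "vprod \<sigma> \<kappa> \<subseteq> vprod \<sigma>' \<kappa>" unfolding vprod_def by blast
  next
    show "inj_on (\<lambda>\<sigma>. vprod \<sigma> \<kappa>) {\<sigma> \<in> cones F. \<eta> \<subseteq> \<sigma>}"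
    proof (rule inj_onI)
      fix \<sigma> \<sigma>' assume "\<sigma> \<in> {\<sigma> \<in> cones F. \<eta> \<subseteq> \<sigma>}" "\<sigma>' \<in> {\<sigma> \<in> cones F. \<eta> \<subseteq> \<sigma>}" "vprod \<sigma> \<kappa> = vprod \<sigma>' \<kappa>"
      then show "\<sigma> = \<sigma>'" using subset_P[of \<sigma> \<kappa> \<sigma>' \<kappa>] subset_P[of \<sigma>' \<kappa> \<sigma> \<kappa>] c\<kappa> by auto
    qed
  next
    fix \<tau> assume "\<tau> \<in> ridges F"
    then show "vprod \<tau> \<kappa> \<in> ridges P"
      using \<kappa>(1) dim_P[of \<tau> \<kappa>] fan_dim_P prod_cone[of \<tau> \<kappa>] by (auto simp: ridges_def facets_def)
  next
    fix \<tau> assume \<tau>: "\<tau> \<in> ridges F"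
    show "{\<sigma>'. \<sigma>' \<in> facets P \<and> vprod \<tau> \<kappa> \<subseteq> \<sigma>'} = (\<lambda>\<sigma>. vprod \<sigma> \<kappa>) ` {\<sigma>. \<sigma> \<in> facets F \<and> \<tau> \<subseteq> \<sigma>}"
    proof (intro equalityI subsetI)
      fix \<mu> assume \<mu>: "\<mu> \<in> {\<sigma>'. \<sigma>' \<in> facets P \<and> vprod \<tau> \<kappa> \<subseteq> \<sigma>'}"
      then have "\<mu> \<in> cones P" using facet_cone by blast
      then obtain \<sigma> \<kappa>' where h: "\<mu> = vprod \<sigma> \<kappa>'" "\<sigma> \<in> cones F" "\<kappa>' \<in> cones G" unfolding cones_P by blast
      have f: "\<sigma> \<in> facets F" "\<kappa>' \<in> facets G" using \<mu> facet_P[OF h(2,3)] h(1) by auto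
      have "\<tau> \<subseteq> \<sigma>" "\<kappa> \<subseteq> \<kappa>'" using \<mu> subset_P[OF ridge_cone[OF \<tau>] c\<kappa>] h(1) by auto
      moreover have "\<kappa>' = \<kappa>" using facet_dim_ge[OF rational_fans(2) h(3) \<kappa>(1)] \<open>\<kappa> \<subseteq> \<kappa>'\<close> by blast
      ultimately show "\<mu> \<in> (\<lambda>\<sigma>. vprod \<sigma> \<kappa>) ` {\<sigma>. \<sigma> \<in> facets F \<and> \<tau> \<subseteq> \<sigma>}" using f h(1) by blast
    next
      fix \<mu> assume "\<mu> \<in> (\<lambda>\<sigma>. vprod \<sigma> \<kappa>) ` {\<sigma>. \<sigma> \<in> facets F \<and> \<tau> \<subseteq> \<sigma>}"
      then obtain \<sigma> where \<sigma>: "\<mu> = vprod \<sigma> \<kappa>" "\<sigma> \<in> facets F" "\<tau> \<subseteq> \<sigma>" by blast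
      then show "\<mu> \<in> {\<sigma>'. \<sigma>' \<in> facets P \<and> vprod \<tau> \<kappa> \<subseteq> \<sigma>'}"
        using facet_P[OF facet_cone[OF \<sigma>(2)] c\<kappa>] \<kappa>(1) unfolding vprod_def by blast
    qed
  next
    fix \<tau> \<sigma> v assume h: "\<tau> \<in> ridges F" "\<sigma> \<in> facets F" "is_normal_vector (lat F) \<tau> \<sigma> v"
    note c = ridge_cone[OF h(1)] facet_cone[OF h(2)]
    show "is_normal_vector (lat P) (vprod \<tau> \<kappa>) (vprod \<sigma> \<kappa>) (vpair v 0)"
      unfolding is_normal_vector_def lat_of_P[OF c(1) c\<kappa>] lat_of_P[OF c(2) c\<kappa>] sp[OF c(1)]
    proof (intro conjI ballI)
      show "vpair v 0 \<in> vprod (lat_of (lat F) \<sigma>) (lat_of (lat G) \<kappa>)"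
        using normal_vector_lat[OF h(3)] 0 by simp
      fix z assume "z \<in> vprod (lat_of (lat F) \<sigma>) (lat_of (lat G) \<kappa>)"
      then obtain x y where xy: "z = vpair x y" "x \<in> lat_of (lat F) \<sigma>" "y \<in> lat_of (lat G) \<kappa>" 
        unfolding vprod_def by blast
      then obtain k :: int where "x - of_int k *\<^sub>R v \<in> lat_of (lat F) \<tau>"
        using h(3) unfolding is_normal_vector_def by blast
      then show "\<exists>k::int. z - of_int k *\<^sub>R vpair v 0 \<in> vprod (lat_of (lat F) \<tau>) (lat_of (lat G) \<kappa>)"
        using xy by (intro exI[of _ k]) (simp add: vpair_scale vpair_diff)
    next
      obtain s where "s \<in> \<sigma>" "v - s \<in> span \<tau>" using h(3) unfolding is_normal_vector_def by blast
      then show "\<exists>s\<in>vprod \<sigma> \<kappa>. vpair v 0 - s \<in> vprod (span \<tau>) (span \<kappa>)"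
        using 0 by (intro bexI[of _ "vpair s 0"]) (simp_all add: vpair_diff)
    qed
  qed
  then show ?thesis unfolding balanced_family_def
    using that local_faithfulD[OF lf] by (metis (no_types, lifting))
qed

text \<open>The mirror image of \<open>slice_left\<close>, with a facet of \<open>F\<close> held
  fixed.\<close>

lemma slice_right:
  assumes \<theta>: "\<theta> \<in> cones G" and \<kappa>: "\<kappa> \<in> facets F" "\<eta> \<subseteq> \<kappa>" and lf: "local_faithful G \<theta>"
    and g: "local_family P (vprod \<eta> \<theta>) g" 
      "\<And>\<tau>. \<tau> \<in> ridges P \<Longrightarrow> vprod \<eta> \<theta> \<subseteq> \<tau> \<Longrightarrow> balanced_at P \<tau> g"
  obtains L where "linear L" "\<And>\<sigma> x. \<sigma> \<in> cones G \<Longrightarrow> \<theta> \<subseteq> \<sigma> \<Longrightarrow> x \<in> span \<sigma> \<Longrightarrow> g (vprod \<kappa> \<sigma>) (vpair 0 x) = L x"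
proof -
  have c\<kappa>: "\<kappa> \<in> cones F" using facet_cone \<kappa> by blast
  have 0: "0 \<in> lat_of (lat F) \<kappa>" "0 \<in> \<kappa>" "0 \<in> span \<kappa>"
    using lat_of_closed(1)[OF fan_lattice[OF rational_fans(1)]] zero_mem c\<kappa> span_zero by auto
  have sp: "span (vprod \<kappa> \<sigma>) = vprod (span \<kappa>) (span \<sigma>)" if "\<sigma> \<in> cones G" for \<sigma>
    using span_vprod zero_mem c\<kappa> that by blast
  have "balanced_family G \<theta> (\<lambda>\<sigma> x. g (vprod \<kappa> \<sigma>) (vpair 0 x))"
  proof (rule balanced_slice[OF G g rational_fans(3) linear_vpair_right]; assumption?)
    fix \<sigma> assume s: "\<sigma> \<in> cones G" "\<theta> \<subseteq> \<sigma>"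
    have "vprod \<eta> \<theta> \<subseteq> vprod \<kappa> \<sigma>" using s(2) \<kappa>(2) unfolding vprod_def by blast
    then show "vprod \<kappa> \<sigma> \<in> cones P \<and> vprod \<eta> \<theta> \<subseteq> vprod \<kappa> \<sigma> \<and> (\<lambda>x. vpair 0 x) ` \<sigma> \<subseteq> vprod \<kappa> \<sigma> \<and>
         (\<lambda>x. vpair 0 x) ` lat_of (lat G) \<sigma> \<subseteq> lat_of (lat P) (vprod \<kappa> \<sigma>)"
      using 0 prod_cone[OF c\<kappa> s(1)] unfolding lat_of_P[OF c\<kappa> s(1)] by auto
  next
    fix \<sigma> \<sigma>' :: "vec set" assume "\<sigma> \<subseteq> \<sigma>'"
    then show "vprod \<kappa> \<sigma> \<subseteq> vprod \<kappa> \<sigma>'" unfolding vprod_def by blast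
  next
    show "inj_on (vprod \<kappa>) {\<sigma> \<in> cones G. \<theta> \<subseteq> \<sigma>}"
    proof (rule inj_onI)
      fix \<sigma> \<sigma>' assume "\<sigma> \<in> {\<sigma> \<in> cones G. \<theta> \<subseteq> \<sigma>}" "\<sigma>' \<in> {\<sigma> \<in> cones G. \<theta> \<subseteq> \<sigma>}" "vprod \<kappa> \<sigma> = vprod \<kappa> \<sigma>'"
      then show "\<sigma> = \<sigma>'" using subset_P[of \<kappa> \<sigma> \<kappa> \<sigma>'] subset_P[of \<kappa> \<sigma>' \<kappa> \<sigma>] c\<kappa> by auto
    qed
  next
    fix \<tau> assume "\<tau> \<in> ridges G"
    then show "vprod \<kappa> \<tau> \<in> ridges P"
      using \<kappa>(1) dim_P[of \<kappa> \<tau>] fan_dim_P prod_cone[of \<kappa> \<tau>] by (auto simp: ridges_def facets_def)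
  next
    fix \<tau> assume \<tau>: "\<tau> \<in> ridges G"
    show "{\<sigma>'. \<sigma>' \<in> facets P \<and> vprod \<kappa> \<tau> \<subseteq> \<sigma>'} = (vprod \<kappa>) ` {\<sigma>. \<sigma> \<in> facets G \<and> \<tau> \<subseteq> \<sigma>}"
    proof (intro equalityI subsetI)
      fix \<mu> assume \<mu>: "\<mu> \<in> {\<sigma>'. \<sigma>' \<in> facets P \<and> vprod \<kappa> \<tau> \<subseteq> \<sigma>'}"
      then have "\<mu> \<in> cones P" using facet_cone by blast
      then obtain \<kappa>' \<sigma> where h: "\<mu> = vprod \<kappa>' \<sigma>" "\<kappa>' \<in> cones F" "\<sigma> \<in> cones G" unfolding cones_P by blast
      have f: "\<kappa>' \<in> facets F" "\<sigma> \<in> facets G" using \<mu> facet_P[OF h(2,3)] h(1) by auto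
      have "\<kappa> \<subseteq> \<kappa>'" "\<tau> \<subseteq> \<sigma>" using \<mu> subset_P[OF c\<kappa> ridge_cone[OF \<tau>]] h(1) by auto
      moreover have "\<kappa>' = \<kappa>" using facet_dim_ge[OF rational_fans(1) h(2) \<kappa>(1)] \<open>\<kappa> \<subseteq> \<kappa>'\<close> by blast
      ultimately show "\<mu> \<in> (vprod \<kappa>) ` {\<sigma>. \<sigma> \<in> facets G \<and> \<tau> \<subseteq> \<sigma>}" using f h(1) by blast
    next
      fix \<mu> assume "\<mu> \<in> (vprod \<kappa>) ` {\<sigma>. \<sigma> \<in> facets G \<and> \<tau> \<subseteq> \<sigma>}"
      then obtain \<sigma> where \<sigma>: "\<mu> = vprod \<kappa> \<sigma>" "\<sigma> \<in> facets G" "\<tau> \<subseteq> \<sigma>" by blast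
      then show "\<mu> \<in> {\<sigma>'. \<sigma>' \<in> facets P \<and> vprod \<kappa> \<tau> \<subseteq> \<sigma>'}"
        using facet_P[OF c\<kappa> facet_cone[OF \<sigma>(2)]] \<kappa>(1) unfolding vprod_def by blast
    qed
  next
    fix \<tau> \<sigma> v assume h: "\<tau> \<in> ridges G" "\<sigma> \<in> facets G" "is_normal_vector (lat G) \<tau> \<sigma> v"
    note c = ridge_cone[OF h(1)] facet_cone[OF h(2)]
    show "is_normal_vector (lat P) (vprod \<kappa> \<tau>) (vprod \<kappa> \<sigma>) (vpair 0 v)"
      unfolding is_normal_vector_def lat_of_P[OF c\<kappa> c(1)] lat_of_P[OF c\<kappa> c(2)] sp[OF c(1)]
    proof (intro conjI ballI)
      show "vpair 0 v \<in> vprod (lat_of (lat F) \<kappa>) (lat_of (lat G) \<sigma>)"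
        using normal_vector_lat[OF h(3)] 0 by simp
      fix z assume "z \<in> vprod (lat_of (lat F) \<kappa>) (lat_of (lat G) \<sigma>)"
      then obtain y x where xy: "z = vpair y x" "x \<in> lat_of (lat G) \<sigma>" "y \<in> lat_of (lat F) \<kappa>" 
        unfolding vprod_def by blast
      then obtain k :: int where "x - of_int k *\<^sub>R v \<in> lat_of (lat G) \<tau>"
        using h(3) unfolding is_normal_vector_def by blast
      then show "\<exists>k::int. z - of_int k *\<^sub>R vpair 0 v \<in> vprod (lat_of (lat F) \<kappa>) (lat_of (lat G) \<tau>)"
        using xy by (intro exI[of _ k]) (simp add: vpair_scale vpair_diff)
    next
      obtain s where "s \<in> \<sigma>" "v - s \<in> span \<tau>" using h(3) unfolding is_normal_vector_def by blast
      then show "\<exists>s\<in>vprod \<kappa> \<sigma>. vpair 0 v - s \<in> vprod (span \<kappa>) (span \<tau>)"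
        using 0 by (intro bexI[of _ "vpair 0 s"]) (simp_all add: vpair_diff)
    qed
  qed
  then show ?thesis unfolding balanced_family_def
    using that local_faithfulD[OF lf] by (metis (no_types, lifting))
qed

text \<open>A point \<open>(x, y)\<close> splits as \<open>(x, 0) + (0, y)\<close>. The form on
  \<open>\<sigma> \<times> \<tau>\<close> may be evaluated at \<open>(x, 0)\<close> in the face
  \<open>\<sigma> \<times> \<theta>\<close>, and from there in
  \<open>\<sigma> \<times> \<kappa>\<close>; hence the value does not depend on
  \<open>\<tau>\<close>, and one fixed facet in each factor is enough.\<close>

lemma local_faithful_P:
  assumes \<eta>: "\<eta> \<in> cones F" "local_faithful F \<eta>" and \<theta>: "\<theta> \<in> cones G" "local_faithful G \<theta>"
  shows "local_faithful P (vprod \<eta> \<theta>)"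
proof (rule local_faithfulI)
  fix g assume g: "local_family P (vprod \<eta> \<theta>) g" 
    "\<And>\<tau>. \<tau> \<in> ridges P \<Longrightarrow> vprod \<eta> \<theta> \<subseteq> \<tau> \<Longrightarrow> balanced_at P \<tau> g"
  obtain \<kappa> where \<kappa>: "\<kappa> \<in> facets G" "\<theta> \<subseteq> \<kappa>" using cone_in_facet[OF G \<theta>(1)] by blast
  obtain \<psi> where \<psi>: "\<psi> \<in> facets F" "\<eta> \<subseteq> \<psi>" using cone_in_facet[OF F \<eta>(1)] by blast
  obtain L1 where L1: "linear L1" "\<And>\<sigma> x. \<sigma> \<in> cones F \<Longrightarrow> \<eta> \<subseteq> \<sigma> \<Longrightarrow> x \<in> span \<sigma> \<Longrightarrow> g (vprod \<sigma> \<kappa>) (vpair x 0) = L1 x"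
    using slice_left[OF \<eta>(1) \<kappa> \<eta>(2) g] by blast
  obtain L2 where L2: "linear L2" "\<And>\<tau> y. \<tau> \<in> cones G \<Longrightarrow> \<theta> \<subseteq> \<tau> \<Longrightarrow> y \<in> span \<tau> \<Longrightarrow> g (vprod \<psi> \<tau>) (vpair 0 y) = L2 y"
    using slice_right[OF \<theta>(1) \<psi> \<theta>(2) g] by blast
  define L where "L z = L1 (vfst z) + L2 (vsnd z)" for z
  have "linear L" unfolding L_def
    using linear_compose_add[OF linear_compose[OF linear_vfst L1(1)] linear_compose[OF linear_vsnd L2(1)]]
    by (simp add: o_def)
  moreover have "g \<mu> z = L z" if \<mu>: "\<mu> \<in> cones P" "vprod \<eta> \<theta> \<subseteq> \<mu>" "z \<in> \<mu>" for \<mu> z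
  proof -
    obtain \<sigma> \<tau> where st: "\<mu> = vprod \<sigma> \<tau>" "\<sigma> \<in> cones F" "\<tau> \<in> cones G" using \<mu>(1) unfolding cones_P by blast
    have sub: "\<eta> \<subseteq> \<sigma>" "\<theta> \<subseteq> \<tau>" using \<mu>(2) subset_P[OF \<eta>(1) \<theta>(1)] st(1) by auto
    obtain x y where xy: "z = vpair x y" "x \<in> \<sigma>" "y \<in> \<tau>" using \<mu>(3) st(1) by (auto simp: vprod_def)
    have z: "0 \<in> \<eta>" "0 \<in> \<theta>" using zero_mem \<eta> \<theta> by auto
    have compat: "g (vprod \<sigma>1 \<tau>1) w = g (vprod \<sigma>2 \<tau>2) w"
      if "\<sigma>1 \<in> cones F" "\<sigma>2 \<in> cones F" "\<tau>1 \<in> cones G" "\<tau>2 \<in> cones G" "\<eta> \<subseteq> \<sigma>1" "\<theta> \<subseteq> \<tau>1" 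
        "\<sigma>1 \<subseteq> \<sigma>2" "\<tau>1 \<subseteq> \<tau>2" "w \<in> vprod \<sigma>1 \<tau>1" for \<sigma>1 \<sigma>2 \<tau>1 \<tau>2 w
      using local_family_compat[OF g(1) prod_cone[OF that(1,3)] prod_cone[OF that(2,4)]] that subset_P \<eta>(1) \<theta>(1)
        span_base[OF that(9)] by simp
    have "g \<mu> (vpair x 0) = g (vprod \<sigma> \<theta>) (vpair x 0)"
      unfolding st(1) by (rule compat[symmetric]) (use st sub xy z \<theta> in auto)
    also have "\<dots> = g (vprod \<sigma> \<kappa>) (vpair x 0)"
      by (rule compat) (use st sub xy z \<theta> \<kappa> facet_cone in auto)
    also have "\<dots> = L1 x" using L1(2)[OF st(2) sub(1) span_base[OF xy(2)]] .
    finally have 1: "g \<mu> (vpair x 0) = L1 x" .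
    have "g \<mu> (vpair 0 y) = g (vprod \<eta> \<tau>) (vpair 0 y)"
      unfolding st(1) by (rule compat[symmetric]) (use st sub xy z \<eta> in auto)
    also have "\<dots> = g (vprod \<psi> \<tau>) (vpair 0 y)"
      by (rule compat) (use st sub xy z \<eta> \<psi> facet_cone in auto)
    also have "\<dots> = L2 y" using L2(2)[OF st(3) sub(2) span_base[OF xy(3)]] .
    finally have 2: "g \<mu> (vpair 0 y) = L2 y" .
    have "z = vpair x 0 + vpair 0 y" by (simp add: xy(1) vpair_add)
    then show ?thesis using 1 2 linear_add[OF local_family_linear[OF g(1) \<mu>(1,2)], of "vpair x 0" "vpair 0 y"] 
      by (simp add: L_def vpair_add)
  qed
  ultimately show "\<exists>L. linear L \<and> (\<forall>\<sigma>\<in>cones P. vprod \<eta> \<theta> \<subseteq> \<sigma> \<longrightarrow> (\<forall>x\<in>\<sigma>. g \<sigma> x = L x))" by blast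
qed

end

lemma div_faithful_prod:
  assumes "tropical_fan F" "tropical_fan G" "tropical_fan (fan_prod F G)" "div_faithful F" "div_faithful G"
  shows "div_faithful (fan_prod F G)"
proof -
  interpret fan_product F G "fan_prod F G" by unfold_locales (use assms in auto)
  have "local_faithful (fan_prod F G) \<mu>" if \<mu>: "\<mu> \<in> cones (fan_prod F G)" for \<mu>
  proof -
    obtain \<sigma> \<tau> where "\<mu> = vprod \<sigma> \<tau>" "\<sigma> \<in> cones F" "\<tau> \<in> cones G" using \<mu> unfolding cones_P by blast
    then show ?thesis using local_faithful_P assms(4,5) div_faithful_iff_local[OF F] div_faithful_iff_local[OF G] by simp
  qed
  then show ?thesis using div_faithful_iff_local[OF P] by blast
qed

section \<open>Tropical modifications\<close>

lemma line_vec_add: "line_vec (s + t) = line_vec s + line_vec t"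
  by (simp add: line_vec_def single_add)

lemma line_vec_scale: "line_vec (c * t) = c *\<^sub>R line_vec t"
  by (rule poly_mapping_eqI) (simp add: line_vec_def lookup_scaleR_vec lookup_single when_def)

lemma line_vec_diff: "line_vec (s - t) = line_vec s - line_vec t"
  by (simp add: line_vec_def single_diff)

lemma line_vec_0: "line_vec 0 = 0"
  by (simp add: line_vec_def)

lemma line_vec_inject: "line_vec s = line_vec t \<longleftrightarrow> s = t"
proof
  assume "line_vec s = line_vec t"
  then have "Poly_Mapping.lookup (line_vec s) 0 = Poly_Mapping.lookup (line_vec t) 0" by simp
  then show "s = t" by (simp add: line_vec_def)
qed simp

definition vline :: "vec \<Rightarrow> real \<Rightarrow> vec" where
  "vline x t = vpair x (line_vec t)"

lemma vline_inject: "vline x s = vline y t \<longleftrightarrow> x = y \<and> s = t"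
  by (simp add: vline_def vpair_inject line_vec_inject)

lemma vline_add: "vline x s + vline y t = vline (x + y) (s + t)"
  by (simp add: vline_def vpair_add line_vec_add)

lemma vline_diff: "vline x s - vline y t = vline (x - y) (s - t)"
  by (simp add: vline_def vpair_diff line_vec_diff)

lemma vline_scale: "c *\<^sub>R vline x s = vline (c *\<^sub>R x) (c * s)"
  by (simp add: vline_def vpair_scale line_vec_scale)

lemma vline_0: "vline 0 0 = 0"
  by (simp add: vline_def line_vec_0 vpair_0)

lemma vline_sum: "(\<Sum>i\<in>I. vline (x i) (t i)) = vline (\<Sum>i\<in>I. x i) (\<Sum>i\<in>I. t i)"
  by (induction I rule: infinite_finite_induct) (simp_all add: vline_0 vline_add)

lemma vfst_vline [simp]: "vfst (vline x t) = x"
  by (simp add: vline_def)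

lemma lookup_vsnd_vline [simp]: "Poly_Mapping.lookup (vsnd (vline x t)) 0 = t"
  by (simp add: vline_def line_vec_def)

text \<open>\<open>D\<close> is not assumed to be a fan, and \<open>ord\<close> only restricts the
  non-zero weights; so a reduced divisor and a trivial one, for which \<open>D\<close> has no cones,
  are treated together.\<close>

locale trop_modification =
  fixes F :: fan and f :: "vec \<Rightarrow> real" and T D :: fan
  assumes F: "tropical_fan F" and f: "conewise_integral_linear F f" 
    and T: "tropical_fan T" and T_def: "T = trop_mod F f" and D_def: "D = div_fan F f"
    and ord: "\<And>\<tau>. \<tau> \<in> ridges F \<Longrightarrow> ord_at F f \<tau> \<noteq> 0 \<Longrightarrow> ord_at F f \<tau> = 1"
begin

lemma rF: "rational_fan F" and rT: "rational_fan T"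
  using F T tropical_rational by blast+

abbreviation "c \<equiv> cone_form f"

definition graph :: "vec set \<Rightarrow> vec set" where
  "graph \<sigma> = (\<lambda>x. vline x (f x)) ` \<sigma>"

definition lifted :: "vec set \<Rightarrow> vec set" where
  "lifted \<delta> = {vline x (f x + t) | x t. x \<in> \<delta> \<and> t \<ge> 0}"

definition e where "e = vline 0 1"

lemma c_linear: "\<sigma> \<in> cones F \<Longrightarrow> linear (c \<sigma>)"
  using conewise_form(1)[OF f] by blast

lemma c_eq: "\<sigma> \<in> cones F \<Longrightarrow> x \<in> \<sigma> \<Longrightarrow> c \<sigma> x = f x"
  using conewise_form(2)[OF f] by blast

lemma c_int: "\<sigma> \<in> cones F \<Longrightarrow> x \<in> lat_of (lat F) \<sigma> \<Longrightarrow> c \<sigma> x \<in> \<int>"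
  using conewise_form(3)[OF f] by blast

lemma c_compat:
  assumes "\<sigma> \<in> cones F" "\<sigma>' \<in> cones F" "\<sigma> \<subseteq> \<sigma>'" "x \<in> span \<sigma>"
  shows "c \<sigma> x = c \<sigma>' x"
proof (rule linear_eq_on[OF c_linear[OF assms(1)] c_linear[OF assms(2)] assms(4)])
  show "c \<sigma> b = c \<sigma>' b" if "b \<in> \<sigma>" for b
    using c_eq[OF assms(1) that] c_eq[OF assms(2), of b] assms(3) that by auto
qed

lemma f_zero:
  assumes "\<sigma> \<in> cones F"
  shows "f 0 = 0"
  using c_eq[OF assms fan_cone(4)[OF rF assms]] linear_0[OF c_linear[OF assms]] by simp

lemma cones_D: "cones D = {\<delta>. \<exists>\<tau>\<in>ridges F. ord_at F f \<tau> = 1 \<and> cone_face \<delta> \<tau>}" and lat_D: "lat D = lat F"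
  by (simp_all add: D_def div_fan_def)

lemma D_cones_F: "\<delta> \<in> cones D \<Longrightarrow> \<delta> \<in> cones F"
  using rF ridge_cone unfolding cones_D rational_fan_def by blast

lemma D_face:
  assumes "\<delta> \<in> cones D" "\<eta> \<in> cones F" "\<eta> \<subseteq> \<delta>"
  shows "\<eta> \<in> cones D"
proof -
  obtain \<tau> where \<tau>: "\<tau> \<in> ridges F" "ord_at F f \<tau> = 1" "cone_face \<delta> \<tau>" using assms(1) unfolding cones_D by blast
  have "\<delta> \<subseteq> \<tau>" using \<tau>(3) face_of_imp_subset unfolding cone_face_def by blast
  then have "\<eta> \<inter> \<tau> = \<eta>" using assms(3) by blast
  then have "cone_face \<eta> \<tau>" using rF assms(2) ridge_cone[OF \<tau>(1)] unfolding rational_fan_def by metis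
  then show ?thesis using \<tau> unfolding cones_D by blast
qed

lemma D_dim:
  assumes "\<delta> \<in> cones D"
  obtains \<tau> where "\<tau> \<in> ridges F" "ord_at F f \<tau> = 1" "\<delta> \<subseteq> \<tau>" "dim \<delta> + 1 \<le> fan_dim F"
proof -
  obtain \<tau> where \<tau>: "\<tau> \<in> ridges F" "ord_at F f \<tau> = 1" "cone_face \<delta> \<tau>" using assms(1) unfolding cones_D by blast
  have s: "\<delta> \<subseteq> \<tau>" using \<tau>(3) face_of_imp_subset unfolding cone_face_def by blast
  have "dim \<delta> \<le> dim \<tau>" using fan_dim_mono(1)[OF rF ridge_cone[OF \<tau>(1)] s] .
  then have "dim \<delta> + 1 \<le> fan_dim F" using \<tau>(1) by (simp add: ridges_def)
  then show ?thesis using that \<tau> s by blast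
qed

text \<open>The cones of \<open>D\<close> are the faces of ridges of weight one, and a ridge
  contained in another ridge equals it by dimension.\<close>

lemma ridge_D_iff:
  assumes "\<tau> \<in> ridges F"
  shows "\<tau> \<in> cones D \<longleftrightarrow> ord_at F f \<tau> = 1"
proof
  assume "\<tau> \<in> cones D"
  then obtain \<tau>' where \<tau>': "\<tau>' \<in> ridges F" "ord_at F f \<tau>' = 1" "\<tau> \<subseteq> \<tau>'" using D_dim by metis
  have "dim \<tau>' \<le> dim \<tau>" using assms \<tau>'(1) by (simp add: ridges_def)
  then have "\<tau> = \<tau>'" using fan_dim_eq[OF rF ridge_cone[OF assms] ridge_cone[OF \<tau>'(1)] \<tau>'(3)] by blast
  then show "ord_at F f \<tau> = 1" using \<tau>' by simp
next
  assume "ord_at F f \<tau> = 1"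
  moreover have "cone_face (\<tau> \<inter> \<tau>) \<tau>" using rF ridge_cone[OF assms] unfolding rational_fan_def by blast
  ultimately show "\<tau> \<in> cones D" using assms unfolding cones_D by auto
qed

lemma cones_T: "cones T = graph ` cones F \<union> lifted ` cones D"
proof -
  have g: "{vpair x (line_vec (f x)) | x. x \<in> \<sigma>} = graph \<sigma>" for \<sigma>
    unfolding graph_def vline_def by blast
  have l: "{vpair x (line_vec (f x + t)) | x t. x \<in> \<delta> \<and> t \<ge> 0} = lifted \<delta>" for \<delta>
    unfolding lifted_def vline_def by blast
  have "cones T = {graph \<sigma> | \<sigma>. \<sigma> \<in> cones F} \<union> {lifted \<delta> | \<delta>. \<delta> \<in> cones D}"
    unfolding T_def trop_mod_def fan.sel g l D_def ..
  then show ?thesis by blast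
qed

lemma lat_T: "lat T = {vline x (of_int k) | x k. x \<in> lat F}"
  by (simp add: T_def trop_mod_def vline_def)

lemma graph_form: "\<sigma> \<in> cones F \<Longrightarrow> graph \<sigma> = (\<lambda>x. vline x (c \<sigma> x)) ` \<sigma>"
  unfolding graph_def using c_eq by (intro image_cong) auto

lemma linear_vline_form: "linear l \<Longrightarrow> linear (\<lambda>x. vline x (l x))"
  by (rule linearI) (simp_all add: vline_add vline_scale linear_add linear_scale)

lemma span_graph: "\<sigma> \<in> cones F \<Longrightarrow> span (graph \<sigma>) = (\<lambda>x. vline x (c \<sigma> x)) ` span \<sigma>"
  using linear_span_image[OF linear_vline_form[OF c_linear]] graph_form by simp

lemma graph_subset_lifted: "graph \<delta> \<subseteq> lifted \<delta>"
  unfolding graph_def lifted_def by force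

lemma e_lifted: "\<delta> \<in> cones D \<Longrightarrow> e \<in> lifted \<delta>"
  unfolding lifted_def e_def mem_Collect_eq using fan_cone(4)[OF rF D_cones_F] f_zero[OF D_cones_F] 
  by (intro exI[of _ "0 :: vec"] exI[of _ "1 :: real"]) simp

lemma span_lifted:
  assumes "\<delta> \<in> cones D"
  shows "span (lifted \<delta>) = {vline x t | x t. x \<in> span \<delta>}"
proof
  have "subspace {vline x t | x t. x \<in> span \<delta>}"
  proof (rule real_vector.subspaceI)
    show "0 \<in> {vline x t | x t. x \<in> span \<delta>}" using vline_0 span_zero by (auto intro!: exI[of _ 0])
    show "x + y \<in> {vline x t | x t. x \<in> span \<delta>}" 
      if "x \<in> {vline x t | x t. x \<in> span \<delta>}" "y \<in> {vline x t | x t. x \<in> span \<delta>}" for x y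
      using that span_add by (auto simp: vline_add vline_inject)
    show "a *\<^sub>R x \<in> {vline x t | x t. x \<in> span \<delta>}" if "x \<in> {vline x t | x t. x \<in> span \<delta>}" for a x
      using that span_scale by (auto simp: vline_scale vline_inject)
  qed
  moreover have "lifted \<delta> \<subseteq> {vline x t | x t. x \<in> span \<delta>}"
    unfolding lifted_def using span_base by blast
  ultimately show "span (lifted \<delta>) \<subseteq> {vline x t | x t. x \<in> span \<delta>}" by (rule_tac span_minimal)
  show "{vline x t | x t. x \<in> span \<delta>} \<subseteq> span (lifted \<delta>)"
  proof
    fix z assume "z \<in> {vline x t | x t. x \<in> span \<delta>}"
    then obtain x t where z: "z = vline x t" "x \<in> span \<delta>" by blast
    have "vline x (c \<delta> x) \<in> span (graph \<delta>)" unfolding span_graph[OF D_cones_F[OF assms]] using z(2) by blast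
    then have "vline x (c \<delta> x) \<in> span (lifted \<delta>)" using span_mono[OF graph_subset_lifted] by blast
    moreover have "(t - c \<delta> x) *\<^sub>R e \<in> span (lifted \<delta>)"
      using e_lifted[OF assms] span_scale span_base by blast
    ultimately have "vline x (c \<delta> x) + (t - c \<delta> x) *\<^sub>R e \<in> span (lifted \<delta>)" by (rule span_add)
    then show "z \<in> span (lifted \<delta>)" by (simp add: z(1) e_def vline_scale vline_add)
  qed
qed

lemma lat_graph:
  assumes "\<sigma> \<in> cones F"
  shows "lat_of (lat T) (graph \<sigma>) = (\<lambda>x. vline x (c \<sigma> x)) ` lat_of (lat F) \<sigma>"
proof (intro equalityI subsetI)
  fix z assume "z \<in> lat_of (lat T) (graph \<sigma>)"
  then show "z \<in> (\<lambda>x. vline x (c \<sigma> x)) ` lat_of (lat F) \<sigma>"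
    unfolding lat_of_def lat_T span_graph[OF assms] by (auto simp: vline_inject)
next
  fix z assume "z \<in> (\<lambda>x. vline x (c \<sigma> x)) ` lat_of (lat F) \<sigma>"
  then obtain x where x: "z = vline x (c \<sigma> x)" "x \<in> lat_of (lat F) \<sigma>" by blast
  obtain k :: int where "c \<sigma> x = of_int k" using c_int[OF assms x(2)] by (auto elim: Ints_cases)
  then have "z \<in> lat T" using x unfolding lat_T by (auto simp: lat_of_def)
  then show "z \<in> lat_of (lat T) (graph \<sigma>)"
    using x unfolding lat_of_def span_graph[OF assms] by blast
qed

lemma lat_lifted:
  assumes "\<delta> \<in> cones D"
  shows "lat_of (lat T) (lifted \<delta>) = {vline x (of_int k) | x k. x \<in> lat_of (lat F) \<delta>}"
  unfolding lat_of_def lat_T span_lifted[OF assms] by (auto simp: vline_inject)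

lemma vfst_graph: "vfst ` graph \<sigma> = \<sigma>"
  unfolding graph_def by force

lemma vfst_lifted: "vfst ` lifted \<delta> = \<delta>"
  unfolding lifted_def by force

lemma graph_T: "\<sigma> \<in> cones F \<Longrightarrow> graph \<sigma> \<in> cones T" and lifted_T: "\<delta> \<in> cones D \<Longrightarrow> lifted \<delta> \<in> cones T"
  unfolding cones_T by auto

lemma dim_graph:
  assumes "\<sigma> \<in> cones F"
  shows "dim (graph \<sigma>) = dim \<sigma>"
proof -
  obtain V where V: "finite V" "graph \<sigma> \<subseteq> span V" by (rule cone_span_finite[OF fan_cone(1)[OF rT graph_T[OF assms]]])
  have "{z \<in> span (graph \<sigma>). vfst z = 0} = {0}"
    unfolding span_graph[OF assms] using span_zero[of \<sigma>] 
    by (auto simp: linear_0[OF c_linear[OF assms]] vline_0 linear_0[OF linear_vfst] intro!: image_eqI[of _ _ 0])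
  then show ?thesis using dim_kernel_image[OF linear_vfst V(2,1)] by (simp add: vfst_graph dim_singleton_0)
qed

lemma kernel_lifted:
  assumes "\<delta> \<in> cones D"
  shows "{z \<in> span (lifted \<delta>). vfst z = 0} = {vline 0 t | t. True}"
  unfolding span_lifted[OF assms] using span_zero[of \<delta>] by auto

lemma dim_line: "dim {vline 0 t | t. True} = 1"
proof -
  have "{vline 0 t | t. True} = span {e}"
  proof (intro equalityI subsetI)
    fix z assume "z \<in> {vline 0 t | t. True}"
    then obtain t where "z = vline 0 t" by blast
    then have "z = t *\<^sub>R e" by (simp add: e_def vline_scale)
    then show "z \<in> span {e}" using span_scale[OF span_base] by blast
  next
    fix z assume "z \<in> span {e}"
    then obtain k where "z = k *\<^sub>R e" using span_singleton by blast
    then show "z \<in> {vline 0 t | t. True}" by (auto simp: e_def vline_scale)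
  qed
  moreover have "independent {e}"
    using vline_inject[of 0 1 0 0] by (simp add: e_def vline_0 real_vector.dependent_single)
  ultimately show ?thesis using real_vector.dim_span_eq_card_independent[of "{e}"] by simp
qed

lemma dim_lifted:
  assumes "\<delta> \<in> cones D"
  shows "dim (lifted \<delta>) = dim \<delta> + 1"
proof -
  obtain V where V: "finite V" "lifted \<delta> \<subseteq> span V" by (rule cone_span_finite[OF fan_cone(1)[OF rT lifted_T[OF assms]]])
  show ?thesis using dim_kernel_image[OF linear_vfst V(2,1)] unfolding vfst_lifted kernel_lifted[OF assms] dim_line .
qed

lemma fan_dim_T: "fan_dim T = fan_dim F"
proof -
  obtain \<sigma> where \<sigma>: "\<sigma> \<in> facets F" using tropical_facet_exists[OF F] by blast
  show ?thesis
  proof (rule fan_dimI[OF fan_finite[OF rT] graph_T[OF facet_cone[OF \<sigma>]]])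
    show "dim (graph \<sigma>) = fan_dim F" using dim_graph[OF facet_cone[OF \<sigma>]] \<sigma> by (simp add: facets_def)
    fix \<mu> assume "\<mu> \<in> cones T"
    then consider \<sigma>' where "\<sigma>' \<in> cones F" "\<mu> = graph \<sigma>'" | \<delta> where "\<delta> \<in> cones D" "\<mu> = lifted \<delta>"
      unfolding cones_T by blast
    then show "dim \<mu> \<le> fan_dim F"
    proof cases
      case 1
      then show ?thesis using dim_graph fan_dim_ge[OF rF] by simp
    next
      case 2
      then show ?thesis using dim_lifted D_dim by metis
    qed
  qed
qed

lemma graph_subset_iff: "graph \<eta> \<subseteq> graph \<sigma> \<longleftrightarrow> \<eta> \<subseteq> \<sigma>"
  unfolding graph_def by (auto simp: vline_inject)

lemma graph_subset_lifted_iff: "graph \<eta> \<subseteq> lifted \<delta> \<longleftrightarrow> \<eta> \<subseteq> \<delta>"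
proof
  assume "graph \<eta> \<subseteq> lifted \<delta>"
  then show "\<eta> \<subseteq> \<delta>" using image_mono[of "graph \<eta>" "lifted \<delta>" vfst] by (simp add: vfst_graph vfst_lifted)
next
  assume "\<eta> \<subseteq> \<delta>"
  then show "graph \<eta> \<subseteq> lifted \<delta>" using graph_subset_lifted graph_subset_iff by blast
qed

lemma lifted_subset_iff: "lifted \<eta> \<subseteq> lifted \<delta> \<longleftrightarrow> \<eta> \<subseteq> \<delta>"
proof
  assume "lifted \<eta> \<subseteq> lifted \<delta>"
  then show "\<eta> \<subseteq> \<delta>" using image_mono[of "lifted \<eta>" "lifted \<delta>" vfst] by (simp add: vfst_lifted)
next
  assume "\<eta> \<subseteq> \<delta>"
  then show "lifted \<eta> \<subseteq> lifted \<delta>" unfolding lifted_def by blast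
qed

lemma not_lifted_subset_graph:
  assumes "\<eta> \<in> cones D" "\<sigma> \<in> cones F"
  shows "\<not> lifted \<eta> \<subseteq> graph \<sigma>"
proof
  assume "lifted \<eta> \<subseteq> graph \<sigma>"
  then have "e \<in> graph \<sigma>" using e_lifted[OF assms(1)] by blast
  then have "f 0 = 1" unfolding graph_def e_def by (auto simp: vline_inject)
  then show False using f_zero[OF assms(2)] by simp
qed

text \<open>A graph does not contain the vertical vector \<open>e\<close>, so the cones containing
  \<open>lifted \<eta>\<close> are the vertical ones over cones of \<open>D\<close> containing
  \<open>\<eta>\<close>. Projection to the base kills just the vertical line, which lies in the span
  of \<open>lifted \<eta>\<close>; this matches the dimension drop of one from \<open>F\<close> to
  \<open>D\<close>.\<close>

lemma local_faithful_lifted: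
  assumes \<eta>: "\<eta> \<in> cones D" and lf: "local_faithful D \<eta>"
  shows "local_faithful T (lifted \<eta>)"
proof -
  have sts: "{\<mu> \<in> cones T. lifted \<eta> \<subseteq> \<mu>} = lifted ` {\<delta> \<in> cones D. \<eta> \<subseteq> \<delta>}"
    unfolding cones_T using not_lifted_subset_graph[OF \<eta>] lifted_subset_iff by blast
  obtain \<tau> where \<tau>: "\<tau> \<in> ridges F" "ord_at F f \<tau> = 1" "\<eta> \<subseteq> \<tau>" using D_dim[OF \<eta>] by blast
  have \<tau>D: "\<tau> \<in> cones D" using ridge_D_iff[OF \<tau>(1)] \<tau>(2) by blast
  have fd: "fan_dim D + 1 = fan_dim F"
  proof -
    have "fan_dim D = dim \<tau>"
    proof (rule fan_dimI[OF _ \<tau>D refl])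
      show "finite (cones D)" using D_cones_F by (intro finite_subset[OF _ fan_finite[OF rF]]) blast
      fix \<delta> assume "\<delta> \<in> cones D"
      then have "dim \<delta> + 1 \<le> fan_dim F" using D_dim by metis
      then show "dim \<delta> \<le> dim \<tau>" using \<tau>(1) by (simp add: ridges_def)
    qed
    then show ?thesis using \<tau>(1) by (simp add: ridges_def)
  qed
  have "fan_projection T D (lifted \<eta>) \<eta> vfst" unfolding fan_projection_def
  proof (intro conjI allI impI)
    show "tropical_fan T" "lifted \<eta> \<in> cones T" "linear vfst" by (fact T lifted_T[OF \<eta>] linear_vfst)+
    show "{\<sigma> \<in> cones D. \<eta> \<subseteq> \<sigma>} = (`) vfst ` {\<sigma> \<in> cones T. lifted \<eta> \<subseteq> \<sigma>}"
      unfolding sts image_image vfst_lifted by simp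
    show "x \<in> span (lifted \<eta>)" if x: "x \<in> span (\<Union> {\<sigma> \<in> cones T. lifted \<eta> \<subseteq> \<sigma>})" "vfst x = 0" for x
    proof -
      have "subspace {vline y t | y t. True}"
        by (rule real_vector.subspaceI) (use vline_0 in \<open>force simp: vline_add vline_scale\<close>)+
      moreover have "lifted \<delta> \<subseteq> {vline y t | y t. True}" for \<delta>
        unfolding lifted_def by blast
      then have "\<Union> {\<sigma> \<in> cones T. lifted \<eta> \<subseteq> \<sigma>} \<subseteq> {vline y t | y t. True}"
        unfolding sts by (intro Union_least) (elim imageE, simp)
      ultimately have "span (\<Union> {\<sigma> \<in> cones T. lifted \<eta> \<subseteq> \<sigma>}) \<subseteq> {vline y t | y t. True}"
        by (rule_tac span_minimal)
      then obtain y t where "x = vline y t" using x(1) by blast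
      then show ?thesis using x(2) unfolding span_lifted[OF \<eta>] using span_zero by auto
    qed
    show "fan_dim D + dim {x \<in> span (lifted \<eta>). vfst x = 0} = fan_dim T"
      unfolding kernel_lifted[OF \<eta>] dim_line fan_dim_T by (rule fd)
    fix \<mu> assume \<mu>: "\<mu> \<in> cones T" "lifted \<eta> \<subseteq> \<mu>"
    then obtain \<delta> where \<delta>: "\<delta> \<in> cones D" "\<mu> = lifted \<delta>" using sts by blast
    show "vfst ` lat_of (lat T) \<mu> = lat_of (lat D) (vfst ` \<mu>)"
      unfolding \<delta>(2) vfst_lifted lat_lifted[OF \<delta>(1)] lat_D by force
  qed
  then show ?thesis using lf by (rule fan_projection.local_faithful_preimage)
qed

text \<open>Besides the graphs of the facets around \<open>\<tau>\<close>, exactly the ridges of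
  weight one acquire a further facet, the vertical one.\<close>

lemma facets_T_over_ridge:
  assumes \<tau>: "\<tau> \<in> ridges F"
  shows "{\<mu>. \<mu> \<in> facets T \<and> graph \<tau> \<subseteq> \<mu>} = 
    graph ` {\<sigma>. \<sigma> \<in> facets F \<and> \<tau> \<subseteq> \<sigma>} \<union> (if ord_at F f \<tau> = 1 then {lifted \<tau>} else {})"
proof (intro equalityI subsetI)
  fix \<mu> assume \<mu>: "\<mu> \<in> {\<mu>. \<mu> \<in> facets T \<and> graph \<tau> \<subseteq> \<mu>}"
  then have d: "dim \<mu> = fan_dim F" by (simp add: facets_def fan_dim_T)
  have "\<mu> \<in> cones T" using \<mu> facet_cone by blast
  then consider \<sigma> where "\<sigma> \<in> cones F" "\<mu> = graph \<sigma>" | \<delta> where "\<delta> \<in> cones D" "\<mu> = lifted \<delta>"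
    unfolding cones_T by blast
  then show "\<mu> \<in> graph ` {\<sigma>. \<sigma> \<in> facets F \<and> \<tau> \<subseteq> \<sigma>} \<union> (if ord_at F f \<tau> = 1 then {lifted \<tau>} else {})"
  proof cases
    case 1
    then show ?thesis using d \<mu> graph_subset_iff dim_graph by (auto simp: facets_def)
  next
    case 2
    then have "\<tau> \<subseteq> \<delta>" using \<mu> graph_subset_lifted_iff by blast
    moreover have "dim \<delta> \<le> dim \<tau>" using d 2 dim_lifted \<tau> by (simp add: ridges_def)
    ultimately have "\<tau> = \<delta>" using fan_dim_eq[OF rF ridge_cone[OF \<tau>] D_cones_F[OF 2(1)]] by blast
    then show ?thesis using 2 ridge_D_iff[OF \<tau>] by simp
  qed
next
  fix \<mu> assume \<mu>: "\<mu> \<in> graph ` {\<sigma>. \<sigma> \<in> facets F \<and> \<tau> \<subseteq> \<sigma>} \<union> (if ord_at F f \<tau> = 1 then {lifted \<tau>} else {})"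
  show "\<mu> \<in> {\<mu>. \<mu> \<in> facets T \<and> graph \<tau> \<subseteq> \<mu>}"
  proof (cases "\<mu> \<in> graph ` {\<sigma>. \<sigma> \<in> facets F \<and> \<tau> \<subseteq> \<sigma>}")
    case True
    then obtain \<sigma> where \<sigma>: "\<sigma> \<in> facets F" "\<tau> \<subseteq> \<sigma>" "\<mu> = graph \<sigma>" by blast
    then show ?thesis using graph_T[OF facet_cone[OF \<sigma>(1)]] dim_graph[OF facet_cone[OF \<sigma>(1)]] fan_dim_T graph_subset_iff 
      by (simp add: facets_def)
  next
    case False
    then have "ord_at F f \<tau> = 1" "\<mu> = lifted \<tau>" using \<mu> by (auto split: if_splits)
    moreover have "\<tau> \<in> cones D" using calculation(1) ridge_D_iff[OF \<tau>] by blast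
    ultimately show ?thesis using lifted_T dim_lifted \<tau> fan_dim_T graph_subset_lifted 
      by (simp add: facets_def ridges_def)
  qed
qed

lemma normal_graph:
  assumes "\<tau> \<in> cones F" "\<sigma> \<in> cones F" "\<tau> \<subseteq> \<sigma>" "is_normal_vector (lat F) \<tau> \<sigma> v"
  shows "is_normal_vector (lat T) (graph \<tau>) (graph \<sigma>) (vline v (c \<sigma> v))"
  unfolding is_normal_vector_def lat_graph[OF assms(1)] lat_graph[OF assms(2)] span_graph[OF assms(1)]
proof (intro conjI ballI)
  have lin: "c \<sigma> (x - a *\<^sub>R y) = c \<sigma> x - a * c \<sigma> y" for x y a
    using c_linear[OF assms(2)] by (simp add: linear_diff linear_scale)
  show "vline v (c \<sigma> v) \<in> (\<lambda>x. vline x (c \<sigma> x)) ` lat_of (lat F) \<sigma>"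
    using normal_vector_lat[OF assms(4)] by blast
  fix z assume "z \<in> (\<lambda>x. vline x (c \<sigma> x)) ` lat_of (lat F) \<sigma>"
  then obtain x where x: "z = vline x (c \<sigma> x)" "x \<in> lat_of (lat F) \<sigma>" by blast
  then obtain k :: int where k: "x - of_int k *\<^sub>R v \<in> lat_of (lat F) \<tau>"
    using assms(4) unfolding is_normal_vector_def by blast
  have "z - of_int k *\<^sub>R vline v (c \<sigma> v) = vline (x - of_int k *\<^sub>R v) (c \<tau> (x - of_int k *\<^sub>R v))"
    using c_compat[OF assms(1-3), of "x - of_int k *\<^sub>R v"] k 
    by (simp add: x(1) vline_scale vline_diff lin lat_of_def)
  then show "\<exists>k::int. z - of_int k *\<^sub>R vline v (c \<sigma> v) \<in> (\<lambda>x. vline x (c \<tau> x)) ` lat_of (lat F) \<tau>"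
    using k by blast
next
  have lin: "c \<sigma> (x - y) = c \<sigma> x - c \<sigma> y" for x y
    using c_linear[OF assms(2)] by (simp add: linear_diff)
  obtain s where s: "s \<in> \<sigma>" "v - s \<in> span \<tau>" using assms(4) unfolding is_normal_vector_def by blast
  have "vline v (c \<sigma> v) - vline s (c \<sigma> s) = vline (v - s) (c \<tau> (v - s))"
    using c_compat[OF assms(1-3) s(2)] by (simp add: vline_diff lin)
  then show "\<exists>s\<in>graph \<sigma>. vline v (c \<sigma> v) - s \<in> (\<lambda>x. vline x (c \<tau> x)) ` span \<tau>"
    using s graph_form[OF assms(2)] by (intro bexI[of _ "vline s (c \<sigma> s)"]) auto
qed

text \<open>A lattice point of the vertical cone lies above a lattice point \<open>x\<close> at
  integral height, and \<open>c \<tau> x\<close> is an integer; so it differs from the graph by an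
  integral multiple of \<open>e\<close>.\<close>

lemma normal_lifted:
  assumes "\<tau> \<in> cones D"
  shows "is_normal_vector (lat T) (graph \<tau>) (lifted \<tau>) e"
  unfolding is_normal_vector_def lat_graph[OF D_cones_F[OF assms]] lat_lifted[OF assms] 
proof (intro conjI ballI)
  have "0 \<in> lat_of (lat F) \<tau>" using lat_of_closed(1)[OF fan_lattice[OF rF]] .
  moreover have "e = vline 0 (of_int 1)" by (simp add: e_def)
  ultimately show "e \<in> {vline x (of_int k) | x k. x \<in> lat_of (lat F) \<tau>}" by blast
  fix z assume "z \<in> {vline x (of_int k) | x k. x \<in> lat_of (lat F) \<tau>}"
  then obtain x and k :: int where x: "z = vline x (of_int k)" "x \<in> lat_of (lat F) \<tau>" by blast
  obtain j :: int where j: "c \<tau> x = of_int j" using c_int[OF D_cones_F[OF assms] x(2)] by (auto elim: Ints_cases)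
  have "z - of_int (k - j) *\<^sub>R e = vline x (c \<tau> x)" by (simp add: x(1) e_def vline_scale vline_diff j)
  then show "\<exists>k::int. z - of_int k *\<^sub>R e \<in> (\<lambda>x. vline x (c \<tau> x)) ` lat_of (lat F) \<tau>" using x(2) by blast
next
  show "\<exists>s\<in>lifted \<tau>. e - s \<in> span (graph \<tau>)"
    using e_lifted[OF assms] span_zero by (intro bexI[of _ e]) auto
qed

text \<open>
  After subtraction of the multiple of the last coordinate that has the same value at \<open>e\<close>, a balanced
  family at \<open>graph \<eta>\<close> no longer depends on the last coordinate and descends to \<open>F\<close>.
\<close>

lemma local_faithful_graph:
  assumes \<eta>: "\<eta> \<in> cones F" and lf: "local_faithful F \<eta>"
  shows "local_faithful T (graph \<eta>)"
proof (rule local_faithfulI)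
  fix g assume g: "local_family T (graph \<eta>) g" 
    and gb: "\<And>\<mu>. \<mu> \<in> ridges T \<Longrightarrow> graph \<eta> \<subseteq> \<mu> \<Longrightarrow> balanced_at T \<mu> g"
  define b where "b = (if \<eta> \<in> cones D then g (lifted \<eta>) e else 0)"
  have be: "g (lifted \<delta>) e = b" if \<delta>: "\<delta> \<in> cones D" "\<eta> \<subseteq> \<delta>" for \<delta>
  proof -
    have \<eta>D: "\<eta> \<in> cones D" using D_face \<delta> \<eta> by blast
    have "g (lifted \<eta>) e = g (lifted \<delta>) e"
      using local_family_compat[OF g lifted_T[OF \<eta>D] lifted_T[OF \<delta>(1)] graph_subset_lifted]
        \<delta>(2) lifted_subset_iff span_base[OF e_lifted[OF \<eta>D]] by blast
    then show ?thesis using \<eta>D by (simp add: b_def)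
  qed
  have brat: "b \<in> \<rat>"
  proof (cases "\<eta> \<in> cones D")
    case True
    then show ?thesis
      using local_family_rational[OF g lifted_T graph_subset_lifted normal_vector_lat[OF normal_lifted]]
      by (simp add: b_def)
  qed (simp add: b_def)
  define a where "a \<sigma> x = g (graph \<sigma>) (vline x (c \<sigma> x)) + (- b) * c \<sigma> x" for \<sigma> x
  have gl: "linear (g (graph \<sigma>))" if "\<sigma> \<in> cones F" "\<eta> \<subseteq> \<sigma>" for \<sigma>
    using local_family_linear[OF g graph_T[OF that(1)]] that(2) graph_subset_iff by blast
  have a: "local_family F \<eta> a" unfolding local_family_def
  proof (intro conjI ballI impI)
    fix \<sigma> assume s: "\<sigma> \<in> cones F" "\<eta> \<subseteq> \<sigma>"
    have "linear (\<lambda>x. g (graph \<sigma>) (vline x (c \<sigma> x)))"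
      using linear_compose[OF linear_vline_form[OF c_linear[OF s(1)]] gl[OF s]] by (simp add: o_def)
    moreover have "linear (\<lambda>x. (- b) * c \<sigma> x)"
      using c_linear[OF s(1)] by (intro linearI) (simp_all add: linear_add linear_scale algebra_simps)
    ultimately show "linear (a \<sigma>)" unfolding a_def by (rule linear_compose_add)
    show "a \<sigma> x \<in> \<rat>" if x: "x \<in> lat_of (lat F) \<sigma>" for x
    proof -
      have "vline x (c \<sigma> x) \<in> lat_of (lat T) (graph \<sigma>)" unfolding lat_graph[OF s(1)] using x by blast
      then have "g (graph \<sigma>) (vline x (c \<sigma> x)) \<in> \<rat>"
        using local_family_rational[OF g graph_T[OF s(1)]] s(2) graph_subset_iff by blast
      moreover have "c \<sigma> x \<in> \<rat>" using c_int[OF s(1) x] Ints_subset_Rats by blast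
      ultimately show ?thesis unfolding a_def using brat by simp
    qed
  next
    fix \<sigma> \<sigma>' x assume s: "\<sigma> \<in> cones F" "\<sigma>' \<in> cones F" "\<eta> \<subseteq> \<sigma>" "\<sigma> \<subseteq> \<sigma>'" "x \<in> \<sigma>"
    have cc: "c \<sigma> x = c \<sigma>' x" using c_compat[OF s(1,2,4)] span_base[OF s(5)] by blast
    have "vline x (c \<sigma> x) \<in> graph \<sigma>" using s(5) graph_form[OF s(1)] by blast
    then have "g (graph \<sigma>) (vline x (c \<sigma> x)) = g (graph \<sigma>') (vline x (c \<sigma> x))"
      using local_family_compat[OF g graph_T[OF s(1)] graph_T[OF s(2)]] s(3,4) graph_subset_iff 
        span_base by blast
    then show "a \<sigma> x = a \<sigma>' x" unfolding a_def using cc by simp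
  qed
  have "balanced_at F \<tau> a" if \<tau>: "\<tau> \<in> ridges F" "\<eta> \<subseteq> \<tau>" for \<tau>
  proof -
    define A where "A = {\<sigma>. \<sigma> \<in> facets F \<and> \<tau> \<subseteq> \<sigma>}"
    define n where "n = normal_vector (lat F) \<tau>"
    define w where "w = ord_at F f \<tau>"
    define S where "S = (\<Sum>\<sigma>\<in>A. n \<sigma>)"
    have finA: "finite A" using finite_facets[OF rF] by (simp add: A_def)
    have w: "w = 0 \<or> w = 1" using ord[OF \<tau>(1)] by (auto simp: w_def)
    have \<tau>F: "\<tau> \<in> cones F" using \<tau>(1) by (rule ridge_cone)
    have n: "is_normal_vector (lat F) \<tau> \<sigma> (n \<sigma>)" if "\<sigma> \<in> A" for \<sigma>
      using ridge_facet_normal[OF rF \<tau>(1)] that by (simp add: n_def A_def)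
    have S: "S \<in> span \<tau>" using normal_sum_in_span[OF F \<tau>(1), of n] n by (simp add: S_def A_def)
    have w_eq: "w = - (\<Sum>\<sigma>\<in>A. c \<sigma> (n \<sigma>)) + c \<tau> S"
      by (simp add: w_def ord_at_def normal_sum_def S_def A_def n_def)
    \<comment> \<open>Normal vectors around \<open>graph \<tau>\<close>: \<open>e\<close> for the
      vertical facet, and for a graph the point of its span above the normal vector in the base, the
      base cone being recovered by projection.\<close>
    define m where "m \<mu> = (if \<mu> = lifted \<tau> then e else vline (n (vfst ` \<mu>)) (c (vfst ` \<mu>) (n (vfst ` \<mu>))))" for \<mu>
    have ne: "graph \<sigma> \<noteq> lifted \<tau>" if "w = 1" "\<sigma> \<in> A" for \<sigma>
      using not_lifted_subset_graph[of \<tau> \<sigma>] that ridge_D_iff[OF \<tau>(1)] facet_cone by (auto simp: w_def A_def)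
    define X where "X = (if w = 1 then {lifted \<tau>} else {})"
    have fac: "{\<mu>. \<mu> \<in> facets T \<and> graph \<tau> \<subseteq> \<mu>} = graph ` A \<union> X"
      using facets_T_over_ridge[OF \<tau>(1)] by (simp add: A_def w_def X_def)
    have disj: "graph ` A \<inter> X = {}" using ne by (auto simp: X_def)
    have m_graph: "m (graph \<sigma>) = vline (n \<sigma>) (c \<sigma> (n \<sigma>))" if \<sigma>: "\<sigma> \<in> A" for \<sigma>
    proof (cases "graph \<sigma> = lifted \<tau>")
      case True
      then have "e \<in> graph \<sigma>" 
      proof -
        have "vline 0 (f 0 + 1) \<in> lifted \<tau>" unfolding lifted_def using fan_cone(4)[OF rF \<tau>F]
          by (intro CollectI exI[of _ 0] exI[of _ 1]) simp
        then show ?thesis using True f_zero[OF \<tau>F] by (simp add: e_def)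
      qed
      then have "f 0 = 1" unfolding graph_def e_def by (auto simp: vline_inject)
      then show ?thesis using f_zero[OF \<tau>F] by simp
    qed (simp add: m_def vfst_graph)
    have m: "is_normal_vector (lat T) (graph \<tau>) \<mu> (m \<mu>)" if "\<mu> \<in> facets T" "graph \<tau> \<subseteq> \<mu>" for \<mu>
    proof -
      have "\<mu> \<in> graph ` A \<union> X" using fac that by blast
      then show ?thesis
      proof
        assume "\<mu> \<in> graph ` A"
        then obtain \<sigma> where \<sigma>: "\<sigma> \<in> A" "\<mu> = graph \<sigma>" by blast
        then show ?thesis using normal_graph[OF \<tau>F facet_cone _ n] m_graph by (simp add: A_def)
      next
        assume "\<mu> \<in> X"
        then have h: "w = 1" "\<mu> = lifted \<tau>" by (auto simp: X_def split: if_splits)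
        then have "\<tau> \<in> cones D" using ridge_D_iff[OF \<tau>(1)] by (simp add: w_def)
        then show ?thesis using normal_lifted h(2) by (simp add: m_def)
      qed
    qed
    have "graph \<tau> \<in> ridges T" using graph_T[OF \<tau>F] dim_graph[OF \<tau>F] \<tau>(1) by (simp add: ridges_def fan_dim_T)
    moreover have "graph \<eta> \<subseteq> graph \<tau>" using \<tau>(2) graph_subset_iff by blast
    ultimately have bal: "(\<Sum>\<mu>\<in>graph ` A \<union> X. g \<mu> (m \<mu>)) = g (graph \<tau>) (\<Sum>\<mu>\<in>graph ` A \<union> X. m \<mu>)"
      unfolding fac[symmetric] by (intro balanced_any_normals[OF rT g _ _ gb] m) auto
    have inj: "inj_on graph A" using graph_subset_iff by (intro inj_onI) blast
    have finX: "finite X" by (simp add: X_def)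
    have "(\<Sum>\<mu>\<in>X. g \<mu> (m \<mu>)) = w * b"
    proof (cases "w = 1")
      case True
      then have "\<tau> \<in> cones D" using ridge_D_iff[OF \<tau>(1)] by (simp add: w_def)
      then show ?thesis using be \<tau>(2) True by (simp add: X_def m_def)
    qed (use w in \<open>simp add: X_def\<close>)
    moreover have "(\<Sum>\<mu>\<in>graph ` A. g \<mu> (m \<mu>)) = (\<Sum>\<sigma>\<in>A. g (graph \<sigma>) (vline (n \<sigma>) (c \<sigma> (n \<sigma>))))"
      by (simp add: sum.reindex[OF inj] m_graph)
    ultimately have l: "(\<Sum>\<mu>\<in>graph ` A \<union> X. g \<mu> (m \<mu>)) = (\<Sum>\<sigma>\<in>A. g (graph \<sigma>) (vline (n \<sigma>) (c \<sigma> (n \<sigma>)))) + w * b"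
      using sum.union_disjoint[OF finite_imageI[OF finA] finX disj, of "\<lambda>\<mu>. g \<mu> (m \<mu>)"] by simp
    have "(\<Sum>\<mu>\<in>X. m \<mu>) = vline 0 w"
      using w by (auto simp: X_def m_def e_def vline_0)
    moreover have "(\<Sum>\<mu>\<in>graph ` A. m \<mu>) = vline S (\<Sum>\<sigma>\<in>A. c \<sigma> (n \<sigma>))"
      by (simp add: sum.reindex[OF inj] m_graph vline_sum S_def)
    \<comment> \<open>The heights of the normal vectors add up to the sum of the
      \<open>c \<sigma> (n \<sigma>)\<close> plus the weight \<open>w\<close>. By the definition of
      the order this is \<open>c \<tau> S\<close>, so the normal sum lies in the span of
      \<open>graph \<tau>\<close>.\<close>
    ultimately have "(\<Sum>\<mu>\<in>graph ` A \<union> X. m \<mu>) = vline S (c \<tau> S)"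
      using sum.union_disjoint[OF finite_imageI[OF finA] finX disj, of m] w_eq by (simp add: vline_add)
    then have key: "(\<Sum>\<sigma>\<in>A. g (graph \<sigma>) (vline (n \<sigma>) (c \<sigma> (n \<sigma>)))) + w * b = g (graph \<tau>) (vline S (c \<tau> S))"
      using bal l by simp
    \<comment> \<open>Subtracting \<open>b\<close> times the forms of \<open>f\<close> produces a
      defect \<open>b * w\<close>, which is exactly the contribution of the vertical facet.\<close>
    have "(\<Sum>\<sigma>\<in>A. a \<sigma> (n \<sigma>)) = (\<Sum>\<sigma>\<in>A. g (graph \<sigma>) (vline (n \<sigma>) (c \<sigma> (n \<sigma>)))) - b * (\<Sum>\<sigma>\<in>A. c \<sigma> (n \<sigma>))"
      by (simp add: a_def sum_subtractf sum_distrib_left)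
    also have "\<dots> = g (graph \<tau>) (vline S (c \<tau> S)) - b * (w + (\<Sum>\<sigma>\<in>A. c \<sigma> (n \<sigma>)))"
      using key by (simp add: algebra_simps)
    also have "\<dots> = a \<tau> S" using w_eq by (simp add: a_def)
    finally have "(\<Sum>\<sigma>\<in>A. a \<sigma> (n \<sigma>)) = a \<tau> (\<Sum>\<sigma>\<in>A. n \<sigma>)" by (simp add: S_def)
    then show ?thesis unfolding balanced_at_def using n by (intro exI[of _ n]) (simp add: A_def)
  qed
  then obtain L0 where L0: "linear L0" "\<And>\<sigma> x. \<sigma> \<in> cones F \<Longrightarrow> \<eta> \<subseteq> \<sigma> \<Longrightarrow> x \<in> span \<sigma> \<Longrightarrow> a \<sigma> x = L0 x"
    using local_faithfulD[OF lf a] by blast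
  define L where "L z = L0 (vfst z) + b * Poly_Mapping.lookup (vsnd z) 0" for z
  have L: "linear L"
    by (rule linearI) (simp_all add: L_def linear_add[OF linear_vfst] linear_scale[OF linear_vfst]
        linear_add[OF L0(1)] linear_scale[OF L0(1)] linear_add[OF linear_vsnd] linear_scale[OF linear_vsnd]
        lookup_add lookup_scaleR_vec algebra_simps)
  have on_graph: "g (graph \<sigma>) (vline x (f x)) = L (vline x (f x))" if "\<sigma> \<in> cones F" "\<eta> \<subseteq> \<sigma>" "x \<in> \<sigma>" for \<sigma> x
    using L0(2)[OF that(1,2) span_base[OF that(3)]] c_eq[OF that(1,3)] by (simp add: a_def L_def)
  have "g \<mu> z = L z" if \<mu>: "\<mu> \<in> cones T" "graph \<eta> \<subseteq> \<mu>" "z \<in> \<mu>" for \<mu> z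
  proof -
    consider \<sigma> where "\<sigma> \<in> cones F" "\<mu> = graph \<sigma>" | \<delta> where "\<delta> \<in> cones D" "\<mu> = lifted \<delta>"
      using \<mu>(1) unfolding cones_T by blast
    then show ?thesis
    proof cases
      case 1
      have "\<eta> \<subseteq> \<sigma>" using \<mu>(2) 1(2) graph_subset_iff by blast
      then show ?thesis using \<mu>(3) 1 on_graph unfolding graph_def by blast
    next
      case 2
      have sub: "\<eta> \<subseteq> \<delta>" using \<mu>(2) 2(2) graph_subset_lifted_iff by blast
      obtain x t where z: "z = vline x (f x + t)" "x \<in> \<delta>" using \<mu>(3) 2(2) unfolding lifted_def by blast
      have \<delta>: "\<delta> \<in> cones F" using D_cones_F 2(1) .
      have "vline x (f x) \<in> graph \<delta>" using z(2) by (simp add: graph_def)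
      then have "g (graph \<delta>) (vline x (f x)) = g \<mu> (vline x (f x))"
        using local_family_compat[OF g graph_T[OF \<delta>] \<mu>(1)] 2(2) sub graph_subset_iff graph_subset_lifted 
          span_base by blast
      then have 1: "g \<mu> (vline x (f x)) = L (vline x (f x))" using on_graph[OF \<delta> sub z(2)] by simp
      have 3: "g \<mu> e = L e" using be[OF 2(1) sub] 2(2) by (simp add: L_def e_def linear_0[OF L0(1)])
      have "z = vline x (f x) + t *\<^sub>R e" by (simp add: z(1) e_def vline_scale vline_add)
      then show ?thesis 
        using 1 3 local_family_linear[OF g \<mu>(1,2)] L by (simp add: linear_add linear_scale)
    qed
  qed
  then show "\<exists>L. linear L \<and> (\<forall>\<sigma>\<in>cones T. graph \<eta> \<subseteq> \<sigma> \<longrightarrow> (\<forall>x\<in>\<sigma>. g \<sigma> x = L x))" using L by blast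
qed

lemma div_faithful_T:
  assumes "div_faithful F" "\<And>\<delta>. \<delta> \<in> cones D \<Longrightarrow> local_faithful D \<delta>"
  shows "div_faithful T"
  using assms local_faithful_graph local_faithful_lifted
  unfolding div_faithful_iff_local[OF T] div_faithful_iff_local[OF F] cones_T by blast

end

lemma div_faithful_trop_mod_reduced:
  assumes "tropical_fan F" "conewise_integral_linear F f" "tropical_fan (trop_mod F f)" "div_reduced F f"
    "tropical_fan (div_fan F f)" "div_faithful F" "div_faithful (div_fan F f)"
  shows "div_faithful (trop_mod F f)"
proof -
  interpret trop_modification F f "trop_mod F f" "div_fan F f"
    by unfold_locales (use assms in \<open>auto simp: div_reduced_def\<close>)
  show ?thesis using div_faithful_T assms(6,7) div_faithful_iff_local[OF assms(5)] by blast
qed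

lemma div_faithful_trop_mod_trivial:
  assumes "tropical_fan F" "conewise_integral_linear F f" "tropical_fan (trop_mod F f)" "div_trivial F f"
    "div_faithful F"
  shows "div_faithful (trop_mod F f)"
proof -
  interpret trop_modification F f "trop_mod F f" "div_fan F f"
    by unfold_locales (use assms in \<open>auto simp: div_trivial_def\<close>)
  have "cones (div_fan F f) = {}" using assms(4) unfolding cones_D div_trivial_def by force
  then show ?thesis using div_faithful_T assms(5) by blast
qed

section \<open>Refinements\<close>

locale fan_refinement =
  fixes F F' :: fan
  assumes F: "tropical_fan F" and F': "tropical_fan F'" and lat_eq: "lat F' = lat F"
    and support_eq: "support F' = support F"
    and in_cone: "\<And>\<kappa>'. \<kappa>' \<in> cones F' \<Longrightarrow> \<exists>\<kappa>\<in>cones F. \<kappa>' \<subseteq> \<kappa>"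
begin

lemma rF: "rational_fan F" and rF': "rational_fan F'"
  using F F' tropical_rational by blast+

text \<open>The analogue of \<open>fan_arint_subset\<close> across the two fans:
  \<open>\<kappa>'\<close> lies in some cone \<open>\<rho>\<close> of \<open>F\<close>, and
  \<open>\<rho> \<inter> \<kappa>\<close> is a face of \<open>\<rho>\<close> that contains an
  interior point of \<open>\<kappa>'\<close>.\<close>

lemma arint_in_cone:
  assumes "\<kappa>' \<in> cones F'" "\<kappa> \<in> cones F" "x \<in> arint \<kappa>'" "x \<in> \<kappa>"
  shows "\<kappa>' \<subseteq> \<kappa>"
proof -
  obtain \<rho> where \<rho>: "\<rho> \<in> cones F" "\<kappa>' \<subseteq> \<rho>" using in_cone assms(1) by blast
  have "x \<in> \<rho> \<inter> \<kappa>" using assms(3,4) \<rho>(2) arint_subset by blast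
  then have "\<kappa>' \<subseteq> \<rho> \<inter> \<kappa>"
    using extremal_arint_subset[OF fan_inter(2)[OF rF \<rho>(1) assms(2)] \<rho>(2) assms(3) _
        fan_cone(2)[OF rF fan_inter(1)[OF rF \<rho>(1) assms(2)]] fan_cone(2)[OF rF' assms(1)]] by blast
  then show ?thesis by blast
qed

text \<open>
  The cone \<open>\<kappa>'\<close> is one whose interior meets the ray from \<open>x\<close> in a generic direction \<open>y\<close> of \<open>\<kappa>\<close>
  arbitrarily close to \<open>x\<close>.
\<close>

lemma subdividing_cone_at:
  assumes \<kappa>: "\<kappa> \<in> cones F" and x: "x \<in> \<kappa>"
  obtains \<kappa>' where "\<kappa>' \<in> cones F'" "x \<in> \<kappa>'" "\<kappa>' \<subseteq> \<kappa>" "span \<kappa>' = span \<kappa>"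
proof -
  have c\<kappa>: "convex_cone \<kappa>" using fan_cone(2)[OF rF \<kappa>] .
  \<comment> \<open>A vector \<open>y\<close> of \<open>\<kappa>\<close> outside these spans is
    generic: any cone of \<open>F'\<close> whose span contains \<open>y\<close> has all of
    \<open>\<kappa>\<close> in its span.\<close>
  define \<W> where "\<W> = {W \<in> span ` cones F'. \<not> \<kappa> \<subseteq> W}"
  have "finite \<W>" unfolding \<W>_def using fan_finite[OF rF'] by simp
  moreover have "subspace W \<and> \<not> \<kappa> \<subseteq> W" if "W \<in> \<W>" for W using that unfolding \<W>_def by auto
  ultimately obtain y where y: "y \<in> \<kappa>" "\<And>W. W \<in> \<W> \<Longrightarrow> y \<notin> W"
    using convex_cone_avoids_subspaces[OF c\<kappa>] by metis
  define z where "z n = x + inverse (real (Suc n)) *\<^sub>R y" for n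
  have z\<kappa>: "z n \<in> \<kappa>" for n
    unfolding z_def using x y(1) by (intro convex_cone_add[OF c\<kappa>] convex_cone_scaleR[OF c\<kappa>]) auto
  have "\<exists>\<mu>. \<mu> \<in> cones F' \<and> z n \<in> arint \<mu>" for n
  proof -
    have "z n \<in> support F'" unfolding support_eq using z\<kappa> \<kappa> by (auto simp: support_def)
    then show ?thesis using fan_min_cone[OF rF'] by metis
  qed
  then obtain \<mu> where \<mu>: "\<And>n. \<mu> n \<in> cones F'" "\<And>n. z n \<in> arint (\<mu> n)" by metis
  \<comment> \<open>By the pigeonhole principle one cone has infinitely many of the points
    \<open>z n\<close> in its interior. It is closed and therefore contains their limit
    \<open>x\<close>, so its span contains \<open>y\<close>.\<close>
  have "finite (range \<mu>)" using \<mu>(1) fan_finite[OF rF'] finite_subset[of "range \<mu>" "cones F'"] by blast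
  then obtain m where m: "infinite {n \<in> UNIV. \<mu> n = \<mu> m}"
    using pigeonhole_infinite[of UNIV \<mu>] by auto
  define \<kappa>' where "\<kappa>' = \<mu> m"
  have \<kappa>': "\<kappa>' \<in> cones F'" using \<mu>(1) by (simp add: \<kappa>'_def)
  have "\<exists>n\<ge>N. \<mu> n = \<kappa>'" for N
    using m unfolding infinite_nat_iff_unbounded_le \<kappa>'_def by blast
  then obtain r where r: "\<And>N. r N \<ge> N" "\<And>N. \<mu> (r N) = \<kappa>'" by metis
  have zr: "z (r N) \<in> arint \<kappa>'" for N using \<mu>(2)[of "r N"] r(2) by simp
  have "filterlim r at_top sequentially"
    by (rule filterlim_at_top_mono[OF filterlim_ident]) (use r(1) in simp)
  then have "(\<lambda>N. inverse (real (Suc (r N)))) \<longlonglongrightarrow> 0"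
    using LIMSEQ_inverse_real_of_nat filterlim_compose by blast
  then have "(\<lambda>N. z (r N)) \<longlonglongrightarrow> x + 0 *\<^sub>R y" unfolding z_def by (intro tendsto_intros)
  then have lim: "(\<lambda>N. z (r N)) \<longlonglongrightarrow> x" by simp
  have x\<kappa>': "x \<in> \<kappa>'"
    using closed_sequentially[OF fan_cone(6)[OF rF' \<kappa>'] _ lim] zr arint_subset by blast
  have sub: "\<kappa>' \<subseteq> \<kappa>" using arint_in_cone[OF \<kappa>' \<kappa> zr z\<kappa>] .
  have "z (r 0) - x \<in> span \<kappa>'" 
    using x\<kappa>' zr[of 0] arint_subset by (blast intro: span_diff span_base)
  then have "real (Suc (r 0)) *\<^sub>R (z (r 0) - x) \<in> span \<kappa>'" by (rule span_scale)
  then have "y \<in> span \<kappa>'" by (simp add: z_def del: of_nat_Suc)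
  then have "\<kappa> \<subseteq> span \<kappa>'" using y(2) \<kappa>' unfolding \<W>_def by blast
  then have "span \<kappa>' = span \<kappa>" 
    using span_mono[OF sub] span_minimal[of \<kappa> "span \<kappa>'"] by auto
  then show ?thesis using that \<kappa>' x\<kappa>' sub by blast
qed

section \<open>Facets and ridges of the refined fan\<close>

lemma fan_dim_eq': "fan_dim F' = fan_dim F"
proof (rule antisym)
  obtain \<sigma>' where \<sigma>': "\<sigma>' \<in> facets F'" using tropical_facet_exists[OF F'] by blast
  then obtain \<sigma> where \<sigma>: "\<sigma> \<in> cones F" "\<sigma>' \<subseteq> \<sigma>" using in_cone facet_cone by blast
  then show "fan_dim F' \<le> fan_dim F"
    using fan_dim_mono(1)[OF rF \<sigma>] fan_dim_ge[OF rF \<sigma>(1)] \<sigma>' by (simp add: facets_def)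
  obtain \<phi> where \<phi>: "\<phi> \<in> facets F" using tropical_facet_exists[OF F] by blast
  obtain \<kappa>' where \<kappa>': "\<kappa>' \<in> cones F'" "span \<kappa>' = span \<phi>"
    using subdividing_cone_at[OF facet_cone[OF \<phi>] fan_cone(4)[OF rF facet_cone[OF \<phi>]]] by blast
  then have "dim \<kappa>' = dim \<phi>" using span_eq_dim by blast
  then show "fan_dim F \<le> fan_dim F'" using fan_dim_ge[OF rF' \<kappa>'(1)] \<phi> by (simp add: facets_def)
qed

lemma facet_span_iff:
  assumes "\<sigma> \<in> cones F" "\<sigma>' \<in> cones F'" "span \<sigma>' = span \<sigma>"
  shows "\<sigma>' \<in> facets F' \<longleftrightarrow> \<sigma> \<in> facets F" "\<sigma>' \<in> ridges F' \<longleftrightarrow> \<sigma> \<in> ridges F"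
  using assms span_eq_dim[OF assms(3)] by (auto simp: facets_def ridges_def fan_dim_eq')

lemma facet_in:
  assumes "\<sigma>' \<in> facets F'" "\<sigma> \<in> cones F" "\<sigma>' \<subseteq> \<sigma>"
  shows "\<sigma> \<in> facets F" "span \<sigma>' = span \<sigma>"
proof -
  have d: "dim \<sigma>' = fan_dim F" using assms(1) by (simp add: facets_def fan_dim_eq')
  then have "dim \<sigma> = fan_dim F" using fan_dim_mono(1)[OF rF assms(2,3)] fan_dim_ge[OF rF assms(2)] by simp
  then show "\<sigma> \<in> facets F" "span \<sigma>' = span \<sigma>"
    using assms(2) fan_dim_mono(2)[OF rF assms(2,3)] d by (auto simp: facets_def)
qed

lemma in_facet:
  assumes "\<sigma>' \<in> facets F'"
  obtains \<sigma> where "\<sigma> \<in> facets F" "\<sigma>' \<subseteq> \<sigma>"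
  using in_cone[OF facet_cone[OF assms]] facet_in(1)[OF assms] by blast

lemma in_facet_unique:
  assumes "\<sigma>' \<in> facets F'" "\<sigma>1 \<in> facets F" "\<sigma>2 \<in> facets F" "\<sigma>' \<subseteq> \<sigma>1" "\<sigma>' \<subseteq> \<sigma>2"
  shows "\<sigma>1 = \<sigma>2"
proof -
  have "\<sigma>1 \<inter> \<sigma>2 \<in> facets F" using facet_in(1)[OF assms(1) fan_inter(1)[OF rF]] assms facet_cone by blast
  then show ?thesis 
    using facet_dim_ge[OF rF facet_cone[OF assms(2)], of "\<sigma>1 \<inter> \<sigma>2"] 
      facet_dim_ge[OF rF facet_cone[OF assms(3)], of "\<sigma>1 \<inter> \<sigma>2"] by auto
qed

text \<open>If \<open>s2\<close> is a positive multiple of \<open>s1\<close> modulo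
  \<open>span \<tau>\<close>, then an interior point of \<open>\<tau>\<close> moved slightly along
  \<open>s2\<close> lies in both facets. Their intersection contains this point and
  \<open>\<tau>\<close>, so it has full dimension.\<close>

lemma same_side_eq:
  assumes \<tau>: "\<tau> \<in> ridges F'" and \<sigma>: "\<sigma>1 \<in> facets F'" "\<sigma>2 \<in> facets F'" "\<tau> \<subseteq> \<sigma>1" "\<tau> \<subseteq> \<sigma>2"
    and s: "s1 \<in> \<sigma>1" "s2 \<in> \<sigma>2" "s2 \<notin> span \<tau>" "c > 0" "s2 - c *\<^sub>R s1 \<in> span \<tau>"
  shows "\<sigma>1 = \<sigma>2"
proof -
  have c\<tau>: "convex_cone \<tau>" "convex_cone \<sigma>1" "convex_cone \<sigma>2"
    using fan_cone(2)[OF rF'] ridge_cone[OF \<tau>] facet_cone \<sigma> by auto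
  obtain p where p: "p \<in> arint \<tau>" using fan_cone(3)[OF rF' ridge_cone[OF \<tau>]] by blast
  obtain e where e: "e > 0" "\<And>t. 0 \<le> t \<Longrightarrow> t \<le> e \<Longrightarrow> p + t *\<^sub>R (s2 - c *\<^sub>R s1) \<in> \<tau>"
    using arint_span[OF c\<tau>(1) p s(5)] by blast
  have p\<tau>: "p \<in> \<tau>" using p arint_subset by blast
  define q where "q = p + e *\<^sub>R s2"
  have "q = (p + e *\<^sub>R (s2 - c *\<^sub>R s1)) + (e * c) *\<^sub>R s1" by (simp add: q_def algebra_simps)
  moreover have "p + e *\<^sub>R (s2 - c *\<^sub>R s1) \<in> \<sigma>1" using e \<sigma>(3) by auto
  moreover have "(e * c) *\<^sub>R s1 \<in> \<sigma>1" using e(1) s by (intro convex_cone_scaleR[OF c\<tau>(2)]) auto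
  ultimately have q1: "q \<in> \<sigma>1" using convex_cone_add[OF c\<tau>(2)] by metis
  have "e *\<^sub>R s2 \<in> \<sigma>2" using e(1) s by (intro convex_cone_scaleR[OF c\<tau>(3)]) auto
  then have q2: "q \<in> \<sigma>2" unfolding q_def using p\<tau> \<sigma>(4) convex_cone_add[OF c\<tau>(3)] by blast
  have q3: "q \<notin> span \<tau>"
  proof
    assume "q \<in> span \<tau>"
    then have "q - p \<in> span \<tau>" using p\<tau> span_diff span_base by blast
    then have "(1/e) *\<^sub>R (q - p) \<in> span \<tau>" by (rule span_scale)
    then show False using s(3) e(1) by (simp add: q_def)
  qed
  define \<kappa> where "\<kappa> = \<sigma>1 \<inter> \<sigma>2"
  have \<kappa>: "\<kappa> \<in> cones F'" "insert q \<tau> \<subseteq> \<kappa>" using fan_inter(1)[OF rF'] facet_cone \<sigma> q1 q2 by (auto simp: \<kappa>_def)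
  obtain V where V: "finite V" "\<tau> \<subseteq> span V" by (rule cone_span_finite[OF fan_cone(1)[OF rF' ridge_cone[OF \<tau>]]])
  have "dim (insert q \<tau>) = fan_dim F'"
    using dim_insert_span[OF V(2,1) q3] \<tau> by (simp add: ridges_def)
  then have "\<kappa> \<in> facets F'" using fan_dim_mono(1)[OF rF' \<kappa>] fan_dim_ge[OF rF' \<kappa>(1)] \<kappa>(1) by (simp add: facets_def)
  then show ?thesis 
    using facet_dim_ge[OF rF' facet_cone[OF \<sigma>(1)], of \<kappa>] facet_dim_ge[OF rF' facet_cone[OF \<sigma>(2)], of \<kappa>]
    by (auto simp: \<kappa>_def)
qed

lemma ridge_facet_witness:
  assumes "\<tau> \<in> ridges F'" "\<sigma> \<in> facets F'" "\<tau> \<subseteq> \<sigma>"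
  obtains s where "s \<in> \<sigma>" "s \<notin> span \<tau>" "span \<sigma> = span (insert s \<tau>)"
proof -
  have r: "rational_cone (lat F') \<sigma>" using fan_cone(1)[OF rF' facet_cone[OF assms(2)]] .
  have d: "dim \<tau> + 1 = dim \<sigma>" using ridge_facet_dim[OF assms(1,2)] .
  obtain s where s: "s \<in> \<sigma>" "s \<notin> span \<tau>" using codim_one_witness[OF r assms(3) d] by blast
  then show ?thesis using that codim_one_span[OF r assms(3) d span_base[OF s(1)] s(2)] by blast
qed

lemma opposite_sides:
  assumes \<tau>: "\<tau> \<in> ridges F'" and \<sigma>: "\<sigma>1 \<in> facets F'" "\<sigma>2 \<in> facets F'" "\<tau> \<subseteq> \<sigma>1" "\<tau> \<subseteq> \<sigma>2"
    and ne: "\<sigma>1 \<noteq> \<sigma>2" and s: "s1 \<in> \<sigma>1" "s2 \<in> \<sigma>2" "s2 \<notin> span \<tau>" "s2 \<in> span (insert s1 \<tau>)"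
  obtains c where "c > 0" "s2 + c *\<^sub>R s1 \<in> span \<tau>"
proof -
  obtain c where c: "s2 - c *\<^sub>R s1 \<in> span \<tau>" using span_insert_coeff[OF s(4)] by blast
  have "c \<noteq> 0" using c s(3) by auto
  moreover have "\<not> c > 0" using same_side_eq[OF \<tau> \<sigma> s(1-3) _ c] ne by blast
  ultimately have "- c > 0" by simp
  moreover have "s2 + (- c) *\<^sub>R s1 \<in> span \<tau>" using c by simp
  ultimately show ?thesis using that by blast
qed

text \<open>
  A ridge in the interior of \<open>\<sigma>\<close> is contained in exactly two facets, whose normal vectors are
  opposite to each other; hence balancing means that the two linear forms agree.
\<close>

lemma forms_agree_across_ridge:
  assumes g: "local_family F' \<eta>' g" "\<And>\<tau>. \<tau> \<in> ridges F' \<Longrightarrow> \<eta>' \<subseteq> \<tau> \<Longrightarrow> balanced_at F' \<tau> g"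
    and \<tau>: "\<tau> \<in> ridges F'" "\<eta>' \<subseteq> \<tau>" and \<sigma>12: "\<sigma>1 \<in> facets F'" "\<sigma>2 \<in> facets F'" "\<tau> \<subseteq> \<sigma>1" "\<tau> \<subseteq> \<sigma>2"
    and \<sigma>: "\<sigma> \<in> facets F" "\<sigma>1 \<subseteq> \<sigma>" "\<sigma>2 \<subseteq> \<sigma>" and v: "v \<in> span \<sigma>"
  shows "g \<sigma>1 v = g \<sigma>2 v"
proof (cases "\<sigma>1 = \<sigma>2")
  case False
  have sp: "span \<sigma>1 = span \<sigma>" "span \<sigma>2 = span \<sigma>" using facet_in(2) facet_cone \<sigma> \<sigma>12 by blast+
  obtain s1 where s1: "s1 \<in> \<sigma>1" "s1 \<notin> span \<tau>" "span \<sigma>1 = span (insert s1 \<tau>)"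
    by (rule ridge_facet_witness[OF \<tau>(1) \<sigma>12(1,3)])
  obtain s2 where s2: "s2 \<in> \<sigma>2" "s2 \<notin> span \<tau>" "span \<sigma>2 = span (insert s2 \<tau>)"
    by (rule ridge_facet_witness[OF \<tau>(1) \<sigma>12(2,4)])
  have s2s1: "s2 \<in> span (insert s1 \<tau>)" using sp s1(3) span_base[OF s2(1)] by simp
  obtain c where c: "c > 0" "s2 + c *\<^sub>R s1 \<in> span \<tau>"
    by (rule opposite_sides[OF \<tau>(1) \<sigma>12 False s1(1) s2(1,2) s2s1])
  obtain z where z: "z \<in> arint \<tau>" using fan_cone(3)[OF rF' ridge_cone[OF \<tau>(1)]] by blast
  have z\<tau>: "z \<in> \<tau>" using z arint_subset by blast
  have \<sigma>F: "\<sigma> \<in> cones F" using facet_cone[OF \<sigma>(1)] .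
  have "z \<in> support F" using z\<tau> \<sigma>12(3) \<sigma>(2) \<sigma>F by (auto simp: support_def)
  then obtain \<zeta> where \<zeta>: "\<zeta> \<in> cones F" "z \<in> arint \<zeta>" using fan_min_cone[OF rF] by blast
  have \<tau>\<zeta>: "\<tau> \<subseteq> \<zeta>" using arint_in_cone[OF ridge_cone[OF \<tau>(1)] \<zeta>(1) z] \<zeta>(2) arint_subset by blast
  have \<zeta>\<sigma>: "\<zeta> \<subseteq> \<sigma>" using fan_arint_subset[OF rF \<zeta>(1) \<sigma>F \<zeta>(2)] z\<tau> \<sigma>12(3) \<sigma>(2) by blast
  \<comment> \<open>\<open>\<zeta>\<close> is the cone of \<open>F\<close> with \<open>z\<close> in
    its interior, and it contains \<open>\<tau>\<close>. The relation
    \<open>s2 + c s1 \<in> span \<tau>\<close> and extremality put \<open>s2\<close> into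
    \<open>\<zeta>\<close>, which therefore has full dimension: the interior of
    \<open>\<tau>\<close> meets that of \<open>\<sigma>\<close>.\<close>
  have "s2 \<in> \<zeta>"
  proof (rule extremal_sum_span(1)[OF fan_extremal[OF rF \<zeta>(1) \<sigma>F \<zeta>\<sigma>] fan_cone(2)[OF rF \<zeta>(1)] fan_cone(2)[OF rF \<sigma>F]
        fan_cone(3)[OF rF \<zeta>(1)]])
    show "s2 \<in> \<sigma>" using s2(1) \<sigma>(3) by blast
    show "c *\<^sub>R s1 \<in> \<sigma>" using s1(1) \<sigma>(2) c(1) by (intro convex_cone_scaleR[OF fan_cone(2)[OF rF \<sigma>F]]) auto
    show "s2 + c *\<^sub>R s1 \<in> span \<zeta>" using c(2) span_mono[OF \<tau>\<zeta>] by blast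
  qed
  then have "insert s2 \<tau> \<subseteq> \<zeta>" using \<tau>\<zeta> by blast
  then have "dim (insert s2 \<tau>) \<le> dim \<zeta>" by (rule fan_dim_mono(1)[OF rF \<zeta>(1)])
  moreover have "dim (insert s2 \<tau>) = dim \<sigma>" 
    using sp(2) s2(3) span_eq_dim by metis
  ultimately have \<zeta>eq: "\<zeta> = \<sigma>" using fan_dim_eq[OF rF \<zeta>(1) \<sigma>F \<zeta>\<sigma>] by simp
  \<comment> \<open>Only two sides are available: a third facet would be opposite to both
    \<open>\<sigma>1\<close> and \<open>\<sigma>2\<close>, which are opposite to each other, and
    then a positive multiple of \<open>s1\<close> would lie in \<open>span \<tau>\<close>.\<close>
  have only: "\<sigma>3 = \<sigma>1 \<or> \<sigma>3 = \<sigma>2" if \<sigma>3: "\<sigma>3 \<in> facets F'" "\<tau> \<subseteq> \<sigma>3" for \<sigma>3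
  proof (rule ccontr)
    assume no: "\<not> ?thesis"
    obtain \<psi> where \<psi>: "\<psi> \<in> facets F" "\<sigma>3 \<subseteq> \<psi>" by (rule in_facet[OF \<sigma>3(1)])
    have "\<sigma> \<subseteq> \<psi>" using fan_arint_subset[OF rF \<sigma>F facet_cone[OF \<psi>(1)], of z] \<zeta>(2) \<zeta>eq z\<tau> \<sigma>3(2) \<psi>(2) by blast
    then have "\<psi> = \<sigma>" using facet_dim_ge[OF rF facet_cone[OF \<psi>(1)] \<sigma>(1)] by blast
    then have sp3: "span \<sigma>3 = span \<sigma>" using facet_in(2)[OF \<sigma>3(1) \<sigma>F] \<psi>(2) by blast
    obtain s3 where s3: "s3 \<in> \<sigma>3" "s3 \<notin> span \<tau>" by (rule ridge_facet_witness[OF \<tau>(1) \<sigma>3])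
    have in1: "s3 \<in> span (insert s1 \<tau>)" and in2: "s3 \<in> span (insert s2 \<tau>)" 
      using sp sp3 s1(3) s2(3) span_base[OF s3(1)] by auto
    obtain d1 where d1: "d1 > 0" "s3 + d1 *\<^sub>R s1 \<in> span \<tau>"
      using opposite_sides[OF \<tau>(1) \<sigma>12(1) \<sigma>3(1) \<sigma>12(3) \<sigma>3(2) _ s1(1) s3 in1] no by blast
    obtain d2 where d2: "d2 > 0" "s3 + d2 *\<^sub>R s2 \<in> span \<tau>"
      using opposite_sides[OF \<tau>(1) \<sigma>12(2) \<sigma>3(1) \<sigma>12(4) \<sigma>3(2) _ s2(1) s3 in2] no by blast
    have "(s3 + d1 *\<^sub>R s1) - (s3 + d2 *\<^sub>R s2) + d2 *\<^sub>R (s2 + c *\<^sub>R s1) \<in> span \<tau>"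
      using d1 d2 c span_diff span_add span_scale by blast
    then have "(d1 + d2 * c) *\<^sub>R s1 \<in> span \<tau>" by (simp add: algebra_simps)
    then have "(1 / (d1 + d2 * c)) *\<^sub>R ((d1 + d2 * c) *\<^sub>R s1) \<in> span \<tau>" by (rule span_scale)
    moreover have "d1 + d2 * c > 0" using d1(1) d2(1) c(1) by (simp add: add_pos_pos)
    ultimately show False using s1(2) by simp
  qed
  then have fac: "{\<sigma>3. \<sigma>3 \<in> facets F' \<and> \<tau> \<subseteq> \<sigma>3} = {\<sigma>1, \<sigma>2}" using \<sigma>12 by blast
  define n where "n = normal_vector (lat F') \<tau>"
  have n: "is_normal_vector (lat F') \<tau> \<sigma>3 (n \<sigma>3)" if "\<sigma>3 \<in> facets F'" "\<tau> \<subseteq> \<sigma>3" for \<sigma>3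
    using ridge_facet_normal[OF rF' \<tau>(1) that] by (simp add: n_def)
  have lin: "linear (g \<sigma>1)" "linear (g \<sigma>2)" 
    using local_family_linear[OF g(1) facet_cone] \<sigma>12 \<tau>(2) by blast+
  have N: "n \<sigma>1 + n \<sigma>2 \<in> span \<tau>" using normal_sum_in_span[OF F' \<tau>(1) n] fac False by simp
  \<comment> \<open>The normal sum is in \<open>span \<tau>\<close>, so \<open>g \<tau>\<close> may
    be replaced there by \<open>g \<sigma>2\<close>. The term at \<open>n \<sigma>2\<close> cancels,
    and the two forms agree at \<open>n \<sigma>1\<close>, a vector complementing
    \<open>span \<tau>\<close>.\<close>
  have "g \<sigma>1 (n \<sigma>1) + g \<sigma>2 (n \<sigma>2) = g \<tau> (n \<sigma>1 + n \<sigma>2)"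
    using balanced_any_normals[OF rF' g(1) \<tau> g(2)[OF \<tau>] n] fac False by simp
  also have "\<dots> = g \<sigma>2 (n \<sigma>1 + n \<sigma>2)"
    using local_family_compat[OF g(1) ridge_cone[OF \<tau>(1)] facet_cone[OF \<sigma>12(2)] \<tau>(2) \<sigma>12(4) N] .
  finally have eq: "g \<sigma>1 (n \<sigma>1) = g \<sigma>2 (n \<sigma>1)" by (simp add: linear_add[OF lin(2)])
  have r1: "rational_cone (lat F') \<sigma>1" using fan_cone(1)[OF rF' facet_cone[OF \<sigma>12(1)]] .
  have d1: "dim \<tau> + 1 = dim \<sigma>1" using ridge_facet_dim[OF \<tau>(1) \<sigma>12(1)] .
  have n1: "is_normal_vector (lat F') \<tau> \<sigma>1 (n \<sigma>1)" using n \<sigma>12 by blast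
  have "span \<sigma>1 = span (insert (n \<sigma>1) \<tau>)"
    using codim_one_span[OF r1 \<sigma>12(3) d1 normal_vector_span[OF n1] normal_vector_not_span[OF n1 r1 \<sigma>12(3) d1]] .
  then have "v \<in> span (insert (n \<sigma>1) \<tau>)" using v sp(1) by simp
  then show ?thesis
  proof (rule linear_eq_on[OF lin])
    fix b assume b: "b \<in> insert (n \<sigma>1) \<tau>"
    show "g \<sigma>1 b = g \<sigma>2 b"
    proof (cases "b = n \<sigma>1")
      case False
      then have "b \<in> span \<tau>" using b span_base by blast
      then show ?thesis 
        using local_family_compat[OF g(1) ridge_cone[OF \<tau>(1)] facet_cone[OF \<sigma>12(1)] \<tau>(2) \<sigma>12(3)]
          local_family_compat[OF g(1) ridge_cone[OF \<tau>(1)] facet_cone[OF \<sigma>12(2)] \<tau>(2) \<sigma>12(4)] by simp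
    qed (use eq in simp)
  qed
qed simp

text \<open>
  A generic segment in \<open>\<sigma>\<close> close to \<open>p\<close> which joins a point of \<open>\<sigma>1\<close> to one of \<open>\<sigma>2\<close> meets only cones
  of codimension at most one, so that the linear form is locally constant along it.
\<close>

lemma forms_agree_in_facet:
  assumes g: "local_family F' \<eta>' g" "\<And>\<tau>. \<tau> \<in> ridges F' \<Longrightarrow> \<eta>' \<subseteq> \<tau> \<Longrightarrow> balanced_at F' \<tau> g"
    and \<eta>': "\<eta>' \<in> cones F'" "p \<in> arint \<eta>'"
    and \<sigma>: "\<sigma> \<in> facets F" and \<sigma>12: "\<sigma>1 \<in> facets F'" "\<sigma>2 \<in> facets F'" "p \<in> \<sigma>1" "p \<in> \<sigma>2" "\<sigma>1 \<subseteq> \<sigma>" "\<sigma>2 \<subseteq> \<sigma>"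
    and v: "v \<in> span \<sigma>"
  shows "g \<sigma>1 v = g \<sigma>2 v"
proof (rule ccontr)
  assume neq: "g \<sigma>1 v \<noteq> g \<sigma>2 v"
  have \<sigma>F: "\<sigma> \<in> cones F" using facet_cone[OF \<sigma>] .
  have p\<sigma>: "p \<in> \<sigma>" using \<sigma>12 by blast
  have c\<sigma>: "convex_cone \<sigma>" using fan_cone(2)[OF rF \<sigma>F] .
  have star: "\<eta>' \<subseteq> \<mu>" if "\<mu> \<in> cones F'" "p \<in> \<mu>" for \<mu> using fan_arint_subset[OF rF' \<eta>'(1) that(1) \<eta>'(2) that(2)] .
  \<comment> \<open>The union of the cones of \<open>F'\<close> that miss \<open>p\<close> is
    closed. A segment close enough to \<open>p\<close> avoids it, so every cone that it meets
    contains \<open>p\<close> and hence \<open>\<eta>'\<close>, where the family is defined.\<close>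
  define bad where "bad = \<Union>{\<mu> \<in> cones F'. p \<notin> \<mu>}"
  have "closed bad" unfolding bad_def using fan_finite[OF rF'] fan_cone(6)[OF rF'] by (intro closed_Union) auto
  moreover have "p \<notin> bad" by (auto simp: bad_def)
  ultimately obtain \<delta> where \<delta>: "\<delta> > 0" "\<And>z. dist z p < \<delta> \<Longrightarrow> z \<notin> bad"
    using open_Compl[of bad] unfolding open_dist by blast
  define small where "small = {\<mu> \<in> cones F'. dim \<mu> + 2 \<le> fan_dim F'}"
  have fin: "finite small" using fan_finite[OF rF'] by (simp add: small_def)
  have not_in: "\<not> \<sigma>i \<subseteq> span A" if "\<sigma>i \<in> facets F'" "dim A < fan_dim F'" "A \<subseteq> span V" "finite V" for \<sigma>i A V
  proof
    assume "\<sigma>i \<subseteq> span A"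
    then have "dim \<sigma>i \<le> dim A" using dim_mono_span that(3,4) by blast
    then show False using that(1,2) by (simp add: facets_def)
  qed
  have "finite (span ` small)" using fin by simp
  moreover have "subspace W \<and> \<not> \<sigma>1 \<subseteq> W" if W: "W \<in> span ` small" for W
  proof -
    obtain \<mu> where \<mu>: "\<mu> \<in> cones F'" "dim \<mu> + 2 \<le> fan_dim F'" "W = span \<mu>" using W by (auto simp: small_def)
    obtain V where "finite V" "\<mu> \<subseteq> span V" by (rule cone_span_finite[OF fan_cone(1)[OF rF' \<mu>(1)]])
    then show ?thesis using not_in[OF \<sigma>12(1)] \<mu> by auto
  qed
  ultimately obtain x where x: "x \<in> \<sigma>1" "\<And>W. W \<in> span ` small \<Longrightarrow> x \<notin> W"
    using convex_cone_avoids_subspaces[OF fan_cone(2)[OF rF' facet_cone[OF \<sigma>12(1)]]] by metis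
  have x\<mu>: "x \<notin> span \<mu>" if "\<mu> \<in> small" for \<mu> using x(2) that by blast
  \<comment> \<open>\<open>x\<close> is off the span of every cone of codimension at least two, and
    \<open>y\<close> is now chosen off the span of each such cone enlarged by \<open>x\<close>; thus
    no point \<open>(1 - t) x + t y\<close> lies in one of these spans.\<close>
  have "finite ((\<lambda>\<mu>. span (insert x \<mu>)) ` small)" using fin by simp
  moreover have "subspace W \<and> \<not> \<sigma>2 \<subseteq> W" if W: "W \<in> (\<lambda>\<mu>. span (insert x \<mu>)) ` small" for W
    proof -
      obtain \<mu> where \<mu>: "\<mu> \<in> small" "W = span (insert x \<mu>)" using W by blast
      have \<mu>': "\<mu> \<in> cones F'" "dim \<mu> + 2 \<le> fan_dim F'" using \<mu>(1) by (auto simp: small_def)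
      obtain V where V: "finite V" "\<mu> \<subseteq> span V" by (rule cone_span_finite[OF fan_cone(1)[OF rF' \<mu>'(1)]])
      have "dim (insert x \<mu>) < fan_dim F'" using dim_insert_span[OF V(2,1) x\<mu>[OF \<mu>(1)]] \<mu>'(2) by simp
      moreover have "insert x \<mu> \<subseteq> span (insert x V)" 
        using V(2) span_mono[of V "insert x V"] span_base[of x "insert x V"] by auto
      ultimately show ?thesis using not_in[OF \<sigma>12(2)] V(1) \<mu>(2) by auto
    qed
  ultimately obtain y where y: "y \<in> \<sigma>2" "\<And>W. W \<in> (\<lambda>\<mu>. span (insert x \<mu>)) ` small \<Longrightarrow> y \<notin> W"
    using convex_cone_avoids_subspaces[OF fan_cone(2)[OF rF' facet_cone[OF \<sigma>12(2)]]] by metis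
  have y\<mu>: "y \<notin> span (insert x \<mu>)" if "\<mu> \<in> small" for \<mu> using y(2) that by blast
  \<comment> \<open>The points of the segment from \<open>x\<close> to \<open>y\<close> have norm
    less than the denominator, so scaling by \<open>\<epsilon>\<close> keeps them within
    \<open>\<delta>\<close> of \<open>p\<close>; the summand 1 makes the denominator positive and
    the estimate strict.\<close>
  define \<epsilon> where "\<epsilon> = \<delta> / (norm x + norm y + 1)"
  have \<epsilon>: "\<epsilon> > 0" using \<delta>(1) by (simp add: \<epsilon>_def add_nonneg_pos)
  define z where "z t = p + \<epsilon> *\<^sub>R ((1 - t) *\<^sub>R x + t *\<^sub>R y)" for t
  have z\<sigma>: "z t \<in> \<sigma>" if "t \<in> {0..1}" for t
    unfolding z_def using that p\<sigma> x(1) y(1) \<sigma>12 \<epsilon>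
    by (intro convex_cone_add[OF c\<sigma>] convex_cone_scaleR[OF c\<sigma>]) auto
  have zp: "p \<in> \<mu>" if t: "t \<in> {0..1}" and \<mu>: "\<mu> \<in> cones F'" "z t \<in> \<mu>" for t \<mu>
  proof -
    have "norm ((1 - t) *\<^sub>R x + t *\<^sub>R y) \<le> norm ((1 - t) *\<^sub>R x) + norm (t *\<^sub>R y)" by (rule norm_triangle_ineq)
    also have "\<dots> \<le> 1 * norm x + 1 * norm y"
      using t by (intro add_mono) (simp_all add: mult_left_le_one_le)
    also have "\<dots> < norm x + norm y + 1" by simp
    finally have b: "norm ((1 - t) *\<^sub>R x + t *\<^sub>R y) < norm x + norm y + 1" .
    have pos: "norm x + norm y + 1 > 0" by (simp add: add_nonneg_pos)
    have "dist (z t) p = \<epsilon> * norm ((1 - t) *\<^sub>R x + t *\<^sub>R y)" using \<epsilon> by (simp add: z_def dist_norm)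
    also have "\<dots> < \<epsilon> * (norm x + norm y + 1)" using b \<epsilon> by simp
    also have "\<dots> = \<delta>" using pos by (simp add: \<epsilon>_def)
    finally have "z t \<notin> bad" by (rule \<delta>(2))
    then show ?thesis using \<mu> by (auto simp: bad_def)
  qed
  define S where "S = {\<sigma>' \<in> facets F'. \<sigma>' \<subseteq> \<sigma>}"
  have finS: "finite S" using finite_facets[OF rF'] by (simp add: S_def)
  define Tm where "Tm \<sigma>' = {0..1} \<inter> z -` \<sigma>'" for \<sigma>'
  have closedT: "closed (Tm \<sigma>')" if "\<sigma>' \<in> S" for \<sigma>'
  proof -
    have "continuous_on {0..1} z" unfolding z_def by (intro continuous_intros)
    then show ?thesis unfolding Tm_def
      using that fan_cone(6)[OF rF'] facet_cone by (intro continuous_closed_preimage) (auto simp: S_def)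
  qed
  \<comment> \<open>\<open>A\<close> and \<open>B\<close> collect the parameters at which the
    segment lies in a facet with the same, respectively a different, value at \<open>v\<close> as
    for \<open>\<sigma>1\<close>. Both are closed and they cover the interval; disjointness, from
    agreement across ridges, contradicts connectedness.\<close>
  define A where "A = \<Union>(Tm ` {\<sigma>' \<in> S. g \<sigma>' v = g \<sigma>1 v})"
  define B where "B = \<Union>(Tm ` {\<sigma>' \<in> S. g \<sigma>' v \<noteq> g \<sigma>1 v})"
  have closedAB: "closed A" "closed B" unfolding A_def B_def using finS closedT by (auto intro!: closed_Union)
  have cover: "{0..1} \<subseteq> A \<union> B"
  proof
    fix t :: real assume t: "t \<in> {0..1}"
    obtain \<kappa>' where \<kappa>': "\<kappa>' \<in> cones F'" "z t \<in> \<kappa>'" "\<kappa>' \<subseteq> \<sigma>" "span \<kappa>' = span \<sigma>"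
      by (rule subdividing_cone_at[OF \<sigma>F z\<sigma>[OF t]])
    then have "\<kappa>' \<in> S" using facet_span_iff(1)[OF \<sigma>F] \<sigma> by (simp add: S_def)
    moreover have "t \<in> Tm \<kappa>'" using t \<kappa>'(2) by (simp add: Tm_def)
    ultimately show "t \<in> A \<union> B" unfolding A_def B_def by blast
  qed
  have disj: "A \<inter> B = {}"
  proof (rule ccontr)
    assume "A \<inter> B \<noteq> {}"
    then obtain t where t: "t \<in> A" "t \<in> B" by blast
    obtain \<sigma>a where a: "\<sigma>a \<in> S" "t \<in> Tm \<sigma>a" "g \<sigma>a v = g \<sigma>1 v" using t(1) unfolding A_def by blast
    obtain \<sigma>b where b: "\<sigma>b \<in> S" "t \<in> Tm \<sigma>b" "g \<sigma>b v \<noteq> g \<sigma>1 v" using t(2) unfolding B_def by blast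
    have h: "\<sigma>a \<in> S" "\<sigma>b \<in> S" "t \<in> Tm \<sigma>a" "t \<in> Tm \<sigma>b" "g \<sigma>a v \<noteq> g \<sigma>b v"
      using a b by auto
    have t: "t \<in> {0..1}" and za: "z t \<in> \<sigma>a" and zb: "z t \<in> \<sigma>b" using h by (auto simp: Tm_def)
    have fa: "\<sigma>a \<in> facets F'" "\<sigma>a \<subseteq> \<sigma>" and fb: "\<sigma>b \<in> facets F'" "\<sigma>b \<subseteq> \<sigma>" using h by (auto simp: S_def)
    have "z t \<in> support F'" using za facet_cone[OF fa(1)] by (auto simp: support_def)
    then obtain \<mu> where \<mu>: "\<mu> \<in> cones F'" "z t \<in> arint \<mu>" using fan_min_cone[OF rF'] by blast
    have z\<mu>: "z t \<in> \<mu>" using \<mu>(2) arint_subset by blast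
    have p\<mu>: "p \<in> \<mu>" using zp[OF t \<mu>(1) z\<mu>] .
    have sub: "\<mu> \<subseteq> \<sigma>a" "\<mu> \<subseteq> \<sigma>b"
      using fan_arint_subset[OF rF' \<mu>(1) facet_cone[OF fa(1)] \<mu>(2) za] 
        fan_arint_subset[OF rF' \<mu>(1) facet_cone[OF fb(1)] \<mu>(2) zb] by auto
    have "\<mu> \<notin> small"
    proof
      assume \<mu>s: "\<mu> \<in> small"
      have "z t - p \<in> span \<mu>" using z\<mu> p\<mu> span_diff span_base by blast
      then have "(1/\<epsilon>) *\<^sub>R (z t - p) \<in> span \<mu>" by (rule span_scale)
      then have w: "(1 - t) *\<^sub>R x + t *\<^sub>R y \<in> span \<mu>" using \<epsilon> by (simp add: z_def)
      show False
      proof (cases "t = 0")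
        case True
        then show ?thesis using w x\<mu>[OF \<mu>s] by simp
      next
        case False
        have "(1 - t) *\<^sub>R x + t *\<^sub>R y \<in> span (insert x \<mu>)" using w span_mono[of \<mu> "insert x \<mu>"] by blast
        moreover have "(1 - t) *\<^sub>R x \<in> span (insert x \<mu>)" by (simp add: span_scale span_base)
        ultimately have "((1 - t) *\<^sub>R x + t *\<^sub>R y) - (1 - t) *\<^sub>R x \<in> span (insert x \<mu>)" by (rule span_diff)
        then have "t *\<^sub>R y \<in> span (insert x \<mu>)" by simp
        then have "(1/t) *\<^sub>R (t *\<^sub>R y) \<in> span (insert x \<mu>)" by (rule span_scale)
        then show ?thesis using y\<mu>[OF \<mu>s] False by simp
      qed
    qed
    then have "dim \<mu> + 1 = fan_dim F' \<or> dim \<mu> = fan_dim F'" 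
      using \<mu>(1) fan_dim_ge[OF rF' \<mu>(1)] unfolding small_def by simp linarith
    then show False
    proof
      assume "dim \<mu> = fan_dim F'"
      then have "\<mu> \<in> facets F'" using \<mu>(1) by (simp add: facets_def)
      then have "\<sigma>a = \<mu>" "\<sigma>b = \<mu>" using facet_dim_ge[OF rF' facet_cone] fa(1) fb(1) sub by blast+
      then show False using h(5) by simp
    next
      assume "dim \<mu> + 1 = fan_dim F'"
      then have "\<mu> \<in> ridges F'" using \<mu>(1) by (simp add: ridges_def)
      then show False 
        using forms_agree_across_ridge[OF g _ star[OF \<mu>(1) p\<mu>] fa(1) fb(1) sub \<sigma> fa(2) fb(2) v] h(5) by blast
    qed
  qed
  have c: "connected {0..1::real}" by simp
  have "z 0 = p + \<epsilon> *\<^sub>R x" "z 1 = p + \<epsilon> *\<^sub>R y" by (simp_all add: z_def)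
  then have ends: "z 0 \<in> \<sigma>1" "z 1 \<in> \<sigma>2"
    using \<sigma>12(3,4) x(1) y(1) \<epsilon> fan_cone(2)[OF rF' facet_cone[OF \<sigma>12(1)]] fan_cone(2)[OF rF' facet_cone[OF \<sigma>12(2)]]
    by (simp_all add: convex_cone_add convex_cone_scaleR)
  have "0 \<in> Tm \<sigma>1" "1 \<in> Tm \<sigma>2" using ends by (auto simp: Tm_def)
  moreover have "\<sigma>1 \<in> S" "\<sigma>2 \<in> S" using \<sigma>12 by (auto simp: S_def)
  ultimately have "0 \<in> A" "1 \<in> B" unfolding A_def B_def using neq by auto
  then have "A \<inter> {0..1} \<noteq> {}" "B \<inter> {0..1} \<noteq> {}" by auto
  moreover have "A \<inter> B \<inter> {0..1} = {}" using disj by blast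
  ultimately show False using c closedAB cover unfolding connected_closed by blast
qed

text \<open>Each facet of \<open>F\<close> around \<open>\<tau>\<close> contains exactly one facet
  of \<open>F'\<close> around \<open>\<tau>'\<close>. Existence comes from
  \<open>subdividing_cone_at\<close> at an interior point of \<open>\<tau>'\<close>; two such facets
  would be on opposite sides of \<open>\<tau>'\<close>, which is impossible since
  \<open>\<tau>\<close> is a face of \<open>\<sigma>\<close>.\<close>

lemma ridge_facets_bij:
  assumes \<tau>: "\<tau> \<in> ridges F" and \<tau>': "\<tau>' \<in> cones F'" "\<tau>' \<subseteq> \<tau>" "span \<tau>' = span \<tau>"
  obtains h where "bij_betw h {\<sigma>'. \<sigma>' \<in> facets F' \<and> \<tau>' \<subseteq> \<sigma>'} {\<sigma>. \<sigma> \<in> facets F \<and> \<tau> \<subseteq> \<sigma>}"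
    "\<And>\<sigma>'. \<sigma>' \<in> facets F' \<Longrightarrow> \<tau>' \<subseteq> \<sigma>' \<Longrightarrow> \<sigma>' \<subseteq> h \<sigma>'"
proof -
  have r': "\<tau>' \<in> ridges F'" using facet_span_iff(2)[OF ridge_cone[OF \<tau>] \<tau>'(1,3)] \<tau> by blast
  define h where "h \<sigma>' = (SOME \<sigma>. \<sigma> \<in> facets F \<and> \<sigma>' \<subseteq> \<sigma>)" for \<sigma>'
  have h: "h \<sigma>' \<in> facets F" "\<sigma>' \<subseteq> h \<sigma>'" if "\<sigma>' \<in> facets F'" for \<sigma>'
  proof -
    have "\<exists>\<sigma>. \<sigma> \<in> facets F \<and> \<sigma>' \<subseteq> \<sigma>" using in_facet[OF \<open>\<sigma>' \<in> facets F'\<close>] by metis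
    then have "h \<sigma>' \<in> facets F \<and> \<sigma>' \<subseteq> h \<sigma>'" unfolding h_def by (rule someI_ex)
    then show "h \<sigma>' \<in> facets F" "\<sigma>' \<subseteq> h \<sigma>'" by blast+
  qed
  have h_eq: "h \<sigma>' = \<sigma>" if "\<sigma>' \<in> facets F'" "\<sigma> \<in> facets F" "\<sigma>' \<subseteq> \<sigma>" for \<sigma>' \<sigma>
    using in_facet_unique[OF that(1) h(1)[OF that(1)] that(2) h(2)[OF that(1)] that(3)] .
  obtain p where p: "p \<in> arint \<tau>'" using fan_cone(3)[OF rF' \<tau>'(1)] by blast
  have p\<tau>': "p \<in> \<tau>'" using p arint_subset by blast
  \<comment> \<open>Stepping back along a vector of \<open>\<tau>\<close> is a move inside
    \<open>span \<tau>'\<close>, and for small steps it stays in \<open>\<tau>'\<close>.\<close>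
  have p\<tau>: "p \<in> arint \<tau>" unfolding arint_def
  proof (intro CollectI conjI ballI)
    show "p \<in> \<tau>" using p\<tau>' \<tau>'(2) by blast
    fix y assume "y \<in> \<tau>"
    then have "- y \<in> span \<tau>'" unfolding \<tau>'(3) by (simp add: span_neg span_base)
    then obtain e where "e > 0" "\<And>t. 0 \<le> t \<Longrightarrow> t \<le> e \<Longrightarrow> p + t *\<^sub>R (- y) \<in> \<tau>'"
      using arint_span[OF fan_cone(2)[OF rF' \<tau>'(1)] p] by blast
    then show "\<exists>e>0. p - e *\<^sub>R y \<in> \<tau>" using \<tau>'(2) by (intro exI[of _ e]) force
  qed
  have h\<tau>: "\<tau> \<subseteq> h \<sigma>'" if "\<sigma>' \<in> facets F'" "\<tau>' \<subseteq> \<sigma>'" for \<sigma>'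
    using fan_arint_subset[OF rF ridge_cone[OF \<tau>] facet_cone[OF h(1)[OF that(1)]] p\<tau>] h(2)[OF that(1)] that(2) p\<tau>' by blast
  have "inj_on h {\<sigma>'. \<sigma>' \<in> facets F' \<and> \<tau>' \<subseteq> \<sigma>'}"
  proof (rule inj_onI)
    fix \<sigma>1 \<sigma>2 assume "\<sigma>1 \<in> {\<sigma>'. \<sigma>' \<in> facets F' \<and> \<tau>' \<subseteq> \<sigma>'}" "\<sigma>2 \<in> {\<sigma>'. \<sigma>' \<in> facets F' \<and> \<tau>' \<subseteq> \<sigma>'}" and heq: "h \<sigma>1 = h \<sigma>2"
    then have \<sigma>12: "\<sigma>1 \<in> facets F'" "\<sigma>2 \<in> facets F'" "\<tau>' \<subseteq> \<sigma>1" "\<tau>' \<subseteq> \<sigma>2" by auto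
    define \<sigma> where "\<sigma> = h \<sigma>1"
    have \<sigma>: "\<sigma> \<in> facets F" "\<sigma>1 \<subseteq> \<sigma>" "\<sigma>2 \<subseteq> \<sigma>" "\<tau> \<subseteq> \<sigma>" 
      using h[OF \<sigma>12(1)] h(2)[OF \<sigma>12(2)] heq h\<tau>[OF \<sigma>12(1,3)] by (simp_all add: \<sigma>_def)
    have \<sigma>F: "\<sigma> \<in> cones F" using facet_cone[OF \<sigma>(1)] .
    have sp: "span \<sigma>1 = span \<sigma>" "span \<sigma>2 = span \<sigma>" using facet_in(2) \<sigma>F \<sigma> \<sigma>12 by blast+
    show "\<sigma>1 = \<sigma>2"
    proof (rule ccontr)
      assume ne: "\<sigma>1 \<noteq> \<sigma>2"
      obtain s1 where s1: "s1 \<in> \<sigma>1" "s1 \<notin> span \<tau>'" "span \<sigma>1 = span (insert s1 \<tau>')"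
        by (rule ridge_facet_witness[OF r' \<sigma>12(1,3)])
      obtain s2 where s2: "s2 \<in> \<sigma>2" "s2 \<notin> span \<tau>'" "span \<sigma>2 = span (insert s2 \<tau>')"
        by (rule ridge_facet_witness[OF r' \<sigma>12(2,4)])
      have s2s1: "s2 \<in> span (insert s1 \<tau>')" using sp s1(3) span_base[OF s2(1)] by simp
      obtain c where c: "c > 0" "s2 + c *\<^sub>R s1 \<in> span \<tau>'"
        by (rule opposite_sides[OF r' \<sigma>12 ne s1(1) s2(1,2) s2s1])
      have "s2 \<in> \<tau>"
      proof (rule extremal_sum_span(1)[OF fan_extremal[OF rF ridge_cone[OF \<tau>] \<sigma>F \<sigma>(4)] 
            fan_cone(2)[OF rF ridge_cone[OF \<tau>]] fan_cone(2)[OF rF \<sigma>F] fan_cone(3)[OF rF ridge_cone[OF \<tau>]]])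
        show "s2 \<in> \<sigma>" using s2(1) \<sigma>(3) by blast
        show "c *\<^sub>R s1 \<in> \<sigma>" using s1(1) \<sigma>(2) c(1) by (intro convex_cone_scaleR[OF fan_cone(2)[OF rF \<sigma>F]]) auto
        show "s2 + c *\<^sub>R s1 \<in> span \<tau>" using c(2) \<tau>'(3) by simp
      qed
      then show False using s2(2) \<tau>'(3) span_base by blast
    qed
  qed
  moreover have "h ` {\<sigma>'. \<sigma>' \<in> facets F' \<and> \<tau>' \<subseteq> \<sigma>'} = {\<sigma>. \<sigma> \<in> facets F \<and> \<tau> \<subseteq> \<sigma>}"
  proof (intro equalityI subsetI)
    fix \<sigma> assume "\<sigma> \<in> h ` {\<sigma>'. \<sigma>' \<in> facets F' \<and> \<tau>' \<subseteq> \<sigma>'}"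
    then show "\<sigma> \<in> {\<sigma>. \<sigma> \<in> facets F \<and> \<tau> \<subseteq> \<sigma>}" using h(1) h\<tau> by blast
  next
    fix \<sigma> assume "\<sigma> \<in> {\<sigma>. \<sigma> \<in> facets F \<and> \<tau> \<subseteq> \<sigma>}"
    then have \<sigma>: "\<sigma> \<in> facets F" "\<tau> \<subseteq> \<sigma>" by auto
    have "p \<in> \<sigma>" using p\<tau>' \<tau>'(2) \<sigma>(2) by blast
    then obtain \<sigma>' where \<sigma>': "\<sigma>' \<in> cones F'" "p \<in> \<sigma>'" "\<sigma>' \<subseteq> \<sigma>" "span \<sigma>' = span \<sigma>"
      by (rule subdividing_cone_at[OF facet_cone[OF \<sigma>(1)]])
    have f': "\<sigma>' \<in> facets F'" using facet_span_iff(1)[OF facet_cone[OF \<sigma>(1)] \<sigma>'(1,4)] \<sigma>(1) by blast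
    have "\<tau>' \<subseteq> \<sigma>'" using fan_arint_subset[OF rF' \<tau>'(1) \<sigma>'(1) p \<sigma>'(2)] .
    then show "\<sigma> \<in> h ` {\<sigma>'. \<sigma>' \<in> facets F' \<and> \<tau>' \<subseteq> \<sigma>'}" using h_eq[OF f' \<sigma>(1) \<sigma>'(3)] f' by blast
  qed
  ultimately have "bij_betw h {\<sigma>'. \<sigma>' \<in> facets F' \<and> \<tau>' \<subseteq> \<sigma>'} {\<sigma>. \<sigma> \<in> facets F \<and> \<tau> \<subseteq> \<sigma>}"
    by (simp add: bij_betw_def)
  then show ?thesis using that h(2) by blast
qed

text \<open>The lattices agree, and so do the spans of corresponding cones; a normal vector for
  \<open>\<tau>'\<close> and a facet \<open>\<sigma>'\<close> is therefore also one for
  \<open>\<tau>\<close> and the facet of \<open>F\<close> around it, and the sums match term by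
  term.\<close>

lemma balanced_ridge_iff:
  assumes \<tau>: "\<tau> \<in> ridges F" "\<eta> \<subseteq> \<tau>" and \<tau>': "\<tau>' \<in> cones F'" "\<tau>' \<subseteq> \<tau>" "span \<tau>' = span \<tau>" "\<eta>' \<subseteq> \<tau>'"
    and l: "local_family F \<eta> l" and g: "local_family F' \<eta>' g"
    and ridge_form: "\<And>x. x \<in> span \<tau> \<Longrightarrow> g \<tau>' x = l \<tau> x"
    and facet_form: "\<And>\<sigma> \<sigma>' x. \<sigma> \<in> facets F \<Longrightarrow> \<sigma>' \<in> facets F' \<Longrightarrow> \<tau> \<subseteq> \<sigma> \<Longrightarrow> \<tau>' \<subseteq> \<sigma>' \<Longrightarrow> \<sigma>' \<subseteq> \<sigma> \<Longrightarrow> 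
      x \<in> span \<sigma> \<Longrightarrow> g \<sigma>' x = l \<sigma> x"
  shows "balanced_at F' \<tau>' g \<longleftrightarrow> balanced_at F \<tau> l"
proof -
  define A' where "A' = {\<sigma>'. \<sigma>' \<in> facets F' \<and> \<tau>' \<subseteq> \<sigma>'}"
  define A where "A = {\<sigma>. \<sigma> \<in> facets F \<and> \<tau> \<subseteq> \<sigma>}"
  obtain h where h0: "bij_betw h {\<sigma>'. \<sigma>' \<in> facets F' \<and> \<tau>' \<subseteq> \<sigma>'} {\<sigma>. \<sigma> \<in> facets F \<and> \<tau> \<subseteq> \<sigma>}"
    "\<And>\<sigma>'. \<sigma>' \<in> facets F' \<Longrightarrow> \<tau>' \<subseteq> \<sigma>' \<Longrightarrow> \<sigma>' \<subseteq> h \<sigma>'"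
    using ridge_facets_bij[OF \<tau>(1) \<tau>'(1-3)] by blast
  have h: "bij_betw h A' A" "\<sigma>' \<in> A' \<Longrightarrow> \<sigma>' \<subseteq> h \<sigma>'" for \<sigma>'
    using h0 by (simp_all add: A_def A'_def)
  have r': "\<tau>' \<in> ridges F'" using facet_span_iff(2)[OF ridge_cone[OF \<tau>(1)] \<tau>'(1,3)] \<tau>(1) by blast
  define n' where "n' = normal_vector (lat F') \<tau>'"
  have n': "is_normal_vector (lat F') \<tau>' \<sigma>' (n' \<sigma>')" if "\<sigma>' \<in> facets F'" "\<tau>' \<subseteq> \<sigma>'" for \<sigma>'
    using ridge_facet_normal[OF rF' r' that] by (simp add: n'_def)
  define n where "n \<sigma> = n' (inv_into A' h \<sigma>)" for \<sigma>
  have nh: "n (h \<sigma>') = n' \<sigma>'" if "\<sigma>' \<in> A'" for \<sigma>'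
    using inv_into_f_f[OF bij_betw_imp_inj_on[OF h(1)] that] by (simp add: n_def)
  have spans: "span \<sigma>' = span (h \<sigma>')" if "\<sigma>' \<in> A'" for \<sigma>'
    using facet_in(2)[of \<sigma>' "h \<sigma>'"] h(2)[OF that] bij_betwE[OF h(1)] that facet_cone by (auto simp: A_def A'_def)
  have n: "is_normal_vector (lat F) \<tau> \<sigma> (n \<sigma>)" if \<sigma>: "\<sigma> \<in> facets F" "\<tau> \<subseteq> \<sigma>" for \<sigma>
  proof -
    have "\<sigma> \<in> h ` A'" using \<sigma> bij_betw_imp_surj_on[OF h(1)] by (simp add: A_def)
    then obtain \<sigma>' where \<sigma>': "\<sigma>' \<in> A'" "\<sigma> = h \<sigma>'" by blast
    have "is_normal_vector (lat F') \<tau>' \<sigma>' (n' \<sigma>')" using n' \<sigma>'(1) by (simp add: A'_def)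
    then show ?thesis
      unfolding \<sigma>'(2) nh[OF \<sigma>'(1)] is_normal_vector_def lat_of_def lat_eq \<tau>'(3) spans[OF \<sigma>'(1)] using h(2)[OF \<sigma>'(1)] by blast
  qed
  have sum_n: "(\<Sum>\<sigma>\<in>A. n \<sigma>) = (\<Sum>\<sigma>'\<in>A'. n' \<sigma>')"
    unfolding sum.reindex_bij_betw[OF h(1), symmetric] using nh by (intro sum.cong) auto
  have sum_l: "(\<Sum>\<sigma>\<in>A. l \<sigma> (n \<sigma>)) = (\<Sum>\<sigma>'\<in>A'. g \<sigma>' (n' \<sigma>'))"
    unfolding sum.reindex_bij_betw[OF h(1), symmetric]
  proof (rule sum.cong[OF refl])
    fix \<sigma>' assume s': "\<sigma>' \<in> A'"
    have "h \<sigma>' \<in> A" using bij_betwE[OF h(1)] s' by blast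
    moreover have "n' \<sigma>' \<in> span (h \<sigma>')" 
      using normal_vector_span[OF n'[of \<sigma>']] s' spans[OF s'] by (simp add: A'_def)
    ultimately show "l (h \<sigma>') (n (h \<sigma>')) = g \<sigma>' (n' \<sigma>')"
      using facet_form[of "h \<sigma>'" \<sigma>' "n' \<sigma>'"] s' h(2)[OF s'] nh[OF s'] by (simp add: A_def A'_def)
  qed
  have "(\<Sum>\<sigma>'\<in>A'. n' \<sigma>') \<in> span \<tau>" 
    using normal_sum_in_span[OF F' r' n'] \<tau>'(3) by (simp add: A'_def)
  then have rhs: "g \<tau>' (\<Sum>\<sigma>'\<in>A'. n' \<sigma>') = l \<tau> (\<Sum>\<sigma>\<in>A. n \<sigma>)" using ridge_form sum_n by simp
  show ?thesis
  proof
    assume "balanced_at F' \<tau>' g"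
    then have "(\<Sum>\<sigma>'\<in>A'. g \<sigma>' (n' \<sigma>')) = g \<tau>' (\<Sum>\<sigma>'\<in>A'. n' \<sigma>')"
      using balanced_any_normals[OF rF' g r' \<tau>'(4) _ n'] by (simp add: A'_def)
    then show "balanced_at F \<tau> l" unfolding balanced_at_def using n sum_l rhs by (intro exI[of _ n]) (simp add: A_def)
  next
    assume "balanced_at F \<tau> l"
    then have "(\<Sum>\<sigma>\<in>A. l \<sigma> (n \<sigma>)) = l \<tau> (\<Sum>\<sigma>\<in>A. n \<sigma>)"
      using balanced_any_normals[OF rF l \<tau> _ n] by (simp add: A_def)
    then show "balanced_at F' \<tau>' g" unfolding balanced_at_def using n' sum_l rhs by (intro exI[of _ n']) (simp add: A'_def)
  qed
qed

lemma arint_mono_span: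
  assumes "\<kappa>' \<in> cones F'" "\<kappa>' \<subseteq> \<kappa>" "span \<kappa>' = span \<kappa>"
  shows "arint \<kappa>' \<subseteq> arint \<kappa>"
proof
  fix p assume p: "p \<in> arint \<kappa>'"
  show "p \<in> arint \<kappa>" unfolding arint_def
  proof (intro CollectI conjI ballI)
    show "p \<in> \<kappa>" using p arint_subset assms(2) by blast
    fix y assume "y \<in> \<kappa>"
    then have "- y \<in> span \<kappa>'" unfolding assms(3) by (simp add: span_neg span_base)
    then obtain e where "e > 0" "\<And>t. 0 \<le> t \<Longrightarrow> t \<le> e \<Longrightarrow> p + t *\<^sub>R (- y) \<in> \<kappa>'"
      using arint_span[OF fan_cone(2)[OF rF' assms(1)] p] by blast
    then show "\<exists>e>0. p - e *\<^sub>R y \<in> \<kappa>" using assms(2) by (intro exI[of _ e]) force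
  qed
qed

text \<open>The forms are restricted to the finer cones. A ridge of \<open>F'\<close> either spans
  the same space as a ridge of \<open>F\<close>, where balancing is inherited, or has interior
  points in the interior of a facet of \<open>F\<close>, where all forms involved come from a single
  one and balancing holds by linearity.\<close>

lemma local_faithful_coarse:
  assumes lf: "\<And>\<eta>'. \<eta>' \<in> cones F' \<Longrightarrow> local_faithful F' \<eta>'" and \<eta>: "\<eta> \<in> cones F"
  shows "local_faithful F \<eta>"
proof (rule local_faithfulI)
  fix g assume g: "local_family F \<eta> g" and gb: "\<And>\<tau>. \<tau> \<in> ridges F \<Longrightarrow> \<eta> \<subseteq> \<tau> \<Longrightarrow> balanced_at F \<tau> g"
  \<comment> \<open>\<open>\<eta>'\<close> has the same span as \<open>\<eta>\<close>, so an
    interior point \<open>q\<close> of it is interior to \<open>\<eta>\<close> as well. This forces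
    cones of \<open>F\<close> that contain \<open>\<eta>'\<close> to contain
    \<open>\<eta>\<close>.\<close>
  obtain \<eta>' where "\<eta>' \<in> cones F'" "0 \<in> \<eta>'" "\<eta>' \<subseteq> \<eta>" "span \<eta>' = span \<eta>"
    by (rule subdividing_cone_at[OF \<eta> fan_cone(4)[OF rF \<eta>]])
  then have \<eta>': "\<eta>' \<in> cones F'" "\<eta>' \<subseteq> \<eta>" "span \<eta>' = span \<eta>" by blast+
  obtain q where q': "q \<in> arint \<eta>'" using fan_cone(3)[OF rF' \<eta>'(1)] by blast
  have q: "q \<in> arint \<eta>" using arint_mono_span[OF \<eta>'] q' by blast
  define up where "up \<kappa>' = (SOME \<kappa>. \<kappa> \<in> cones F \<and> \<kappa>' \<subseteq> \<kappa>)" for \<kappa>'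
  have up: "up \<kappa>' \<in> cones F" "\<kappa>' \<subseteq> up \<kappa>'" if \<kappa>': "\<kappa>' \<in> cones F'" for \<kappa>'
  proof -
    have "\<exists>\<kappa>. \<kappa> \<in> cones F \<and> \<kappa>' \<subseteq> \<kappa>" using in_cone[OF \<kappa>'] by blast
    then have "up \<kappa>' \<in> cones F \<and> \<kappa>' \<subseteq> up \<kappa>'" unfolding up_def by (rule someI_ex)
    then show "up \<kappa>' \<in> cones F" "\<kappa>' \<subseteq> up \<kappa>'" by blast+
  qed
  have star: "\<eta> \<subseteq> \<kappa>" if "\<kappa> \<in> cones F" "\<kappa>' \<subseteq> \<kappa>" "\<eta>' \<subseteq> \<kappa>'" for \<kappa> \<kappa>'
  proof -
    have "q \<in> \<kappa>" using q' arint_subset that by blast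
    then show ?thesis using fan_arint_subset[OF rF \<eta> that(1) q] by blast
  qed
  define g' where "g' \<kappa>' = g (up \<kappa>')" for \<kappa>'
  \<comment> \<open>The arbitrary choice in \<open>up\<close> is harmless: two cones of
    \<open>F\<close> containing \<open>\<kappa>'\<close> meet in a cone that contains
    \<open>\<kappa>'\<close> and \<open>\<eta>\<close>, and compatibility applies through
    it.\<close>
  have key: "g' \<kappa>' x = g \<kappa> x" if h: "\<kappa>' \<in> cones F'" "\<eta>' \<subseteq> \<kappa>'" "\<kappa> \<in> cones F" "\<kappa>' \<subseteq> \<kappa>" "x \<in> span \<kappa>'" for \<kappa>' \<kappa> x
  proof -
    define \<mu> where "\<mu> = up \<kappa>' \<inter> \<kappa>"
    have \<mu>: "\<mu> \<in> cones F" "\<kappa>' \<subseteq> \<mu>" "\<mu> \<subseteq> up \<kappa>'" "\<mu> \<subseteq> \<kappa>"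
      using fan_inter(1)[OF rF up(1)[OF h(1)] h(3)] up(2)[OF h(1)] h(4) by (auto simp: \<mu>_def)
    have \<eta>\<mu>: "\<eta> \<subseteq> \<mu>" using star[OF \<mu>(1,2) h(2)] .
    have x: "x \<in> span \<mu>" using span_mono[OF \<mu>(2)] h(5) by blast
    show ?thesis unfolding g'_def
      using local_family_compat[OF g \<mu>(1) up(1)[OF h(1)] \<eta>\<mu> \<mu>(3) x] 
        local_family_compat[OF g \<mu>(1) h(3) \<eta>\<mu> \<mu>(4) x] by simp
  qed
  have g': "local_family F' \<eta>' g'" unfolding local_family_def
  proof (intro conjI ballI impI)
    fix \<kappa>' assume h: "\<kappa>' \<in> cones F'" "\<eta>' \<subseteq> \<kappa>'"
    note u = up[OF h(1)] star[OF up[OF h(1)] h(2)]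
    show "linear (g' \<kappa>')" unfolding g'_def by (rule local_family_linear[OF g u(1,3)])
    show "g' \<kappa>' x \<in> \<rat>" if "x \<in> lat_of (lat F') \<kappa>'" for x
      unfolding g'_def using that span_mono[OF u(2)]
      by (intro local_family_rational[OF g u(1,3)]) (auto simp: lat_of_def lat_eq)
  next
    fix \<kappa>1 \<kappa>2 x assume h: "\<kappa>1 \<in> cones F'" "\<kappa>2 \<in> cones F'" "\<eta>' \<subseteq> \<kappa>1" "\<kappa>1 \<subseteq> \<kappa>2" "x \<in> \<kappa>1"
    have "g' \<kappa>1 x = g (up \<kappa>2) x"
      using up[OF h(2)] h span_base[OF h(5)] by (intro key) auto
    then show "g' \<kappa>1 x = g' \<kappa>2 x" by (simp add: g'_def)
  qed
  have "balanced_at F' \<tau>' g'" if \<tau>': "\<tau>' \<in> ridges F'" "\<eta>' \<subseteq> \<tau>'" for \<tau>'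
  proof -
    have c': "\<tau>' \<in> cones F'" using ridge_cone[OF \<tau>'(1)] .
    obtain z where z: "z \<in> arint \<tau>'" using fan_cone(3)[OF rF' c'] by blast
    have z\<tau>': "z \<in> \<tau>'" using z arint_subset by blast
    have "z \<in> support F" unfolding support_eq[symmetric] using z\<tau>' c' by (auto simp: support_def)
    then obtain \<zeta> where \<zeta>: "\<zeta> \<in> cones F" "z \<in> arint \<zeta>" using fan_min_cone[OF rF] by blast
    have \<tau>'\<zeta>: "\<tau>' \<subseteq> \<zeta>" using arint_in_cone[OF c' \<zeta>(1) z] \<zeta>(2) arint_subset by blast
    have \<eta>\<zeta>: "\<eta> \<subseteq> \<zeta>" using star[OF \<zeta>(1) \<tau>'\<zeta> \<tau>'(2)] .
    have d: "dim \<tau>' + 1 = fan_dim F" using \<tau>'(1) by (simp add: ridges_def fan_dim_eq')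
    show ?thesis
    proof (cases "dim \<tau>' = dim \<zeta>")
      case True
      then have sp: "span \<tau>' = span \<zeta>" using fan_dim_mono(2)[OF rF \<zeta>(1) \<tau>'\<zeta>] by blast
      have r: "\<zeta> \<in> ridges F" using facet_span_iff(2)[OF \<zeta>(1) c' sp] \<tau>'(1) by blast
      have "balanced_at F' \<tau>' g' \<longleftrightarrow> balanced_at F \<zeta> g"
      proof (rule balanced_ridge_iff[OF r \<eta>\<zeta> c' \<tau>'\<zeta> sp \<tau>'(2) g g'])
        show "g' \<tau>' x = g \<zeta> x" if "x \<in> span \<zeta>" for x
          using key[OF c' \<tau>'(2) \<zeta>(1) \<tau>'\<zeta>] that sp by blast
        show "g' \<sigma>' x = g \<sigma> x" 
          if "\<sigma> \<in> facets F" "\<sigma>' \<in> facets F'" "\<zeta> \<subseteq> \<sigma>" "\<tau>' \<subseteq> \<sigma>'" "\<sigma>' \<subseteq> \<sigma>" "x \<in> span \<sigma>" for \<sigma> \<sigma>' x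
          using key[of \<sigma>' \<sigma> x] facet_in(2)[of \<sigma>' \<sigma>] facet_cone that \<tau>'(2) by blast
      qed
      then show ?thesis using gb[OF r \<eta>\<zeta>] by blast
    next
      case False
      then have "dim \<zeta> = fan_dim F" 
        using fan_dim_mono(1)[OF rF \<zeta>(1) \<tau>'\<zeta>] fan_dim_ge[OF rF \<zeta>(1)] d by simp
      then have \<zeta>f: "\<zeta> \<in> facets F" using \<zeta>(1) by (simp add: facets_def)
      define n where "n = normal_vector (lat F') \<tau>'"
      have n: "is_normal_vector (lat F') \<tau>' \<sigma>' (n \<sigma>')" if "\<sigma>' \<in> facets F'" "\<tau>' \<subseteq> \<sigma>'" for \<sigma>'
        using ridge_facet_normal[OF rF' \<tau>'(1) that] by (simp add: n_def)
      have "g' \<sigma>' (n \<sigma>') = g \<zeta> (n \<sigma>')" if s: "\<sigma>' \<in> facets F'" "\<tau>' \<subseteq> \<sigma>'" for \<sigma>'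
      proof -
        obtain \<psi> where \<psi>: "\<psi> \<in> facets F" "\<sigma>' \<subseteq> \<psi>" by (rule in_facet[OF s(1)])
        have "\<zeta> \<subseteq> \<psi>" using fan_arint_subset[OF rF \<zeta>(1) facet_cone[OF \<psi>(1)] \<zeta>(2)] z\<tau>' s(2) \<psi>(2) by blast
        then have "\<psi> = \<zeta>" using facet_dim_ge[OF rF facet_cone[OF \<psi>(1)] \<zeta>f] by blast
        then show ?thesis
          using key[OF facet_cone[OF s(1)] _ \<zeta>(1) _ normal_vector_span[OF n[OF s]]] \<psi>(2) \<tau>'(2) s(2) by blast
      qed
      then have "(\<Sum>\<sigma>' | \<sigma>' \<in> facets F' \<and> \<tau>' \<subseteq> \<sigma>'. g' \<sigma>' (n \<sigma>')) = (\<Sum>\<sigma>' | \<sigma>' \<in> facets F' \<and> \<tau>' \<subseteq> \<sigma>'. g \<zeta> (n \<sigma>'))"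
        by (intro sum.cong) auto
      also have "\<dots> = g \<zeta> (\<Sum>\<sigma>' | \<sigma>' \<in> facets F' \<and> \<tau>' \<subseteq> \<sigma>'. n \<sigma>')"
        by (simp add: linear_sum[OF local_family_linear[OF g \<zeta>(1) \<eta>\<zeta>]])
      also have "\<dots> = g' \<tau>' (\<Sum>\<sigma>' | \<sigma>' \<in> facets F' \<and> \<tau>' \<subseteq> \<sigma>'. n \<sigma>')"
        using key[OF c' \<tau>'(2) \<zeta>(1) \<tau>'\<zeta> normal_sum_in_span[OF F' \<tau>'(1) n]] by simp
      finally show ?thesis unfolding balanced_at_def using n by (intro exI[of _ n]) simp
    qed
  qed
  then obtain L where L: "linear L" "\<And>\<kappa>' x. \<kappa>' \<in> cones F' \<Longrightarrow> \<eta>' \<subseteq> \<kappa>' \<Longrightarrow> x \<in> span \<kappa>' \<Longrightarrow> g' \<kappa>' x = L x"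
    using local_faithfulD[OF lf[OF \<eta>'(1)] g'] by blast
  have "g \<sigma> x = L x" if s: "\<sigma> \<in> cones F" "\<eta> \<subseteq> \<sigma>" "x \<in> \<sigma>" for \<sigma> x
  proof -
    have "q \<in> \<sigma>" using q arint_subset s(2) by blast
    then obtain \<kappa>' where \<kappa>': "\<kappa>' \<in> cones F'" "q \<in> \<kappa>'" "\<kappa>' \<subseteq> \<sigma>" "span \<kappa>' = span \<sigma>"
      by (rule subdividing_cone_at[OF s(1)])
    have e: "\<eta>' \<subseteq> \<kappa>'" using fan_arint_subset[OF rF' \<eta>'(1) \<kappa>'(1) q' \<kappa>'(2)] .
    have x: "x \<in> span \<kappa>'" unfolding \<kappa>'(4) by (rule span_base[OF s(3)])
    show ?thesis using key[OF \<kappa>'(1) e s(1) \<kappa>'(3) x] L(2)[OF \<kappa>'(1) e x] by simp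
  qed
  then show "\<exists>L. linear L \<and> (\<forall>\<sigma>\<in>cones F. \<eta> \<subseteq> \<sigma> \<longrightarrow> (\<forall>x\<in>\<sigma>. g \<sigma> x = L x))" using L(1) by blast
qed

text \<open>The family on \<open>F'\<close> is made into one on \<open>F\<close> by using, for a
  cone \<open>\<kappa>\<close>, the form of a finer cone with the same span through the interior
  point \<open>p\<close> of \<open>\<eta>'\<close>; \<open>forms_agree_in_facet\<close> makes this
  consistent. The faithfulness used is that at \<open>\<zeta>\<close>, the cone of \<open>F\<close>
  with \<open>p\<close> in its interior.\<close>

lemma local_faithful_fine:
  assumes lf: "\<And>\<eta>. \<eta> \<in> cones F \<Longrightarrow> local_faithful F \<eta>" and \<eta>': "\<eta>' \<in> cones F'"
  shows "local_faithful F' \<eta>'"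
proof (rule local_faithfulI)
  fix g assume g: "local_family F' \<eta>' g" and gb: "\<And>\<tau>. \<tau> \<in> ridges F' \<Longrightarrow> \<eta>' \<subseteq> \<tau> \<Longrightarrow> balanced_at F' \<tau> g"
  obtain p where p: "p \<in> arint \<eta>'" using fan_cone(3)[OF rF' \<eta>'] by blast
  have p\<eta>': "p \<in> \<eta>'" using p arint_subset by blast
  have star: "\<eta>' \<subseteq> \<kappa>'" if "\<kappa>' \<in> cones F'" "p \<in> \<kappa>'" for \<kappa>'
    using fan_arint_subset[OF rF' \<eta>' that(1) p that(2)] .
  have "p \<in> support F" unfolding support_eq[symmetric] using p\<eta>' \<eta>' by (auto simp: support_def)
  then obtain \<zeta> where \<zeta>: "\<zeta> \<in> cones F" "p \<in> arint \<zeta>" using fan_min_cone[OF rF] by blast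
  have p\<zeta>: "p \<in> \<zeta>" using \<zeta>(2) arint_subset by blast
  define pick where "pick \<kappa> = (SOME \<kappa>'. \<kappa>' \<in> cones F' \<and> p \<in> \<kappa>' \<and> \<kappa>' \<subseteq> \<kappa> \<and> span \<kappa>' = span \<kappa>)" for \<kappa>
  have pick: "pick \<kappa> \<in> cones F'" "p \<in> pick \<kappa>" "pick \<kappa> \<subseteq> \<kappa>" "span (pick \<kappa>) = span \<kappa>" "\<eta>' \<subseteq> pick \<kappa>"
    if \<kappa>: "\<kappa> \<in> cones F" "p \<in> \<kappa>" for \<kappa>
  proof -
    have "\<exists>\<kappa>'. \<kappa>' \<in> cones F' \<and> p \<in> \<kappa>' \<and> \<kappa>' \<subseteq> \<kappa> \<and> span \<kappa>' = span \<kappa>" 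
      using subdividing_cone_at[OF \<kappa>] by metis
    then have "pick \<kappa> \<in> cones F' \<and> p \<in> pick \<kappa> \<and> pick \<kappa> \<subseteq> \<kappa> \<and> span (pick \<kappa>) = span \<kappa>"
      unfolding pick_def by (rule someI_ex)
    then show "pick \<kappa> \<in> cones F'" "p \<in> pick \<kappa>" "pick \<kappa> \<subseteq> \<kappa>" "span (pick \<kappa>) = span \<kappa>" "\<eta>' \<subseteq> pick \<kappa>"
      using star by blast+
  qed
  define G where "G \<kappa> = g (pick \<kappa>)" for \<kappa>
  \<comment> \<open>\<open>pick \<kappa>\<close> need not be a face of the given facet
    \<open>\<sigma>'\<close>. It is a face of another facet inside \<open>\<sigma>\<close>, found
    through an interior point of \<open>pick \<kappa>\<close>, and the forms of the two facets agree
    on \<open>span \<sigma>\<close>.\<close>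
  have key: "G \<kappa> x = g \<sigma>' x" 
    if \<kappa>: "\<kappa> \<in> cones F" "p \<in> \<kappa>" and \<sigma>: "\<sigma> \<in> facets F" "\<kappa> \<subseteq> \<sigma>" 
      and \<sigma>': "\<sigma>' \<in> facets F'" "p \<in> \<sigma>'" "\<sigma>' \<subseteq> \<sigma>" and x: "x \<in> span \<kappa>" for \<kappa> \<sigma> \<sigma>' x
  proof -
    note k = pick[OF \<kappa>]
    obtain q where q: "q \<in> arint (pick \<kappa>)" using fan_cone(3)[OF rF' k(1)] by blast
    have "q \<in> \<sigma>" using q arint_subset k(3) \<sigma>(2) by blast
    then obtain \<sigma>'' where \<sigma>'': "\<sigma>'' \<in> cones F'" "q \<in> \<sigma>''" "\<sigma>'' \<subseteq> \<sigma>" "span \<sigma>'' = span \<sigma>"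
      by (rule subdividing_cone_at[OF facet_cone[OF \<sigma>(1)]])
    have f: "\<sigma>'' \<in> facets F'" using facet_span_iff(1)[OF facet_cone[OF \<sigma>(1)] \<sigma>''(1,4)] \<sigma>(1) by blast
    have sub: "pick \<kappa> \<subseteq> \<sigma>''" using fan_arint_subset[OF rF' k(1) \<sigma>''(1) q \<sigma>''(2)] .
    have xk: "x \<in> span (pick \<kappa>)" using x k(4) by simp
    have x\<sigma>: "x \<in> span \<sigma>" using x span_mono[OF \<sigma>(2)] by blast
    have p'': "p \<in> \<sigma>''" using k(2) sub by blast
    have "G \<kappa> x = g \<sigma>'' x" unfolding G_def using local_family_compat[OF g k(1) \<sigma>''(1) k(5) sub xk] .
    also have "\<dots> = g \<sigma>' x"
      using forms_agree_in_facet[OF g gb \<eta>' p \<sigma>(1) f \<sigma>'(1) p'' \<sigma>'(2) \<sigma>''(3) \<sigma>'(3) x\<sigma>] .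
    finally show ?thesis .
  qed
  have pick_facet: "pick \<sigma> \<in> facets F'" if "\<sigma> \<in> facets F" "p \<in> \<sigma>" for \<sigma>
  proof -
    note k = pick[OF facet_cone[OF that(1)] that(2)]
    show ?thesis using facet_span_iff(1)[OF facet_cone[OF that(1)] k(1,4)] that(1) by blast
  qed
  have G: "local_family F \<zeta> G" unfolding local_family_def
  proof (intro conjI ballI impI)
    fix \<kappa> assume h: "\<kappa> \<in> cones F" "\<zeta> \<subseteq> \<kappa>"
    have pk: "p \<in> \<kappa>" using h(2) p\<zeta> by blast
    note k = pick[OF h(1) pk]
    show "linear (G \<kappa>)" unfolding G_def by (rule local_family_linear[OF g k(1,5)])
    show "G \<kappa> x \<in> \<rat>" if "x \<in> lat_of (lat F) \<kappa>" for x
      unfolding G_def using that by (intro local_family_rational[OF g k(1,5)]) (simp add: lat_of_def lat_eq k(4))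
  next
    fix \<kappa>1 \<kappa>2 x assume h: "\<kappa>1 \<in> cones F" "\<kappa>2 \<in> cones F" "\<zeta> \<subseteq> \<kappa>1" "\<kappa>1 \<subseteq> \<kappa>2" "x \<in> \<kappa>1"
    have pk: "p \<in> \<kappa>1" "p \<in> \<kappa>2" using h p\<zeta> by auto
    obtain \<sigma> where \<sigma>: "\<sigma> \<in> facets F" "\<kappa>2 \<subseteq> \<sigma>" by (rule cone_in_facet[OF F h(2)])
    have p\<sigma>: "p \<in> \<sigma>" using pk \<sigma> by blast
    note k = pick[OF facet_cone[OF \<sigma>(1)] p\<sigma>]
    have sub: "\<kappa>1 \<subseteq> \<sigma>" using h(4) \<sigma>(2) by blast
    have x: "x \<in> span \<kappa>1" "x \<in> span \<kappa>2" using h span_base by blast+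
    show "G \<kappa>1 x = G \<kappa>2 x"
      using key[OF h(1) pk(1) \<sigma>(1) sub pick_facet[OF \<sigma>(1) p\<sigma>] k(2,3) x(1)]
        key[OF h(2) pk(2) \<sigma> pick_facet[OF \<sigma>(1) p\<sigma>] k(2,3) x(2)] by simp
  qed
  have "balanced_at F \<tau> G" if \<tau>: "\<tau> \<in> ridges F" "\<zeta> \<subseteq> \<tau>" for \<tau>
  proof -
    have p\<tau>: "p \<in> \<tau>" using \<tau>(2) p\<zeta> by blast
    note k = pick[OF ridge_cone[OF \<tau>(1)] p\<tau>]
    have r': "pick \<tau> \<in> ridges F'" using facet_span_iff(2)[OF ridge_cone[OF \<tau>(1)] k(1,4)] \<tau>(1) by blast
    have "balanced_at F' (pick \<tau>) g \<longleftrightarrow> balanced_at F \<tau> G"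
    proof (rule balanced_ridge_iff[OF \<tau> k(1,3,4,5) G g])
      show "g (pick \<tau>) x = G \<tau> x" for x by (simp add: G_def)
      fix \<sigma> \<sigma>' x assume h: "\<sigma> \<in> facets F" "\<sigma>' \<in> facets F'" "\<tau> \<subseteq> \<sigma>" "pick \<tau> \<subseteq> \<sigma>'" "\<sigma>' \<subseteq> \<sigma>" "x \<in> span \<sigma>"
      have "p \<in> \<sigma>" "p \<in> \<sigma>'" using h k(2) p\<tau> by auto
      then show "g \<sigma>' x = G \<sigma> x"
        using key[OF facet_cone[OF h(1)] _ h(1) order_refl h(2) _ h(5,6)] by simp
    qed
    then show ?thesis using gb[OF r' k(5)] by blast
  qed
  then obtain L where L: "linear L" "\<And>\<sigma> x. \<sigma> \<in> cones F \<Longrightarrow> \<zeta> \<subseteq> \<sigma> \<Longrightarrow> x \<in> span \<sigma> \<Longrightarrow> G \<sigma> x = L x"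
    using local_faithfulD[OF lf[OF \<zeta>(1)] G] by blast
  have "g \<kappa>' x = L x" if h: "\<kappa>' \<in> cones F'" "\<eta>' \<subseteq> \<kappa>'" "x \<in> \<kappa>'" for \<kappa>' x
  proof -
    obtain \<sigma>' where \<sigma>': "\<sigma>' \<in> facets F'" "\<kappa>' \<subseteq> \<sigma>'" by (rule cone_in_facet[OF F' h(1)])
    obtain \<sigma> where \<sigma>: "\<sigma> \<in> facets F" "\<sigma>' \<subseteq> \<sigma>" by (rule in_facet[OF \<sigma>'(1)])
    have p': "p \<in> \<sigma>'" "p \<in> \<sigma>" using p\<eta>' h(2) \<sigma>'(2) \<sigma>(2) by auto
    have \<zeta>\<sigma>: "\<zeta> \<subseteq> \<sigma>" using fan_arint_subset[OF rF \<zeta>(1) facet_cone[OF \<sigma>(1)] \<zeta>(2) p'(2)] .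
    have x: "x \<in> span \<kappa>'" "x \<in> span \<sigma>" using h(3) \<sigma>'(2) \<sigma>(2) span_base by blast+
    have "g \<kappa>' x = g \<sigma>' x" using local_family_compat[OF g h(1) facet_cone[OF \<sigma>'(1)] h(2) \<sigma>'(2) x(1)] .
    also have "\<dots> = G \<sigma> x" using key[OF facet_cone[OF \<sigma>(1)] p'(2) \<sigma>(1) order_refl \<sigma>'(1) p'(1) \<sigma>(2) x(2)] by simp
    also have "\<dots> = L x" using L(2)[OF facet_cone[OF \<sigma>(1)] \<zeta>\<sigma> x(2)] .
    finally show ?thesis .
  qed
  then show "\<exists>L. linear L \<and> (\<forall>\<sigma>\<in>cones F'. \<eta>' \<subseteq> \<sigma> \<longrightarrow> (\<forall>x\<in>\<sigma>. g \<sigma> x = L x))" using L(1) by blast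
qed

theorem div_faithful_refinement: "div_faithful F' \<longleftrightarrow> div_faithful F"
  unfolding div_faithful_iff_local[OF F] div_faithful_iff_local[OF F']
  using local_faithful_coarse local_faithful_fine by blast

end

text \<open>The point to check is that no part of the support is lost. A point \<open>x\<close> of a
  cone containing \<open>\<sigma>\<close> is pushed in the direction \<open>- v\<close> as far as
  that cone permits; the end point lies on a face not containing \<open>\<sigma>\<close>, and
  \<open>x\<close> is recovered by adding a multiple of \<open>v\<close>.\<close>

lemma blow_up_refinement:
  assumes F: "tropical_fan F" and B: "tropical_fan (blow_up F \<sigma> \<rho>)" and \<rho>: "blow_up_ray F \<sigma> \<rho>"
  shows "fan_refinement F (blow_up F \<sigma> \<rho>)"
proof -
  have rF: "rational_fan F" using F tropical_rational by blast
  have \<sigma>: "\<sigma> \<in> cones F" using \<rho> by (simp add: blow_up_ray_def)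
  obtain v where v: "v \<noteq> 0" "\<rho> = {t *\<^sub>R v | t. t \<ge> 0}" using \<rho> unfolding blow_up_ray_def rational_ray_def by blast
  have "1 *\<^sub>R v \<in> \<rho>" unfolding v(2) by (intro CollectI exI[of _ 1]) simp
  then have v\<sigma>: "v \<in> \<sigma>" using \<rho> v(1) rel_interior_subset unfolding blow_up_ray_def by auto
  define J where "J \<tau> = {x + y | x y. x \<in> \<tau> \<and> y \<in> \<rho>}" for \<tau>
  have cB: "cones (blow_up F \<sigma> \<rho>) = {\<tau> \<in> cones F. \<not> \<sigma> \<subseteq> \<tau>} \<union>
     {J \<tau> | \<tau>. \<tau> \<in> cones F \<and> \<not> \<sigma> \<subseteq> \<tau> \<and> (\<exists>\<sigma>'\<in>cones F. \<sigma> \<subseteq> \<sigma>' \<and> cone_face \<tau> \<sigma>')}"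
    by (simp add: blow_up_def J_def)
  have J_sub: "J \<tau> \<subseteq> \<kappa>" if h: "\<kappa> \<in> cones F" "\<sigma> \<subseteq> \<kappa>" "\<tau> \<subseteq> \<kappa>" for \<tau> \<kappa>
  proof
    fix z assume "z \<in> J \<tau>"
    then obtain x t where z: "z = x + t *\<^sub>R v" "x \<in> \<tau>" "t \<ge> 0" unfolding J_def v(2) by blast
    have c: "convex_cone \<kappa>" using fan_cone(2)[OF rF h(1)] .
    show "z \<in> \<kappa>" unfolding z(1)
      by (intro convex_cone_add[OF c] convex_cone_scaleR[OF c]) (use z h v\<sigma> in auto)
  qed
  have in_cone: "\<exists>\<kappa>\<in>cones F. \<kappa>' \<subseteq> \<kappa>" if "\<kappa>' \<in> cones (blow_up F \<sigma> \<rho>)" for \<kappa>'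
  proof -
    consider "\<kappa>' \<in> cones F" | \<tau> \<sigma>' where "\<kappa>' = J \<tau>" "\<sigma>' \<in> cones F" "\<sigma> \<subseteq> \<sigma>'" "cone_face \<tau> \<sigma>'"
      using \<open>\<kappa>' \<in> cones (blow_up F \<sigma> \<rho>)\<close> unfolding cB by blast
    then show ?thesis
    proof cases
      case 2
      have "\<tau> \<subseteq> \<sigma>'" using 2(4) face_of_imp_subset unfolding cone_face_def by blast
      then show ?thesis using J_sub[OF 2(2,3)] 2(1,2) by blast
    qed blast
  qed
  have sup: "x \<in> support (blow_up F \<sigma> \<rho>)" if x: "x \<in> support F" for x
  proof -
    obtain \<kappa> where \<kappa>: "\<kappa> \<in> cones F" "x \<in> \<kappa>" using x by (auto simp: support_def)
    show ?thesis
    proof (cases "\<sigma> \<subseteq> \<kappa>")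
      case False
      then have "\<kappa> \<in> cones (blow_up F \<sigma> \<rho>)" using \<kappa>(1) unfolding cB by blast
      then show ?thesis using \<kappa>(2) by (auto simp: support_def)
    next
      case True
      have c: "convex_cone \<kappa>" using fan_cone(2)[OF rF \<kappa>(1)] .
      have v\<kappa>: "v \<in> \<kappa>" using True v\<sigma> by blast
      have cl: "closed \<kappa>" using fan_cone(6)[OF rF \<kappa>(1)] .
      define S where "S = {0..} \<inter> (\<lambda>t. x - t *\<^sub>R v) -` \<kappa>"
      have "closed S" unfolding S_def
        by (rule continuous_closed_preimage) (auto intro!: continuous_intros cl)
      \<comment> \<open>If the push never ended, rescaling and passing to the limit would give
        \<open>- v \<in> \<kappa>\<close>, contrary to strong convexity.\<close>
      have "\<exists>n. x - real (Suc n) *\<^sub>R v \<notin> \<kappa>"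
      proof (rule ccontr)
        assume "\<not> ?thesis"
        then have all: "x - real (Suc n) *\<^sub>R v \<in> \<kappa>" for n by blast
        have mem: "inverse (real (Suc n)) *\<^sub>R x - v \<in> \<kappa>" for n
        proof -
          have "inverse (real (Suc n)) *\<^sub>R (x - real (Suc n) *\<^sub>R v) \<in> \<kappa>"
            by (rule convex_cone_scaleR[OF c _ all]) simp
          then show ?thesis by (simp add: scaleR_diff_right del: of_nat_Suc)
        qed
        have "(\<lambda>n. inverse (real (Suc n)) *\<^sub>R x - v) \<longlonglongrightarrow> 0 *\<^sub>R x - v"
          by (intro tendsto_intros LIMSEQ_inverse_real_of_nat)
        then have "0 *\<^sub>R x - v \<in> \<kappa>" by (rule closed_sequentially[OF cl mem])
        then show False using strongly_convex_D[OF fan_cone(5)[OF rF \<kappa>(1)] v\<kappa>] v(1) by simp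
      qed
      then obtain n where n: "x - real (Suc n) *\<^sub>R v \<notin> \<kappa>" by blast
      have "S \<subseteq> {0..real (Suc n)}"
      proof
        fix t assume t: "t \<in> S"
        have "\<not> t > real (Suc n)"
        proof
          assume "t > real (Suc n)"
          then show False using cone_sub_mono[OF c v\<kappa>, of x t "real (Suc n)"] t n by (simp add: S_def)
        qed
        then show "t \<in> {0..real (Suc n)}" using t by (simp add: S_def)
      qed
      then have "compact S" using \<open>closed S\<close> compact_eq_bounded_closed bounded_subset bounded_closed_interval by metis
      moreover have "0 \<in> S" using \<kappa>(2) by (simp add: S_def)
      ultimately obtain s where s: "s \<in> S" "\<forall>t\<in>S. t \<le> s" using compact_attains_sup[of S] by blast
      define z where "z = x - s *\<^sub>R v"
      have z: "z \<in> \<kappa>" using s(1) by (simp add: S_def z_def)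
      have s0: "s \<ge> 0" using s(1) by (simp add: S_def)
      \<comment> \<open>\<open>\<tau>\<close> is the smallest face of \<open>\<kappa>\<close>
        through the end point \<open>z\<close>. It does not contain \<open>v\<close>, since
        otherwise \<open>z\<close> could be pushed further; hence it does not contain
        \<open>\<sigma>\<close> and gives rise to one of the new cones.\<close>
      define \<tau> where "\<tau> = {y \<in> \<kappa>. \<exists>e>0. z - e *\<^sub>R y \<in> \<kappa>}"
      have face: "cone_face \<tau> \<kappa>" "z \<in> \<tau>" using minimal_face[OF c z] arint_subset unfolding \<tau>_def by blast+
      have "v \<notin> \<tau>"
      proof
        assume "v \<in> \<tau>"
        then obtain e where e: "e > 0" "z - e *\<^sub>R v \<in> \<kappa>" unfolding \<tau>_def by blast
        have "z - e *\<^sub>R v = x - (s + e) *\<^sub>R v" by (simp add: z_def algebra_simps)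
        then have "s + e \<in> S" using e s0 by (simp add: S_def)
        then show False using s(2) e(1) by fastforce
      qed
      then have "\<not> \<sigma> \<subseteq> \<tau>" using v\<sigma> by blast
      moreover have "\<tau> \<in> cones F" using rF \<kappa>(1) face(1) unfolding rational_fan_def by blast
      ultimately have "J \<tau> \<in> cones (blow_up F \<sigma> \<rho>)" unfolding cB using \<kappa>(1) True face(1) by blast
      moreover have "x = z + s *\<^sub>R v" by (simp add: z_def)
      then have "x \<in> J \<tau>" unfolding J_def v(2) using face(2) s0 by blast
      ultimately show ?thesis by (auto simp: support_def)
    qed
  qed
  show ?thesis
  proof
    show "tropical_fan F" "tropical_fan (blow_up F \<sigma> \<rho>)" by (fact F B)+
    show "lat (blow_up F \<sigma> \<rho>) = lat F" by (simp add: blow_up_def)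
    show "support (blow_up F \<sigma> \<rho>) = support F"
    proof
      show "support (blow_up F \<sigma> \<rho>) \<subseteq> support F" using in_cone unfolding support_def by blast
    qed (use sup in blast)
  qed (fact in_cone)
qed

theorem theorem6p9:
  shows "shellable_in {F. tropical_fan F} div_faithful"
  unfolding shellable_in_def
proof (intro equalityI subsetI)
  fix F assume "F \<in> Sh {F. tropical_fan F} {F \<in> {F. tropical_fan F}. div_faithful F}"
  \<comment> \<open>The rules for isomorphisms, products and modifications ask for membership in the
    class only of the resulting fan; that the ingredients are tropical has to be carried along in
    the induction.\<close>
  then have "tropical_fan F \<and> div_faithful F"
  proof (induction rule: Sh.induct)
    case (iso F G)
    then show ?case using div_faithful_iso by blast
  next
    case (product F G)
    then show ?case using div_faithful_prod by blast
  next
    case (modification_reduced F f)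
    then show ?case using div_faithful_trop_mod_reduced by blast
  next
    case (modification_trivial F f)
    then show ?case using div_faithful_trop_mod_trivial by blast
  next
    case (blow_up F \<sigma> \<rho>)
    then show ?case using fan_refinement.div_faithful_refinement[OF blow_up_refinement] by blast
  next
    case (blow_down F \<sigma> \<rho>)
    then show ?case using fan_refinement.div_faithful_refinement[OF blow_up_refinement] by blast
  qed simp
  then show "F \<in> {F \<in> {F. tropical_fan F}. div_faithful F}" by simp
qed (auto intro: Sh.base)

end
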